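(* Let $\mathcal{X}$ and $\mathcal{Y}$ be complex Banach spaces. Let $A$ be a unital closed subalgebra of $\mathcal{B}(\mathcal{X})$ containing all finite rank operators on $\mathcal{X}$, and let $B$ be a unital closed subalgebra of $\mathcal{B}(\mathcal{Y})$ containing all finite rank operators on $\mathcal{Y}$. Suppose that $T$ is a surjective isometry from an open subgroup $\mathfrak{A}$ of $A^{-1}$ onto an open subgroup $\mathfrak{B}$ of $B^{-1}$, i.e. $T$ is surjective and $\|T(a)-T(b)\|=\|a-b\|$ for all $a,b\in\mathfrak{A}$. Then either there exists an invertible bounded linear or conjugate linear operator $U:\mathcal{X}\to\mathcal{Y}$ such that $T(a)=T(e_A)UaU^{-1}$ for every $a\in\mathfrak{A}$, or there exists an invertible bounded linear or conjugate linear operator $V:\mathcal{X}^*\to\mathcal{Y}$ such that $T(a)=T(e_A)Va^*V^{-1}$ for every $a\in\mathfrak{A}$. In particular, if $T$ is unital in the sense that $T(e_A)=e_B$, then $T$ is multiplicative (in this case, $A^{-1}$ is isometrically isomorphic to $B^{-1}$ as a metrizable group) or anti-multiplicative (in this case, $A^{-1}$ is isometrically anti-isomorphic to $B^{-1}$ as a metrizable group).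
   Context: $\mathcal{B}(\mathcal{X})$ is the Banach algebra of all bounded linear operators on $\mathcal{X}$ with the operator norm, $\mathcal{X}^*$ is the dual Banach space, and $a^*:\mathcal{X}^*\to\mathcal{X}^*$ is the (Banach space) adjoint of $a\in\mathcal{B}(\mathcal{X})$. $A^{-1}$ is the multiplicative group of invertible elements of $A$ with the norm metric, and $e_A$, $e_B$ are the units of $A$, $B$. Isometrically isomorphic (respectively anti-isomorphic) as metrizable groups means that there is a group isomorphism (respectively anti-isomorphism) from one group onto the other that preserves the norm distance. Multiplicative means $T(ab)=T(a)T(b)$, and anti-multiplicative means $T(ab)=T(b)T(a)$, for all $a,b\in\mathfrak{A}$. The map $T$ is not assumed to be linear or multiplicative. *)

theory Defs
  imports "HOL-Analysis.Analysis" "HOL-Algebra.Group"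
begin

section \<open>Complex Banach spaces\<close>

class complex_vector = real_vector +
  fixes scaleC :: "complex \<Rightarrow> 'a \<Rightarrow> 'a" (infixr "*\<^sub>C" 75)
  assumes scaleC_add_right: "c *\<^sub>C (x + y) = c *\<^sub>C x + c *\<^sub>C y"
    and scaleC_add_left: "(c + d) *\<^sub>C x = c *\<^sub>C x + d *\<^sub>C x"
    and scaleC_scaleC: "c *\<^sub>C d *\<^sub>C x = (c * d) *\<^sub>C x"
    and scaleC_of_real: "complex_of_real r *\<^sub>C x = r *\<^sub>R x"

class complex_normed_vector = complex_vector + real_normed_vector +
  assumes norm_scaleC: "norm (c *\<^sub>C x) = cmod c * norm x"

class complex_banach = complex_normed_vector + banach

lemma scaleC_one [simp]: "1 *\<^sub>C (x :: 'a :: complex_vector) = x"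
  using scaleC_of_real[of 1 x] by simp

lemma scaleC_scaleR: "c *\<^sub>C r *\<^sub>R x = r *\<^sub>R c *\<^sub>C (x :: 'a :: complex_vector)"
  by (simp add: scaleC_of_real[symmetric] scaleC_scaleC mult.commute)

lemma scaleC_zero_right [simp]: "c *\<^sub>C (0 :: 'a :: complex_vector) = 0"
  using scaleC_add_right[of c "0 :: 'a" 0] by simp

lemma scaleC_minus_right: "c *\<^sub>C (- x) = - (c *\<^sub>C (x :: 'a :: complex_vector))"
  using scaleC_scaleR[of c "-1" x] by simp

lemma scaleC_diff_right: "c *\<^sub>C (x - y) = c *\<^sub>C x - c *\<^sub>C (y :: 'a :: complex_vector)"
  using scaleC_add_right[of c x "- y"] by (simp add: scaleC_minus_right)

lemma bounded_linear_scaleC: "bounded_linear ((*\<^sub>C) c :: 'a :: complex_normed_vector \<Rightarrow> 'a)"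
  by (rule bounded_linear_intro[where K = "cmod c"])
    (simp_all add: scaleC_add_right scaleC_scaleR norm_scaleC)

global_interpretation complex_vector: vector_space "scaleC :: complex \<Rightarrow> 'a \<Rightarrow> 'a :: complex_vector"
  defines csubspace = complex_vector.subspace
    and cspan = complex_vector.span
  by unfold_locales (simp_all add: scaleC_add_right scaleC_add_left scaleC_scaleC)

instantiation complex :: complex_banach
begin

definition scaleC_complex :: "complex \<Rightarrow> complex \<Rightarrow> complex" where
  "scaleC_complex c x = c * x"

instance
  by standard (simp_all add: scaleC_complex_def algebra_simps norm_mult scaleR_conv_of_real)

end


section \<open>Bounded complex linear and conjugate linear operators\<close>

text \<open>\<open>bounded_linear\<close> is real linearity together with boundedness.\<close>

definition bounded_clinear :: "('a::complex_normed_vector \<Rightarrow> 'b::complex_normed_vector) \<Rightarrow> bool" where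
  "bounded_clinear f \<longleftrightarrow> bounded_linear f \<and> (\<forall>c x. f (c *\<^sub>C x) = c *\<^sub>C f x)"

definition bounded_conj_linear :: "('a::complex_normed_vector \<Rightarrow> 'b::complex_normed_vector) \<Rightarrow> bool" where
  "bounded_conj_linear f \<longleftrightarrow> bounded_linear f \<and> (\<forall>c x. f (c *\<^sub>C x) = cnj c *\<^sub>C f x)"

definition invertible_operator :: "('a::complex_normed_vector \<Rightarrow> 'b::complex_normed_vector) \<Rightarrow> bool" where
  "invertible_operator f \<longleftrightarrow> bij f \<and> bounded_linear f \<and> bounded_linear (inv_into UNIV f)"

text \<open>The Banach space of bounded complex linear operators, as a subspace of the space of
  bounded real linear operators; it inherits the operator norm.\<close>

typedef (overloaded) ('a, 'b) cblinfun ("(_ \<Rightarrow>\<^sub>C\<^sub>L /_)" [22, 21] 21) =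
  "{f :: 'a::complex_normed_vector \<Rightarrow>\<^sub>L 'b::complex_normed_vector. bounded_clinear (blinfun_apply f)}"
  by (rule exI[of _ 0]) (simp add: bounded_clinear_def blinfun.bounded_linear_right)

setup_lifting type_definition_cblinfun

lift_definition cblinfun_apply :: "('a::complex_normed_vector \<Rightarrow>\<^sub>C\<^sub>L 'b::complex_normed_vector) \<Rightarrow> 'a \<Rightarrow> 'b"
  is blinfun_apply .

instantiation cblinfun :: (complex_normed_vector, complex_normed_vector) complex_normed_vector
begin

lift_definition norm_cblinfun :: "'a \<Rightarrow>\<^sub>C\<^sub>L 'b \<Rightarrow> real" is norm .

lift_definition zero_cblinfun :: "'a \<Rightarrow>\<^sub>C\<^sub>L 'b" is 0
  by (simp add: bounded_clinear_def blinfun.bounded_linear_right)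

lift_definition plus_cblinfun :: "'a \<Rightarrow>\<^sub>C\<^sub>L 'b \<Rightarrow> 'a \<Rightarrow>\<^sub>C\<^sub>L 'b \<Rightarrow> 'a \<Rightarrow>\<^sub>C\<^sub>L 'b" is "(+)"
  by (simp add: bounded_clinear_def blinfun.bounded_linear_right blinfun.add_left scaleC_add_right)

lift_definition minus_cblinfun :: "'a \<Rightarrow>\<^sub>C\<^sub>L 'b \<Rightarrow> 'a \<Rightarrow>\<^sub>C\<^sub>L 'b \<Rightarrow> 'a \<Rightarrow>\<^sub>C\<^sub>L 'b" is "(-)"
  by (simp add: bounded_clinear_def blinfun.bounded_linear_right blinfun.diff_left scaleC_diff_right)

lift_definition uminus_cblinfun :: "'a \<Rightarrow>\<^sub>C\<^sub>L 'b \<Rightarrow> 'a \<Rightarrow>\<^sub>C\<^sub>L 'b" is "uminus"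
  by (simp add: bounded_clinear_def blinfun.bounded_linear_right blinfun.minus_left scaleC_minus_right)

lift_definition scaleR_cblinfun :: "real \<Rightarrow> 'a \<Rightarrow>\<^sub>C\<^sub>L 'b \<Rightarrow> 'a \<Rightarrow>\<^sub>C\<^sub>L 'b" is "scaleR"
  by (simp add: bounded_clinear_def blinfun.bounded_linear_right blinfun.scaleR_left scaleC_scaleR)

lift_definition scaleC_cblinfun :: "complex \<Rightarrow> 'a \<Rightarrow>\<^sub>C\<^sub>L 'b \<Rightarrow> 'a \<Rightarrow>\<^sub>C\<^sub>L 'b"
  is "\<lambda>c f. blinfun_compose (Blinfun ((*\<^sub>C) c)) f"
  by (simp add: bounded_clinear_def blinfun.bounded_linear_right
      bounded_linear_Blinfun_apply bounded_linear_scaleC scaleC_scaleC mult.commute)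

definition sgn_cblinfun :: "'a \<Rightarrow>\<^sub>C\<^sub>L 'b \<Rightarrow> 'a \<Rightarrow>\<^sub>C\<^sub>L 'b"
  where "sgn_cblinfun x = scaleR (inverse (norm x)) x"

definition dist_cblinfun :: "'a \<Rightarrow>\<^sub>C\<^sub>L 'b \<Rightarrow> 'a \<Rightarrow>\<^sub>C\<^sub>L 'b \<Rightarrow> real"
  where "dist_cblinfun a b = norm (a - b)"

definition [code del]:
  "(uniformity :: (('a \<Rightarrow>\<^sub>C\<^sub>L 'b) \<times> ('a \<Rightarrow>\<^sub>C\<^sub>L 'b)) filter)
    = (INF e\<in>{0 <..}. principal {(x, y). dist x y < e})"

definition open_cblinfun :: "('a \<Rightarrow>\<^sub>C\<^sub>L 'b) set \<Rightarrow> bool"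
  where [code del]: "open_cblinfun S = (\<forall>x\<in>S. \<forall>\<^sub>F (x', y) in uniformity. x' = x \<longrightarrow> y \<in> S)"

instance
proof
  fix f g h :: "'a \<Rightarrow>\<^sub>C\<^sub>L 'b" and c d :: complex and r s :: real
  note C = bounded_linear_Blinfun_apply[OF bounded_linear_scaleC]
  show "dist f g = norm (f - g)" by (rule dist_cblinfun_def)
  show "sgn f = inverse (norm f) *\<^sub>R f" by (rule sgn_cblinfun_def)
  show "(uniformity :: (('a \<Rightarrow>\<^sub>C\<^sub>L 'b) \<times> ('a \<Rightarrow>\<^sub>C\<^sub>L 'b)) filter)
    = (INF e\<in>{0 <..}. principal {(x, y). dist x y < e})"
    by (rule uniformity_cblinfun_def)
  show "open S = (\<forall>x\<in>S. \<forall>\<^sub>F (x', y) in uniformity. x' = x \<longrightarrow> y \<in> S)" for S :: "('a \<Rightarrow>\<^sub>C\<^sub>L 'b) set"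
    by (rule open_cblinfun_def)
  show "f + g + h = f + (g + h)" by transfer (simp add: add.assoc)
  show "f + g = g + f" by transfer (simp add: add.commute)
  show "0 + f = f" by transfer simp
  show "- f + f = 0" by transfer simp
  show "f - g = f + - g" by transfer simp
  show "r *\<^sub>R (f + g) = r *\<^sub>R f + r *\<^sub>R g" by transfer (simp add: scaleR_add_right)
  show "(r + s) *\<^sub>R f = r *\<^sub>R f + s *\<^sub>R f" by transfer (simp add: scaleR_add_left)
  show "r *\<^sub>R s *\<^sub>R f = (r * s) *\<^sub>R f" by transfer simp
  show "1 *\<^sub>R f = f" by transfer simp
  show "norm f = 0 \<longleftrightarrow> f = 0" by transfer simp
  show "norm (f + g) \<le> norm f + norm g" by transfer (rule norm_triangle_ineq)
  show "norm (r *\<^sub>R f) = \<bar>r\<bar> * norm f" by transfer simp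
  show "c *\<^sub>C (f + g) = c *\<^sub>C f + c *\<^sub>C g"
    by transfer (auto intro!: blinfun_eqI simp: C blinfun.add_left scaleC_add_right)
  show "(c + d) *\<^sub>C f = c *\<^sub>C f + d *\<^sub>C f"
    by transfer (auto intro!: blinfun_eqI simp: C blinfun.add_left scaleC_add_left)
  show "c *\<^sub>C d *\<^sub>C f = (c * d) *\<^sub>C f"
    by transfer (auto intro!: blinfun_eqI simp: C scaleC_scaleC)
  show "complex_of_real r *\<^sub>C f = r *\<^sub>R f"
    by transfer (auto intro!: blinfun_eqI simp: C blinfun.scaleR_left scaleC_of_real)
  show "norm (c *\<^sub>C f) = cmod c * norm f"
  proof (transfer fixing: c)
    fix f :: "'a \<Rightarrow>\<^sub>L 'b"
    let ?g = "\<lambda>c. blinfun_compose (Blinfun ((*\<^sub>C) c)) f"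
    have le: "norm (blinfun_compose (Blinfun ((*\<^sub>C) c)) f) \<le> cmod c * norm f"
      for c and f :: "'a \<Rightarrow>\<^sub>L 'b"
      by (rule norm_blinfun_bound)
        (auto simp: C norm_scaleC mult.assoc intro!: mult_left_mono norm_blinfun)
    show "norm (?g c) = cmod c * norm f"
    proof (cases "c = 0")
      case True
      then show ?thesis using le[of c f] by simp
    next
      case False
      then have "blinfun_compose (Blinfun ((*\<^sub>C) (inverse c))) (?g c) = f"
        by (intro blinfun_eqI) (simp add: C scaleC_scaleC)
      then have "norm f \<le> cmod (inverse c) * norm (?g c)"
        using le[of "inverse c" "?g c"] by simp
      then have "cmod c * norm f \<le> norm (?g c)"
        using False by (simp add: norm_divide norm_inverse field_simps)
      with le[of c f] show ?thesis by simp
    qed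
  qed
qed

end

lemma cblinfun_eqI: "(\<And>x. cblinfun_apply f x = cblinfun_apply g x) \<Longrightarrow> f = g"
  by transfer (rule blinfun_eqI)

lemma bounded_clinear_cblinfun_apply: "bounded_clinear (cblinfun_apply f)"
  by transfer simp

lemma cblinfun_apply_arith:
  "cblinfun_apply 0 x = 0"
  "cblinfun_apply (f + g) x = cblinfun_apply f x + cblinfun_apply g x"
  "cblinfun_apply (f - g) x = cblinfun_apply f x - cblinfun_apply g x"
  "cblinfun_apply (- f) x = - cblinfun_apply f x"
  "cblinfun_apply (r *\<^sub>R f) x = r *\<^sub>R cblinfun_apply f x"
  "cblinfun_apply (c *\<^sub>C f) x = c *\<^sub>C cblinfun_apply f x"
  by (transfer; simp add: blinfun.bilinear_simps
      bounded_linear_Blinfun_apply[OF bounded_linear_scaleC])+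

lemma norm_cblinfun_eq_onorm: "norm f = onorm (cblinfun_apply f)"
  by transfer (rule norm_blinfun.rep_eq)

instance cblinfun :: (complex_normed_vector, complex_banach) complex_banach
proof
  fix X :: "nat \<Rightarrow> 'a \<Rightarrow>\<^sub>C\<^sub>L 'b"
  assume X: "Cauchy X"
  define Y where "Y n = Rep_cblinfun (X n)" for n
  have dist_Rep: "dist (Rep_cblinfun f) (Rep_cblinfun g) = dist f g" for f g :: "'a \<Rightarrow>\<^sub>C\<^sub>L 'b"
    by (simp add: dist_norm norm_cblinfun.rep_eq minus_cblinfun.rep_eq)
  have "Cauchy Y"
    using X by (simp add: Cauchy_def Y_def dist_Rep)
  then obtain L where L: "Y \<longlonglongrightarrow> L"
    using Cauchy_convergent convergent_def by blast
  have lim: "(\<lambda>n. Y n x) \<longlonglongrightarrow> L x" for x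
    by (intro blinfun.tendsto L tendsto_const)
  have "L (c *\<^sub>C x) = c *\<^sub>C L x" for c x
  proof (rule LIMSEQ_unique)
    show "(\<lambda>n. Y n (c *\<^sub>C x)) \<longlonglongrightarrow> L (c *\<^sub>C x)" by (rule lim)
    have "Y n (c *\<^sub>C x) = c *\<^sub>C Y n x" for n
      using Rep_cblinfun[of "X n"] by (simp add: Y_def bounded_clinear_def)
    then show "(\<lambda>n. Y n (c *\<^sub>C x)) \<longlonglongrightarrow> c *\<^sub>C L x"
      using bounded_linear.tendsto[OF bounded_linear_scaleC lim] by simp
  qed
  then have "bounded_clinear (blinfun_apply L)"
    by (simp add: bounded_clinear_def blinfun.bounded_linear_right)
  then have Rep_L: "Rep_cblinfun (Abs_cblinfun L) = L"
    by (simp add: Abs_cblinfun_inverse)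
  have "X \<longlonglongrightarrow> Abs_cblinfun L"
    using L unfolding lim_sequentially Y_def
    by (subst (asm) Rep_L[symmetric]) (simp add: dist_Rep)
  then show "convergent X" by (auto simp: convergent_def)
qed

lift_definition cblinfun_id :: "'a::complex_normed_vector \<Rightarrow>\<^sub>C\<^sub>L 'a" is id_blinfun
  by (simp add: bounded_clinear_def blinfun.bounded_linear_right)

lift_definition cblinfun_compose ::
    "('b::complex_normed_vector \<Rightarrow>\<^sub>C\<^sub>L 'c::complex_normed_vector) \<Rightarrow>
     ('a::complex_normed_vector \<Rightarrow>\<^sub>C\<^sub>L 'b) \<Rightarrow> ('a \<Rightarrow>\<^sub>C\<^sub>L 'c)" (infixl "o\<^sub>C\<^sub>L" 67)
  is blinfun_compose
  by (simp add: bounded_clinear_def blinfun.bounded_linear_right)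

lemma cblinfun_apply_id [simp]: "cblinfun_apply cblinfun_id x = x"
  by transfer simp

lemma cblinfun_apply_compose [simp]:
  "cblinfun_apply (f o\<^sub>C\<^sub>L g) x = cblinfun_apply f (cblinfun_apply g x)"
  by transfer simp

lemma norm_cblinfun_compose: "norm (f o\<^sub>C\<^sub>L g) \<le> norm f * norm g"
  by transfer (rule norm_blinfun_compose)

type_synonym 'a dual = "'a \<Rightarrow>\<^sub>C\<^sub>L complex"

text \<open>The Banach space adjoint \<open>a\<^sup>* \<phi> = \<phi> \<circ> a\<close>.\<close>

lift_definition cblinfun_adjoint ::
    "('a::complex_normed_vector \<Rightarrow>\<^sub>C\<^sub>L 'b::complex_normed_vector) \<Rightarrow> ('b dual \<Rightarrow>\<^sub>C\<^sub>L 'a dual)"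
  is "\<lambda>a. Blinfun (\<lambda>\<phi>. \<phi> o\<^sub>C\<^sub>L a)"
proof -
  fix a :: "'a \<Rightarrow>\<^sub>C\<^sub>L 'b"
  have bl: "bounded_linear (\<lambda>\<phi> :: 'b dual. \<phi> o\<^sub>C\<^sub>L a)"
    by (rule bounded_linear_intro[where K = "norm a"])
      (auto intro!: cblinfun_eqI norm_cblinfun_compose simp: cblinfun_apply_arith)
  show "bounded_clinear (blinfun_apply (Blinfun (\<lambda>\<phi> :: 'b dual. \<phi> o\<^sub>C\<^sub>L a)))"
    unfolding bounded_linear_Blinfun_apply[OF bl]
    by (auto intro!: cblinfun_eqI simp: bounded_clinear_def bl cblinfun_apply_arith)
qed

lemma cblinfun_apply_adjoint [simp]: "cblinfun_apply (cblinfun_adjoint a) \<phi> = \<phi> o\<^sub>C\<^sub>L a"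
proof -
  have bl: "bounded_linear (\<lambda>\<phi> :: 'b dual. \<phi> o\<^sub>C\<^sub>L a)"
    by (rule bounded_linear_intro[where K = "norm a"])
      (auto intro!: cblinfun_eqI norm_cblinfun_compose simp: cblinfun_apply_arith)
  show ?thesis
    by (simp add: cblinfun_apply.rep_eq cblinfun_adjoint.rep_eq bounded_linear_Blinfun_apply[OF bl])
qed

definition finite_rank :: "('a::complex_normed_vector \<Rightarrow>\<^sub>C\<^sub>L 'b::complex_normed_vector) \<Rightarrow> bool" where
  "finite_rank f \<longleftrightarrow> (\<exists>S. finite S \<and> range (cblinfun_apply f) \<subseteq> cspan S)"


section \<open>Operator algebras and their groups of invertible elements\<close>

definition unital_closed_subalgebra :: "('a::complex_normed_vector \<Rightarrow>\<^sub>C\<^sub>L 'a) set \<Rightarrow> bool" where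
  "unital_closed_subalgebra A \<longleftrightarrow>
     csubspace A \<and> (\<forall>a\<in>A. \<forall>b\<in>A. a o\<^sub>C\<^sub>L b \<in> A) \<and> cblinfun_id \<in> A \<and> closed A"

text \<open>The group of those elements of \<open>A\<close> that have an inverse belonging to \<open>A\<close>.\<close>

definition invertible_group :: "('a::complex_normed_vector \<Rightarrow>\<^sub>C\<^sub>L 'a) set \<Rightarrow> ('a \<Rightarrow>\<^sub>C\<^sub>L 'a) monoid" where
  "invertible_group A = units_of \<lparr>carrier = A, mult = (o\<^sub>C\<^sub>L), one = cblinfun_id\<rparr>"

definition open_subgroup :: "'a::topological_space set \<Rightarrow> ('a, 'b) monoid_scheme \<Rightarrow> bool" where
  "open_subgroup H G \<longleftrightarrow> subgroup H G \<and> openin (top_of_set (carrier G)) H"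

definition anti_iso :: "('a, 'c) monoid_scheme \<Rightarrow> ('b, 'd) monoid_scheme \<Rightarrow> ('a \<Rightarrow> 'b) set" where
  "anti_iso G H = {h. bij_betw h (carrier G) (carrier H) \<and>
     (\<forall>x\<in>carrier G. \<forall>y\<in>carrier G. h (x \<otimes>\<^bsub>G\<^esub> y) = h y \<otimes>\<^bsub>H\<^esub> h x)}"

definition norm_isometry_on :: "'a::real_normed_vector set \<Rightarrow> ('a \<Rightarrow> 'b::real_normed_vector) \<Rightarrow> bool" where
  "norm_isometry_on S h \<longleftrightarrow> (\<forall>x\<in>S. \<forall>y\<in>S. norm (h x - h y) = norm (x - y))"

definition isometrically_isomorphic ::
    "('a::real_normed_vector, 'c) monoid_scheme \<Rightarrow> ('b::real_normed_vector, 'd) monoid_scheme \<Rightarrow> bool" where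
  "isometrically_isomorphic G H \<longleftrightarrow> (\<exists>h \<in> iso G H. norm_isometry_on (carrier G) h)"

definition isometrically_anti_isomorphic ::
    "('a::real_normed_vector, 'c) monoid_scheme \<Rightarrow> ('b::real_normed_vector, 'd) monoid_scheme \<Rightarrow> bool" where
  "isometrically_anti_isomorphic G H \<longleftrightarrow> (\<exists>h \<in> anti_iso G H. norm_isometry_on (carrier G) h)"

end

theory Submission
  imports Defs
begin

text \<open>Write \<open>e\<close> for an identity operator and \<open>G\<close>, \<open>H\<close> for the open groups \<open>GA\<close>, \<open>GB\<close>. The argument has a metric half, which extends \<open>T\<close> to a map
\<open>D\<close> of the whole algebra \<open>A\<close>, and an algebraic half, which recovers the form of \<open>D\<close> from the operators
of rank one.

Metric half. The midpoint argument of Mazur and Ulam needs only small balls, so \<open>T\<close> has the form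
\<open>T x = D x + c\<close> near \<open>e\<close>, with an additive isometry \<open>D\<close> of \<open>A\<close> onto \<open>B\<close>
(\<open>isometry_of_balls_affine\<close>). The pair \<open>(D, c)\<close> is constant along connected subsets of \<open>G\<close>, hence it
is also the right one at \<open>\<mu> e + a\<close> whenever \<open>\<bar>\<mu>\<bar>\<close> is large. Now let \<open>a\<close> be any point of \<open>G\<close>, possibly
in another component. Comparing \<open>T a\<close> with the values of \<open>T\<close> at these remote points shows that
\<open>z = D\<^sup>-\<^sup>1 (T a - c) - a\<close> satisfies \<open>\<parallel>z - \<mu> e\<parallel> \<le> \<bar>\<mu>\<bar>\<close> for all large \<open>\<mu>\<close>. Since \<open>e\<close> is
a vertex of the unit ball (\<open>identity_is_vertex_of_unit_ball\<close>), \<open>z = 0\<close>, and so \<open>T a = D a + c\<close>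
on all of \<open>G\<close>. Finally \<open>c = 0\<close>: halving \<open>T (2 a) = 2 D a + c\<close> shows that \<open>b - c/2\<close> is invertible for
every \<open>b \<in> H\<close>, whereas, if \<open>c x \<noteq> 0\<close>, some \<open>b \<in> H\<close> has \<open>b x = c x / 2\<close>.

Algebraic half. Put \<open>S = T(e)\<^sup>-\<^sup>1 D\<close>; it is additive, maps \<open>e\<close> to \<open>e\<close> and \<open>G\<close> onto \<open>H\<close>. Rank at most one can be
read off from \<open>G\<close>: it means that no \<open>a \<in> G\<close> has both \<open>a - R \<notin> G\<close> and \<open>a - 2 R \<notin> G\<close>
(\<open>dyadic_iff_G\<close>). So \<open>S\<close> preserves the dyads \<open>x \<otimes> \<phi>\<close>, that is the maps \<open>v \<mapsto> \<phi>(v) x\<close>, and it carries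
the two families of maximal spaces of dyads, fixed \<open>\<phi>\<close> or fixed \<open>x\<close>, to the two families on the other side, either
preserving or exchanging the families. The two spaces through a dyad meet in its complex multiples, which the
isometry \<open>D\<close> therefore maps to multiples of the image, with the same or with the conjugate factor.
Because \<open>a - x \<otimes> \<phi>\<close> fails to be invertible exactly when \<open>\<phi>(a\<^sup>-\<^sup>1 x) = 1\<close>, the numbers \<open>\<phi>(a\<^sup>-\<^sup>1 x)\<close> are
preserved as well, up to that conjugation (\<open>trace_formula\<close>). From them one reads off
\<open>S(a) U = U a\<close>, where \<open>U\<close> is the map \<open>S\<close> induces on the first factor of the dyads with fixed \<open>\<phi>\<close>, or, if
the families are exchanged, \<open>S(a) V = V a\<^sup>*\<close>, where \<open>V\<close> is the map \<open>S\<close> induces on the functionals of the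
dyads with fixed \<open>x\<close>. Both cases are one computation (\<open>intertwining_operator\<close>).

If \<open>T\<close> is unital these formulas make it multiplicative or anti-multiplicative, and \<open>D\<close> inherits the property
because every element of \<open>A\<close> is a difference of two elements of \<open>G\<close>; so \<open>D\<close> is the isometry between the full
groups of invertible elements.\<close>

section \<open>Bounded functionals separate points\<close>

definition sublinear :: "('a::real_vector \<Rightarrow> real) \<Rightarrow> bool" where
  "sublinear p \<longleftrightarrow> (\<forall>x y. p (x + y) \<le> p x + p y) \<and> (\<forall>t x. 0 \<le> t \<longrightarrow> p (t *\<^sub>R x) = t * p x)"

lemma sublinear_zero: "sublinear p \<Longrightarrow> p 0 = 0"
  unfolding sublinear_def by (metis mult_zero_left order_refl scaleR_zero_left)

lemma sublinear_minus: "sublinear p \<Longrightarrow> - p (- x) \<le> p x"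
  using sublinear_zero[of p] unfolding sublinear_def by (smt (verit) add.right_inverse)

text \<open>The largest sublinear functional below \<open>p\<close> that is at most \<open>- p y\<close> at \<open>- y\<close>, hence additive along the
direction \<open>y\<close>.\<close>

definition slope_reduct :: "('a::real_vector \<Rightarrow> real) \<Rightarrow> 'a \<Rightarrow> 'a \<Rightarrow> real" where
  "slope_reduct p y x = (INF t\<in>{0..}. p (x + t *\<^sub>R y) - t * p y)"

lemma slope_reduct_bounded:
  assumes "sublinear p"
  shows "bdd_below ((\<lambda>t. p (x + t *\<^sub>R y) - t * p y) ` {0..})"
proof (rule bdd_belowI2[where m = "- p (- x)"])
  fix t :: real assume t: "t \<in> {0..}"
  have "p (t *\<^sub>R y) \<le> p (x + t *\<^sub>R y) + p (- x)"
    using assms unfolding sublinear_def by (metis add.commute add_minus_cancel)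
  moreover have "p (t *\<^sub>R y) = t * p y"
    using assms t by (simp add: sublinear_def)
  ultimately show "- p (- x) \<le> p (x + t *\<^sub>R y) - t * p y" by simp
qed

lemma slope_reduct_le:
  assumes "sublinear p" "0 \<le> t"
  shows "slope_reduct p y x \<le> p (x + t *\<^sub>R y) - t * p y"
  unfolding slope_reduct_def
  by (rule cINF_lower[OF slope_reduct_bounded[OF assms(1)]]) (use assms in auto)

lemma slope_reduct_greatest:
  assumes "\<And>t. 0 \<le> t \<Longrightarrow> m \<le> p (x + t *\<^sub>R y) - t * p y"
  shows "m \<le> slope_reduct p y x"
  unfolding slope_reduct_def by (rule cINF_greatest) (use assms in auto)

text \<open>Adding two rays \<open>u + s y\<close> and \<open>v + t y\<close> gives a point of the ray from \<open>u + v\<close>, so subadditivity of \<open>p\<close>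
passes to the infimum; a positive factor only rescales the parameter of the ray.\<close>

lemma sublinear_slope_reduct:
  assumes p: "sublinear p"
  shows "sublinear (slope_reduct p y)"
proof -
  let ?r = "slope_reduct p y"
  have add: "?r (u + v) \<le> ?r u + ?r v" for u v
  proof -
    have "?r (u + v) - (p (u + s *\<^sub>R y) - s * p y) \<le> p (v + t *\<^sub>R y) - t * p y"
      if "0 \<le> s" "0 \<le> t" for s t
    proof -
      have "?r (u + v) \<le> p ((u + v) + (s + t) *\<^sub>R y) - (s + t) * p y"
        using that by (intro slope_reduct_le p) auto
      also have "(u + v) + (s + t) *\<^sub>R y = (u + s *\<^sub>R y) + (v + t *\<^sub>R y)"
        by (simp add: algebra_simps)
      also have "p \<dots> \<le> p (u + s *\<^sub>R y) + p (v + t *\<^sub>R y)"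
        using p by (simp add: sublinear_def)
      finally show ?thesis by (simp add: algebra_simps)
    qed
    then have "?r (u + v) - (p (u + s *\<^sub>R y) - s * p y) \<le> ?r v" if "0 \<le> s" for s
      using that by (intro slope_reduct_greatest) auto
    then have "?r (u + v) - ?r v \<le> ?r u"
      by (intro slope_reduct_greatest) (auto simp: algebra_simps)
    then show ?thesis by simp
  qed
  have scale_le: "?r (c *\<^sub>R u) \<le> c * ?r u" if c: "0 < c" for c u
  proof -
    have "?r (c *\<^sub>R u) / c \<le> p (u + t *\<^sub>R y) - t * p y" if t: "0 \<le> t" for t
    proof -
      have "?r (c *\<^sub>R u) \<le> p (c *\<^sub>R u + (c * t) *\<^sub>R y) - (c * t) * p y"
        using c t by (intro slope_reduct_le p) auto
      also have "c *\<^sub>R u + (c * t) *\<^sub>R y = c *\<^sub>R (u + t *\<^sub>R y)"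
        by (simp add: algebra_simps)
      also have "p \<dots> = c * p (u + t *\<^sub>R y)"
        using p c by (simp add: sublinear_def)
      finally show ?thesis using c by (simp add: field_simps)
    qed
    then have "?r (c *\<^sub>R u) / c \<le> ?r u"
      by (rule slope_reduct_greatest)
    then show ?thesis using c by (simp add: field_simps)
  qed
  have zero: "?r 0 = 0"
  proof (rule antisym)
    show "?r 0 \<le> 0" using slope_reduct_le[OF p, of 0 y 0] sublinear_zero[OF p] by simp
    show "0 \<le> ?r 0" by (rule slope_reduct_greatest) (use p in \<open>simp add: sublinear_def\<close>)
  qed
  have "?r (c *\<^sub>R u) = c * ?r u" if "0 \<le> c" for c u
  proof (cases "c = 0")
    case True
    then show ?thesis by (simp add: zero)
  next
    case False
    then have c: "0 < c" using that by simp
    from scale_le[of "inverse c" "c *\<^sub>R u"] c have "?r u \<le> inverse c * ?r (c *\<^sub>R u)" by simp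
    then have "c * ?r u \<le> ?r (c *\<^sub>R u)" using c by (simp add: field_simps)
    with scale_le[OF c, of u] show ?thesis by simp
  qed
  with add show ?thesis by (simp add: sublinear_def)
qed

text \<open>The Hahn--Banach theorem in the form that needs no partially defined functionals: Zorn's lemma, applied downwards.
The pointwise infimum of a chain is finite because \<open>- q (- x)\<close> bounds it below, and it is subadditive because
any two members of the chain are comparable.\<close>

lemma minimal_sublinear_below:
  fixes q :: "'a::real_vector \<Rightarrow> real"
  assumes q: "sublinear q"
  shows "\<exists>f. sublinear f \<and> f \<le> q \<and> (\<forall>g. sublinear g \<longrightarrow> g \<le> f \<longrightarrow> g = f)"
proof -
  define A where "A = {p. sublinear p \<and> p \<le> q}"
  let ?R = "relation_of (\<lambda>f g :: 'a \<Rightarrow> real. g \<le> f) A"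
  have "partial_order_on A ?R"
    by (rule partial_order_on_relation_ofI) auto
  moreover have "\<exists>u\<in>A. \<forall>a\<in>C. u \<le> a" if C: "C \<in> Chains ?R" for C
  proof (cases "C = {}")
    case True
    then show ?thesis using q by (auto simp: A_def)
  next
    case False
    have CA: "p \<in> A" if "p \<in> C" for p
      using C that by (auto simp: Chains_def relation_of_def)
    have tot: "p \<le> p' \<or> p' \<le> p" if "p \<in> C" "p' \<in> C" for p p'
      using C that by (auto simp: Chains_def relation_of_def)
    define u where "u x = (INF p\<in>C. p x)" for x
    have bdd: "bdd_below ((\<lambda>p. p x) ` C)" for x
    proof (rule bdd_belowI2[where m = "- q (- x)"])
      fix p assume "p \<in> C"
      then have "sublinear p" "p (- x) \<le> q (- x)" using CA by (auto simp: A_def le_fun_def)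
      then show "- q (- x) \<le> p x" using sublinear_minus[of p x] by simp
    qed
    have u_le: "u x \<le> p x" if "p \<in> C" for p x
      unfolding u_def by (rule cINF_lower[OF bdd that])
    have u_ge: "m \<le> u x" if "\<And>p. p \<in> C \<Longrightarrow> m \<le> p x" for m x
      unfolding u_def by (rule cINF_greatest[OF False that])
    have "u (x + y) \<le> u x + u y" for x y
    proof -
      have "u (x + y) - p x \<le> p' y" if "p \<in> C" "p' \<in> C" for p p'
      proof -
        have "p \<le> p' \<or> p' \<le> p" by (rule tot[OF that])
        then obtain r where r: "r \<in> C" "r \<le> p" "r \<le> p'"
          using \<open>p \<in> C\<close> \<open>p' \<in> C\<close> by blast
        have "u (x + y) \<le> r (x + y)" by (rule u_le[OF r(1)])
        also have "\<dots> \<le> r x + r y" using CA[OF r(1)] by (simp add: A_def sublinear_def)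
        also have "\<dots> \<le> p x + p' y" using r by (simp add: le_fun_def add_mono)
        finally show ?thesis by simp
      qed
      then have "u (x + y) - p x \<le> u y" if "p \<in> C" for p
        using that by (intro u_ge) auto
      then have "u (x + y) - u y \<le> u x"
        by (intro u_ge) (simp add: algebra_simps)
      then show ?thesis by simp
    qed
    moreover have "u (t *\<^sub>R x) = t * u x" if "0 \<le> t" for t x
    proof -
      have hom: "p (s *\<^sub>R z) = s * p z" if "p \<in> C" "0 \<le> s" for p s z
        using CA[OF that(1)] that(2) by (simp add: A_def sublinear_def)
      show ?thesis
      proof (cases "t = 0")
        case True
        have "p 0 = 0" if "p \<in> C" for p
          using CA[OF that] sublinear_zero by (auto simp: A_def)
        then have "u 0 = 0"
          using False u_ge[of 0 0] u_le[of _ 0] by (metis all_not_in_conv antisym order_refl)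
        then show ?thesis using True by simp
      next
        case False
        then have t: "0 < t" using that by simp
        have "u (t *\<^sub>R x) / t \<le> u x"
          using t u_le hom by (intro u_ge) (metis less_eq_real_def mult.commute pos_divide_le_eq)
        moreover have "t * u x \<le> u (t *\<^sub>R x)"
          using t by (intro u_ge) (simp add: mult_left_mono hom u_le)
        ultimately show ?thesis using t by (simp add: field_simps)
      qed
    qed
    moreover have "u \<le> q"
      using False u_le CA by (fastforce simp: A_def le_fun_def intro: order_trans)
    ultimately have "u \<in> A" by (simp add: A_def sublinear_def)
    then show ?thesis using u_le by (auto simp: le_fun_def)
  qed
  ultimately obtain f where "f \<in> A" "\<forall>g\<in>A. g \<le> f \<longrightarrow> g = f"
    using predicate_Zorn[of A "\<lambda>f g. g \<le> f"] by blast
  then show ?thesis by (auto simp: A_def intro!: exI[of _ f] intro: order_trans)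
qed

text \<open>Minimality forces \<open>slope_reduct f y = f\<close> for every \<open>y\<close>, and at parameter \<open>1\<close> this reads
\<open>f x + f y \<le> f (x + y)\<close>.\<close>

lemma minimal_sublinear_imp_linear:
  assumes f: "sublinear f" and min: "\<And>g. sublinear g \<Longrightarrow> g \<le> f \<Longrightarrow> g = f"
  shows "linear f"
proof (rule linearI)
  have reduct: "slope_reduct f y = f" for y
    by (rule min[OF sublinear_slope_reduct[OF f]])
      (use slope_reduct_le[OF f, of 0 y] in \<open>simp add: le_fun_def\<close>)
  have add: "f (x + y) = f x + f y" for x y
  proof (rule antisym)
    show "f (x + y) \<le> f x + f y" using f by (simp add: sublinear_def)
    show "f x + f y \<le> f (x + y)"
      using slope_reduct_le[OF f, of 1 y x] by (simp add: reduct)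
  qed
  then show "f (x + y) = f x + f y" for x y .
  have neg: "f (- x) = - f x" for x
    using add[of x "- x"] sublinear_zero[OF f] by simp
  show "f (c *\<^sub>R x) = c *\<^sub>R f x" for c x
  proof (cases "0 \<le> c")
    case True
    then show ?thesis using f by (simp add: sublinear_def)
  next
    case False
    then have "f ((- c) *\<^sub>R x) = - c * f x" using f unfolding sublinear_def by (metis less_eq_real_def linorder_not_le neg_0_le_iff_le)
    then show ?thesis using neg[of "c *\<^sub>R x"] by simp
  qed
qed

text \<open>A minimal functional below the norm could vanish at \<open>x\<close>. Starting from \<open>slope_reduct norm x\<close> instead forces
\<open>f (- x) \<le> - \<parallel>x\<parallel>\<close>.\<close>

lemma real_functional_nonzero:
  fixes x :: "'a::real_normed_vector"
  assumes "x \<noteq> 0"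
  shows "\<exists>f :: 'a \<Rightarrow> real. bounded_linear f \<and> f x \<noteq> 0"
proof -
  have norm: "sublinear (norm :: 'a \<Rightarrow> real)"
    by (simp add: sublinear_def norm_triangle_ineq)
  obtain f where f: "sublinear f" "f \<le> slope_reduct norm x"
    "\<And>g. sublinear g \<Longrightarrow> g \<le> f \<Longrightarrow> g = f"
    using minimal_sublinear_below[OF sublinear_slope_reduct[OF norm, of x]] by blast
  have lin: "linear f" by (rule minimal_sublinear_imp_linear[OF f(1,3)])
  have le: "f z \<le> norm z" for z
    using f(2) slope_reduct_le[OF norm, of 0 x z] by (auto simp: le_fun_def intro: order_trans)
  have "\<bar>f z\<bar> \<le> norm z" for z
    using le[of z] le[of "- z"] linear_neg[OF lin, of z] by simp
  then have "bounded_linear f"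
    using lin by (auto simp: bounded_linear_def bounded_linear_axioms_def intro!: exI[of _ 1])
  moreover have "f (- x) \<le> - norm x"
    using f(2) slope_reduct_le[OF norm, of 1 x "- x"] by (auto simp: le_fun_def intro: order_trans)
  then have "f x \<noteq> 0" using assms linear_neg[OF lin, of x] by auto
  ultimately show ?thesis by blast
qed

text \<open>A complex functional is determined by its real part \<open>f\<close>, namely as \<open>x \<mapsto> f x - \<i> f (\<i> x)\<close>.\<close>

lemma dual_of_real_functional:
  fixes f :: "'a::complex_normed_vector \<Rightarrow> real"
  assumes f: "bounded_linear f"
  shows "\<exists>\<phi> :: 'a dual. \<forall>x. Re (cblinfun_apply \<phi> x) = f x"
proof -
  interpret f: bounded_linear f by (rule f)
  define g where "g x = Complex (f x) (- f (\<i> *\<^sub>C x))" for x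
  have g: "g x = of_real (f x) - \<i> * of_real (f (\<i> *\<^sub>C x))" for x
    by (simp add: g_def complex_eq_iff)
  have bl: "bounded_linear g"
    unfolding g using f bounded_linear_compose[OF f bounded_linear_scaleC[of \<i>]]
    by (intro bounded_linear_sub bounded_linear_const_mult bounded_linear_of_real[THEN bounded_linear_compose])
      (auto simp: o_def)
  have gi: "g (\<i> *\<^sub>C x) = \<i> * g x" for x
    using scaleC_of_real[of "-1" x] by (simp add: g_def complex_eq_iff scaleC_scaleC f.neg)
  have "g (c *\<^sub>C x) = c *\<^sub>C g x" for c x
  proof -
    interpret g: bounded_linear g by (rule bl)
    have "c *\<^sub>C x = (of_real (Re c) + \<i> * of_real (Im c)) *\<^sub>C x"
      by (simp add: complex_eq_iff[symmetric] complex_eq)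
    also have "\<dots> = Re c *\<^sub>R x + \<i> *\<^sub>C (Im c *\<^sub>R x)"
      by (simp only: scaleC_add_left scaleC_scaleC[symmetric] scaleC_of_real)
    finally have "g (c *\<^sub>C x) = Re c *\<^sub>R g x + \<i> * (Im c *\<^sub>R g x)"
      by (simp add: g.add gi g.scaleR)
    also have "\<dots> = c *\<^sub>C g x"
      by (subst (3) complex_eq) (simp add: scaleC_complex_def scaleR_conv_of_real algebra_simps)
    finally show ?thesis .
  qed
  then have "bounded_clinear (blinfun_apply (Blinfun g))"
    by (simp add: bounded_clinear_def bl bounded_linear_Blinfun_apply)
  then have "cblinfun_apply (Abs_cblinfun (Blinfun g)) x = g x" for x
    by (simp add: cblinfun_apply.rep_eq Abs_cblinfun_inverse bounded_linear_Blinfun_apply[OF bl])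
  then show ?thesis by (metis g_def complex.sel(1))
qed

lemma dual_separates:
  fixes x :: "'a::complex_normed_vector"
  assumes "x \<noteq> 0"
  shows "\<exists>\<phi> :: 'a dual. cblinfun_apply \<phi> x = 1"
proof -
  obtain f :: "'a \<Rightarrow> real" where "bounded_linear f" "f x \<noteq> 0"
    using real_functional_nonzero[OF assms] by blast
  then obtain \<phi> :: "'a dual" where "cblinfun_apply \<phi> x \<noteq> 0"
    using dual_of_real_functional by (metis zero_complex.simps(1))
  then have "cblinfun_apply (inverse (cblinfun_apply \<phi> x) *\<^sub>C \<phi>) x = 1"
    by (simp add: cblinfun_apply_arith scaleC_complex_def)
  then show ?thesis by blast
qed

section \<open>Isometries between balls of real subspaces\<close>

definition isometry_between ::
    "'a::real_normed_vector set \<Rightarrow> 'b::real_normed_vector set \<Rightarrow> ('a \<Rightarrow> 'b) \<Rightarrow> bool" where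
  "isometry_between K L S \<longleftrightarrow> bij_betw S K L \<and> norm_isometry_on K S"

lemma isometry_between_compose:
  assumes "isometry_between K L S" "isometry_between L M R"
  shows "isometry_between K M (R \<circ> S)"
  using assms bij_betw_trans[of S K L R M]
  by (auto simp: isometry_between_def norm_isometry_on_def dest: bij_betwE)

lemma isometry_between_inv_into:
  assumes "isometry_between K L S"
  shows "isometry_between L K (inv_into K S)"
proof -
  have b: "bij_betw S K L" and i: "\<And>x y. x \<in> K \<Longrightarrow> y \<in> K \<Longrightarrow> norm (S x - S y) = norm (x - y)"
    using assms by (auto simp: isometry_between_def norm_isometry_on_def)
  have "norm (inv_into K S x - inv_into K S y) = norm (x - y)" if "x \<in> L" "y \<in> L" for x y
    using i[of "inv_into K S x" "inv_into K S y"] that b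
    by (metis bij_betw_imp_surj_on f_inv_into_f inv_into_into)
  then show ?thesis
    using bij_betw_inv_into[OF b] by (simp add: isometry_between_def norm_isometry_on_def)
qed

lemma isometry_point_reflection:
  fixes z :: "'a::real_normed_vector"
  assumes "\<And>u. u \<in> K \<Longrightarrow> 2 *\<^sub>R z - u \<in> K"
  shows "isometry_between K K (\<lambda>u. 2 *\<^sub>R z - u)"
  unfolding isometry_between_def norm_isometry_on_def
proof (intro conjI ballI)
  show "bij_betw (\<lambda>u. 2 *\<^sub>R z - u) K K"
    by (rule bij_betw_byWitness[where f' = "\<lambda>u. 2 *\<^sub>R z - u"]) (use assms in auto)
  show "norm ((2 *\<^sub>R z - x) - (2 *\<^sub>R z - y)) = norm (x - y)" for x y
    by (simp add: norm_minus_commute)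
qed

text \<open>If \<open>S\<close> moves the centre \<open>z\<close>, then \<open>\<rho> S\<^sup>-\<^sup>1 \<rho> S\<close>, with \<open>\<rho>\<close> the reflection in \<open>z\<close>, is an isometry of \<open>K\<close> that moves
\<open>z\<close> twice as far. Iterated doubling contradicts boundedness.\<close>

lemma isometry_fixes_centre:
  fixes K :: "'a::real_normed_vector set"
  assumes bdd: "bounded K" and z: "z \<in> K" and sym: "\<And>u. u \<in> K \<Longrightarrow> 2 *\<^sub>R z - u \<in> K"
    and S: "isometry_between K K S"
  shows "S z = z"
proof -
  define \<rho> where "\<rho> u = 2 *\<^sub>R z - u" for u
  have \<rho>: "isometry_between K K \<rho>"
    unfolding \<rho>_def by (rule isometry_point_reflection[OF sym])
  have double: "\<exists>S'. isometry_between K K S' \<and> norm (S' z - z) = 2 * norm (S z - z)"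
    if S: "isometry_between K K S" for S
  proof (intro exI conjI)
    let ?I = "inv_into K S"
    let ?S' = "\<rho> \<circ> (?I \<circ> (\<rho> \<circ> S))"
    show "isometry_between K K ?S'"
      by (intro isometry_between_compose[where L = K] S \<rho> isometry_between_inv_into[OF S])
    have b: "bij_betw S K K" and i: "\<And>x y. x \<in> K \<Longrightarrow> y \<in> K \<Longrightarrow> norm (S x - S y) = norm (x - y)"
      using S by (auto simp: isometry_between_def norm_isometry_on_def)
    have Sz: "S z \<in> K" using b z by (auto dest: bij_betwE)
    then have K: "\<rho> (S z) \<in> K" by (simp add: \<rho>_def sym)
    have "norm (?S' z - z) = norm (?I (\<rho> (S z)) - z)"
      by (simp add: \<rho>_def scaleR_2 norm_minus_commute)
    also have "\<dots> = norm (S (?I (\<rho> (S z))) - S z)"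
      using K b z by (intro i[symmetric]) (auto simp: bij_betw_def intro!: inv_into_into)
    also have "S (?I (\<rho> (S z))) = \<rho> (S z)"
      using K b by (intro f_inv_into_f) (auto simp: bij_betw_def)
    also have "norm (\<rho> (S z) - S z) = norm (2 *\<^sub>R (z - S z))"
      by (simp add: \<rho>_def scaleR_2 algebra_simps)
    finally show "norm (?S' z - z) = 2 * norm (S z - z)"
      by (simp add: norm_minus_commute)
  qed
  have iter: "\<exists>S'. isometry_between K K S' \<and> norm (S' z - z) = 2 ^ n * norm (S z - z)" for n
  proof (induction n)
    case 0
    then show ?case using S by auto
  next
    case (Suc n)
    then obtain S' where "isometry_between K K S'" "norm (S' z - z) = 2 ^ n * norm (S z - z)" by blast
    with double[of S'] show ?case by auto
  qed
  obtain b where b: "\<And>u. u \<in> K \<Longrightarrow> norm u \<le> b" using bdd by (auto simp: bounded_iff)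
  have "2 ^ n * norm (S z - z) \<le> 2 * b" for n
  proof -
    obtain S' where S': "isometry_between K K S'" "norm (S' z - z) = 2 ^ n * norm (S z - z)"
      using iter by blast
    then have "S' z \<in> K" using z by (auto simp: isometry_between_def dest: bij_betwE)
    then show ?thesis using b[of z] b[of "S' z"] z norm_triangle_ineq4[of "S' z" z] S'(2) by simp
  qed
  then have *: "real n * norm (S z - z) \<le> 2 * b" for n
  proof -
    have "real n * norm (S z - z) \<le> 2 ^ n * norm (S z - z)"
      by (rule mult_right_mono) (simp_all add: of_nat_less_two_power less_imp_le)
    then show ?thesis using \<open>2 ^ n * norm (S z - z) \<le> 2 * b\<close> by linarith
  qed
  have "norm (S z - z) = 0"
  proof (rule ccontr)
    assume "norm (S z - z) \<noteq> 0"
    then have "0 < norm (S z - z)" by simp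
    from reals_Archimedean3[OF this, rule_format, of "2 * b"] * show False by (meson not_less)
  qed
  then show ?thesis by simp
qed

text \<open>The midpoint of \<open>f\<close> and \<open>g\<close> is the centre of symmetry of the set \<open>K\<close> of points within half their distance of both.
\<open>T\<close> carries \<open>K\<close> onto the corresponding set \<open>L\<close> of \<open>T f\<close> and \<open>T g\<close>, and conjugates the reflection of \<open>K\<close> to
an isometry of \<open>L\<close>. That isometry fixes the centre of \<open>L\<close>, so the preimage of this centre is the centre of \<open>K\<close>. Staying within radius
\<open>\<epsilon>/2\<close> keeps \<open>K\<close> and \<open>L\<close> inside the balls where \<open>T\<close> is controlled.\<close>

lemma isometry_of_balls_midpoint:
  fixes A :: "'a::real_normed_vector set" and B :: "'b::real_normed_vector set"
  assumes A: "subspace A" and B: "subspace B"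
    and T: "isometry_between (A \<inter> ball a \<epsilon>) (B \<inter> ball (T a) \<epsilon>) T" and a: "a \<in> A"
    and f: "f \<in> A" "norm (f - a) < \<epsilon> / 2" and g: "g \<in> A" "norm (g - a) < \<epsilon> / 2"
  shows "T ((1/2) *\<^sub>R (f + g)) = (1/2) *\<^sub>R (T f + T g)"
proof -
  define r where "r = norm (f - g) / 2"
  define z where "z = (1/2) *\<^sub>R (f + g)"
  define z' where "z' = (1/2) *\<^sub>R (T f + T g)"
  have \<epsilon>: "0 < \<epsilon>" using f(2) norm_ge_zero[of "f - a"] by linarith
  have bij: "bij_betw T (A \<inter> ball a \<epsilon>) (B \<inter> ball (T a) \<epsilon>)"
    and iso: "\<And>x y. x \<in> A \<Longrightarrow> y \<in> A \<Longrightarrow> norm (x - a) < \<epsilon> \<Longrightarrow> norm (y - a) < \<epsilon> \<Longrightarrow> norm (T x - T y) = norm (x - y)"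
    using T by (auto simp: isometry_between_def norm_isometry_on_def dist_norm norm_minus_commute)
  have r: "r < \<epsilon> / 2"
    using f g norm_triangle_ineq4[of "f - a" "g - a"] by (simp add: r_def)
  have fa: "norm (f - a) < \<epsilon>" and ga: "norm (g - a) < \<epsilon>" using f g \<epsilon> by auto
  have Tf: "T f \<in> B" "norm (T f - T a) < \<epsilon> / 2" and Tg: "T g \<in> B"
    using bij f fa g ga iso[of f a] a \<epsilon> by (auto simp: dist_norm norm_minus_commute dest: bij_betwE)
  have Tfg: "norm (T f - T g) = norm (f - g)" using iso f(1) g(1) fa ga by blast
  \<comment> \<open>With \<open>r\<close> half the distance, \<open>K\<close> reaches at most \<open>r + \<epsilon>/2 < \<epsilon>\<close> away from \<open>a\<close>.\<close>
  define K where "K = {u \<in> A. norm (u - f) \<le> r \<and> norm (u - g) \<le> r}"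
  define L where "L = {u \<in> B. norm (u - T f) \<le> r \<and> norm (u - T g) \<le> r}"
  have KA: "u \<in> A" "norm (u - a) < \<epsilon>" if "u \<in> K" for u
    using that f(2) r norm_triangle_ineq[of "u - f" "f - a"] by (auto simp: K_def)
  have KL: "isometry_between K L T"
    unfolding isometry_between_def norm_isometry_on_def
  proof (intro conjI ballI)
    have "inj_on T K"
      using bij KA by (auto simp: bij_betw_def dist_norm norm_minus_commute intro!: inj_on_subset[of T "A \<inter> ball a \<epsilon>" K])
    moreover have "T u \<in> L" if "u \<in> K" for u
      using KA[OF that] that iso[of u f] iso[of u g] f g fa ga bij
      by (auto simp: L_def K_def dist_norm norm_minus_commute dest: bij_betwE)
    moreover have "v \<in> T ` K" if v: "v \<in> L" for v
    proof -
      have "norm (v - T a) < \<epsilon>"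
        using v Tf(2) r norm_triangle_ineq[of "v - T f" "T f - T a"] by (auto simp: L_def)
      then have "v \<in> B \<inter> ball (T a) \<epsilon>" using v by (simp add: L_def dist_norm norm_minus_commute)
      then obtain u where u: "u \<in> A" "norm (u - a) < \<epsilon>" "T u = v"
        using bij by (force simp: bij_betw_def dist_norm norm_minus_commute)
      then have "u \<in> K" using v iso[of u f] iso[of u g] f g fa ga by (simp add: K_def L_def)
      then show ?thesis using u by blast
    qed
    ultimately show "bij_betw T K L" by (auto simp: bij_betw_def)
    show "norm (T x - T y) = norm (x - y)" if "x \<in> K" "y \<in> K" for x y
      using KA that iso by blast
  qed
  have reflect: "2 *\<^sub>R ((1/2) *\<^sub>R (p + q)) - u \<in> C \<and>
      norm (2 *\<^sub>R ((1/2) *\<^sub>R (p + q)) - u - p) = norm (u - q) \<and>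
      norm (2 *\<^sub>R ((1/2) *\<^sub>R (p + q)) - u - q) = norm (u - p)"
    if "subspace C" "p \<in> C" "q \<in> C" "u \<in> C" for p q u and C :: "'c::real_normed_vector set"
    using that by (auto simp: subspace_add subspace_diff norm_minus_commute)
  have half: "norm ((1/2) *\<^sub>R (p + q) - p) = norm (p - q) / 2"
    "norm ((1/2) *\<^sub>R (p + q) - q) = norm (p - q) / 2" for p q :: "'c::real_normed_vector"
  proof -
    have "(1/2) *\<^sub>R (p + q) - p = (1/2) *\<^sub>R (q - p)" "(1/2) *\<^sub>R (p + q) - q = (1/2) *\<^sub>R (p - q)"
      using scaleR_half_double[of p] scaleR_half_double[of q] by (simp_all add: algebra_simps)
    then show "norm ((1/2) *\<^sub>R (p + q) - p) = norm (p - q) / 2"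
      "norm ((1/2) *\<^sub>R (p + q) - q) = norm (p - q) / 2"
      by (simp_all add: norm_minus_commute)
  qed
  have zK: "z \<in> K" using A f(1) g(1)
    by (simp add: K_def z_def half r_def subspace_add subspace_scale)
  have z'L: "z' \<in> L" using B Tf(1) Tg
    by (simp add: L_def z'_def half r_def Tfg subspace_add subspace_scale)
  have symK: "2 *\<^sub>R z - u \<in> K" if "u \<in> K" for u
    using reflect[OF A f(1) g(1), of u] that by (simp add: K_def z_def)
  have symL: "2 *\<^sub>R z' - u \<in> L" if "u \<in> L" for u
    using reflect[OF B Tf(1) Tg, of u] that by (simp add: L_def z'_def)
  have "bounded L"
    by (rule bounded_subset[of "cball (T f) r"]) (auto simp: L_def dist_norm norm_minus_commute)
  define \<rho> where "\<rho> u = 2 *\<^sub>R z - u" for u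
  have \<rho>: "isometry_between K K \<rho>"
    unfolding \<rho>_def by (rule isometry_point_reflection[OF symK])
  \<comment> \<open>Transport the reflection of \<open>K\<close> to \<open>L\<close>; as an isometry of \<open>L\<close> it fixes the centre \<open>z'\<close>.\<close>
  have "T (\<rho> (inv_into K T z')) = z'"
    using isometry_fixes_centre[OF \<open>bounded L\<close> z'L symL,
        of "T \<circ> (\<rho> \<circ> inv_into K T)"]
      isometry_between_compose[OF isometry_between_compose[OF isometry_between_inv_into[OF KL] \<rho>] KL]
    by (simp add: o_assoc)
  moreover have bT: "bij_betw T K L" using KL by (simp add: isometry_between_def)
  then have w: "inv_into K T z' \<in> K" "T (inv_into K T z') = z'"
    using z'L by (auto simp: bij_betw_def intro: inv_into_into f_inv_into_f)
  moreover have "\<rho> (inv_into K T z') \<in> K" using symK w by (simp add: \<rho>_def)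
  ultimately have "\<rho> (inv_into K T z') = inv_into K T z'"
    using bT by (metis bij_betw_def inj_on_eq_iff)
  then have "2 *\<^sub>R z = 2 *\<^sub>R inv_into K T z'" by (simp add: \<rho>_def algebra_simps scaleR_2)
  then have "z = inv_into K T z'" by simp
  then show ?thesis using w(2) by (simp add: z_def z'_def)
qed

text \<open>The sets are explicit because the operator algebras are subspaces of a type and not types.\<close>

definition additive_isometry :: "'a::real_normed_vector set \<Rightarrow> 'b::real_normed_vector set \<Rightarrow> ('a \<Rightarrow> 'b) \<Rightarrow> bool" where
  "additive_isometry A B D \<longleftrightarrow> D ` A = B \<and> (\<forall>x\<in>A. \<forall>y\<in>A. D (x + y) = D x + D y) \<and> (\<forall>x\<in>A. norm (D x) = norm x)"

lemma additive_isometry_diff: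
  assumes "subspace A" "additive_isometry A B D" "x \<in> A" "y \<in> A"
  shows "D (x - y) = D x - D y"
proof -
  have "D ((x - y) + y) = D (x - y) + D y"
    using assms subspace_diff[of A x y] unfolding additive_isometry_def by blast
  then show ?thesis by simp
qed

text \<open>The increment \<open>F\<close> of \<open>T\<close> at \<open>a\<close> commutes with halving, so \<open>2\<^sup>n F (x / 2\<^sup>n)\<close> does not depend on \<open>n\<close> once
\<open>x / 2\<^sup>n\<close> is small. This extends \<open>F\<close> from a ball to all of \<open>A\<close>.\<close>

lemma isometry_of_balls_affine:
  fixes A :: "'a::real_normed_vector set" and B :: "'b::real_normed_vector set"
  assumes A: "subspace A" and B: "subspace B"
    and T: "isometry_between (A \<inter> ball a \<epsilon>) (B \<inter> ball (T a) \<epsilon>) T" and a: "a \<in> A" and \<epsilon>: "0 < \<epsilon>"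
  shows "\<exists>D c. additive_isometry A B D \<and> (\<forall>x\<in>A. norm (x - a) < \<epsilon> / 2 \<longrightarrow> T x = D x + c)"
proof -
  have bij: "bij_betw T (A \<inter> ball a \<epsilon>) (B \<inter> ball (T a) \<epsilon>)"
    and iso: "\<And>x y. x \<in> A \<Longrightarrow> y \<in> A \<Longrightarrow> norm (x - a) < \<epsilon> \<Longrightarrow> norm (y - a) < \<epsilon> \<Longrightarrow> norm (T x - T y) = norm (x - y)"
    using T by (auto simp: isometry_between_def norm_isometry_on_def dist_norm norm_minus_commute)
  define F where "F x = T (a + x) - T a" for x
  have F0: "F 0 = 0" by (simp add: F_def)
  have mid: "F ((1/2) *\<^sub>R (x + y)) = (1/2) *\<^sub>R (F x + F y)"
    if "x \<in> A" "y \<in> A" "norm x < \<epsilon> / 2" "norm y < \<epsilon> / 2" for x y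
  proof -
    have "T ((1/2) *\<^sub>R ((a + x) + (a + y))) = (1/2) *\<^sub>R (T (a + x) + T (a + y))"
      using that a by (intro isometry_of_balls_midpoint[OF A B T a]) (auto simp: A subspace_add)
    moreover have "(1/2) *\<^sub>R ((a + x) + (a + y)) = a + (1/2) *\<^sub>R (x + y)"
      using scaleR_half_double[of a] by (simp add: algebra_simps)
    ultimately have "T (a + (1/2) *\<^sub>R (x + y)) = (1/2) *\<^sub>R (T (a + x) + T (a + y))"
      by (simp only:)
    then show ?thesis
      using scaleR_half_double[of "T a"] by (simp add: F_def algebra_simps)
  qed
  have halve: "F ((1/2) *\<^sub>R x) = (1/2) *\<^sub>R F x" if "x \<in> A" "norm x < \<epsilon> / 2" for x
    using mid[of x 0] that F0 \<epsilon> A by (simp add: subspace_0)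
  have shrink: "2 ^ k *\<^sub>R F ((1 / 2 ^ k) *\<^sub>R x) = F x" if "x \<in> A" "norm x < \<epsilon> / 2" for x k
  proof (induction k)
    case (Suc k)
    have "norm ((1 / 2 ^ k) *\<^sub>R x) \<le> norm x"
      by (simp add: divide_simps mult_le_cancel_left1 not_less)
    then have "norm ((1 / 2 ^ k) *\<^sub>R x) < \<epsilon> / 2" using that(2) by linarith
    then have "F ((1/2) *\<^sub>R ((1 / 2 ^ k) *\<^sub>R x)) = (1/2) *\<^sub>R F ((1 / 2 ^ k) *\<^sub>R x)"
      using that A by (intro halve subspace_scale)
    then show ?case using Suc by simp
  qed simp
  define N where "N x = (SOME n. norm x < 2 ^ n * (\<epsilon> / 2))" for x :: 'a
  have ex_n: "\<exists>n. u < 2 ^ n * d" if "0 < d" for u d :: real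
  proof -
    obtain n where "u / d < 2 ^ n" using real_arch_pow[of 2 "u / d"] by auto
    then show ?thesis using that by (auto simp: field_simps)
  qed
  have N: "norm x < 2 ^ N x * (\<epsilon> / 2)" for x
    unfolding N_def by (rule someI_ex) (rule ex_n, use \<epsilon> in simp)
  define D where "D x = 2 ^ N x *\<^sub>R F ((1 / 2 ^ N x) *\<^sub>R x)" for x
  have small: "norm ((1 / 2 ^ n) *\<^sub>R x) < d \<longleftrightarrow> norm x < 2 ^ n * d" for n d and x :: "'c::real_normed_vector"
    by (simp add: field_simps)
  have D: "D x = 2 ^ n *\<^sub>R F ((1 / 2 ^ n) *\<^sub>R x)" if x: "x \<in> A" "norm x < 2 ^ n * (\<epsilon> / 2)" for x n
  proof -
    have *: "2 ^ (m + k) *\<^sub>R F ((1 / 2 ^ (m + k)) *\<^sub>R x) = 2 ^ m *\<^sub>R F ((1 / 2 ^ m) *\<^sub>R x)"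
      if "norm x < 2 ^ m * (\<epsilon> / 2)" for m k
    proof -
      have "2 ^ k *\<^sub>R F ((1 / 2 ^ k) *\<^sub>R ((1 / 2 ^ m) *\<^sub>R x)) = F ((1 / 2 ^ m) *\<^sub>R x)"
        using x(1) that A by (intro shrink subspace_scale small[THEN iffD2])
      moreover have "(1 / 2 ^ (m + k)) *\<^sub>R x = (1 / 2 ^ k) *\<^sub>R ((1 / 2 ^ m) *\<^sub>R x)"
        "2 ^ (m + k) *\<^sub>R v = 2 ^ m *\<^sub>R (2 ^ k *\<^sub>R v)" for v :: 'b
        by (simp_all add: power_add mult.commute)
      ultimately show ?thesis by (simp only:)
    qed
    show ?thesis
    proof (cases "n \<le> N x")
      case True
      then show ?thesis using *[OF x(2), of "N x - n"] by (simp add: D_def)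
    next
      case False
      then show ?thesis using *[OF N, of "n - N x"] by (simp add: D_def)
    qed
  qed
  have D_small: "D x = F x" if "x \<in> A" "norm x < \<epsilon> / 2" for x
    using D[of x 0] that by simp
  have add: "D (x + y) = D x + D y" if "x \<in> A" "y \<in> A" for x y
  proof -
    obtain n where n: "norm x + norm y < 2 ^ n * (\<epsilon> / 2)"
      using ex_n[of "\<epsilon> / 2" "norm x + norm y"] \<epsilon> by auto
    let ?s = "1 / 2 ^ n :: real"
    have xn: "norm x < 2 ^ n * (\<epsilon> / 2)" and yn: "norm y < 2 ^ n * (\<epsilon> / 2)"
      and xyn: "norm (x + y) < 2 ^ n * (\<epsilon> / 2)"
      using n norm_ge_zero[of x] norm_ge_zero[of y] norm_triangle_ineq[of x y] by linarith+
    have sA: "?s *\<^sub>R x \<in> A" "?s *\<^sub>R y \<in> A" "?s *\<^sub>R (x + y) \<in> A"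
      using that A by (auto simp: subspace_scale subspace_add)
    have "F ((1/2) *\<^sub>R (?s *\<^sub>R x + ?s *\<^sub>R y)) = (1/2) *\<^sub>R (F (?s *\<^sub>R x) + F (?s *\<^sub>R y))"
      using sA xn yn by (intro mid small[THEN iffD2])
    moreover have "F ((1/2) *\<^sub>R (?s *\<^sub>R (x + y))) = (1/2) *\<^sub>R F (?s *\<^sub>R (x + y))"
      using sA xyn by (intro halve small[THEN iffD2])
    ultimately have "F (?s *\<^sub>R (x + y)) = F (?s *\<^sub>R x) + F (?s *\<^sub>R y)"
      by (simp add: scaleR_add_right[of ?s] flip: scaleR_add_right[of "1/2"])
    then show ?thesis
      using that A xn yn xyn by (simp add: D subspace_add scaleR_add_right)
  qed
  have F_norm: "norm (F x) = norm x" if "x \<in> A" "norm x < \<epsilon>" for x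
    using that a iso[of "a + x" a] \<epsilon> A by (simp add: F_def subspace_add)
  have F_B: "F x \<in> B" if "x \<in> A" "norm x < \<epsilon>" for x
  proof -
    have "a + x \<in> A \<inter> ball a \<epsilon>" "a \<in> A \<inter> ball a \<epsilon>"
      using that A a \<epsilon> by (auto simp: subspace_add dist_norm)
    then have "T (a + x) \<in> B" "T a \<in> B" using bij by (auto dest: bij_betwE)
    then show ?thesis using B by (simp add: F_def subspace_diff)
  qed
  have norm_small: "norm ((1 / 2 ^ N x) *\<^sub>R x) < \<epsilon>" for x
  proof -
    have "norm ((1 / 2 ^ N x) *\<^sub>R x) < \<epsilon> / 2" using N small by blast
    then show ?thesis using \<epsilon> by linarith
  qed
  have norm: "norm (D x) = norm x" if "x \<in> A" for x
    using F_norm[of "(1 / 2 ^ N x) *\<^sub>R x"] that norm_small[of x] A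
    by (simp add: D_def subspace_scale)
  have "D x \<in> B" if "x \<in> A" for x
    using F_B[of "(1 / 2 ^ N x) *\<^sub>R x"] that norm_small[of x] A B
    by (simp add: D_def subspace_scale)
  moreover have "y \<in> D ` A" if y: "y \<in> B" for y
  proof -
    obtain n where n: "norm y < 2 ^ n * (\<epsilon> / 2)"
      using ex_n[of "\<epsilon> / 2" "norm y"] \<epsilon> by auto
    let ?v = "(1 / 2 ^ n) *\<^sub>R y"
    have v: "norm ?v < \<epsilon> / 2" using n small by blast
    have TB: "T a \<in> B"
      using bij a \<epsilon> by (auto dest: bij_betwE)
    have "norm ?v < \<epsilon>" using v \<epsilon> by linarith
    then have "T a + ?v \<in> B \<inter> ball (T a) \<epsilon>"
      using y B TB by (auto simp: dist_norm subspace_add subspace_scale)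
    then obtain u where u: "u \<in> A" "norm (u - a) < \<epsilon>" "T u = T a + ?v"
      using bij by (force simp: bij_betw_def dist_norm norm_minus_commute)
    then have F: "F (u - a) = ?v" by (simp add: F_def)
    have uA: "u - a \<in> A" using u a A by (simp add: subspace_diff)
    have nu: "norm (u - a) < \<epsilon> / 2" using F_norm[OF uA u(2)] F v by simp
    have "D (2 ^ n *\<^sub>R (u - a)) = 2 ^ n *\<^sub>R F ((1 / 2 ^ n) *\<^sub>R (2 ^ n *\<^sub>R (u - a)))"
      using nu uA A by (intro D) (auto simp: subspace_scale)
    then have "D (2 ^ n *\<^sub>R (u - a)) = y" using F by simp
    then show ?thesis using uA A by (metis imageI subspace_scale)
  qed
  ultimately have iso_D: "additive_isometry A B D"
    using add norm by (auto simp: additive_isometry_def)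
  have "T x = D x + (T a - D a)" if "x \<in> A" "norm (x - a) < \<epsilon> / 2" for x
    using D_small[of "x - a"] that a A additive_isometry_diff[OF A iso_D that(1) a]
    by (simp add: F_def subspace_diff algebra_simps)
  then show ?thesis using iso_D by blast
qed

section \<open>The identity is a vertex of the unit ball\<close>

lemma cblinfun_apply_linear:
  "cblinfun_apply f 0 = 0"
  "cblinfun_apply f (x + y) = cblinfun_apply f x + cblinfun_apply f y"
  "cblinfun_apply f (x - y) = cblinfun_apply f x - cblinfun_apply f y"
  "cblinfun_apply f (- x) = - cblinfun_apply f x"
  "cblinfun_apply f (c *\<^sub>C x) = c *\<^sub>C cblinfun_apply f x"
  "cblinfun_apply f (r *\<^sub>R x) = r *\<^sub>R cblinfun_apply f x"
proof -
  interpret bounded_linear "cblinfun_apply f"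
    using bounded_clinear_cblinfun_apply by (auto simp: bounded_clinear_def)
  show "cblinfun_apply f 0 = 0"
    "cblinfun_apply f (x + y) = cblinfun_apply f x + cblinfun_apply f y"
    "cblinfun_apply f (x - y) = cblinfun_apply f x - cblinfun_apply f y"
    "cblinfun_apply f (- x) = - cblinfun_apply f x"
    "cblinfun_apply f (r *\<^sub>R x) = r *\<^sub>R cblinfun_apply f x"
    by (rule zero add diff neg scaleR)+
  show "cblinfun_apply f (c *\<^sub>C x) = c *\<^sub>C cblinfun_apply f x"
    using bounded_clinear_cblinfun_apply[of f] by (auto simp: bounded_clinear_def)
qed

lemma norm_cblinfun: "norm (cblinfun_apply f x) \<le> norm f * norm x"
  by transfer (rule norm_blinfun)

lemma norm_cblinfun_bound:
  "0 \<le> b \<Longrightarrow> (\<And>x. norm (cblinfun_apply f x) \<le> b * norm x) \<Longrightarrow> norm f \<le> b"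
  by transfer (rule norm_blinfun_bound)

lemma bounded_linear_scaleC_left: "bounded_linear (\<lambda>c. c *\<^sub>C (x :: 'a :: complex_normed_vector))"
proof (rule bounded_linear_intro[where K = "norm x"])
  show "(r *\<^sub>R c) *\<^sub>C x = r *\<^sub>R c *\<^sub>C x" for r c
    by (metis scaleC_of_real scaleC_scaleC scaleR_conv_of_real)
qed (simp_all add: scaleC_add_left norm_scaleC)

lemma sum_powers_root_of_unity:
  fixes N m :: nat
  assumes N: "0 < N"
  defines "\<zeta> \<equiv> exp (2 * of_real pi * \<i> / of_nat N)"
  shows "(\<Sum>k<N. (\<zeta> ^ k) ^ m) = (if N dvd m then of_nat N else 0)"
proof -
  have pow: "\<zeta> ^ m = exp (2 * of_real pi * \<i> * of_nat m / of_nat N)"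
    unfolding \<zeta>_def by (simp add: exp_of_nat_mult[symmetric] field_simps)
  have one: "\<zeta> ^ m = 1 \<longleftrightarrow> N dvd m"
    unfolding pow using N by (intro complex_root_unity_eq_1) simp
  have "\<zeta> ^ N = 1"
    using N by (simp add: \<zeta>_def exp_of_nat_mult[symmetric])
  then have "(\<zeta> ^ m) ^ N = 1"
    by (simp add: power_mult[symmetric] mult.commute[of m]) (simp add: power_mult)
  moreover have "(\<Sum>k<N. (\<zeta> ^ k) ^ m) = (\<Sum>k<N. (\<zeta> ^ m) ^ k)"
    by (simp add: power_mult[symmetric] mult.commute)
  moreover have "(\<Sum>k<N. (\<zeta> ^ m) ^ k) = of_nat N" if "\<zeta> ^ m = 1"
    unfolding that by simp
  ultimately show ?thesis
    using one by (simp add: geometric_sum)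
qed

text \<open>The powers \<open>(e + \<omega> w)\<^sup>n\<close> are contractions for all \<open>\<bar>\<omega>\<bar> = 1\<close>, and \<open>n w\<close> is the coefficient of \<open>\<omega>\<close> in them.
Cauchy's estimate, here an average over roots of unity, therefore bounds \<open>n w\<close> by \<open>1\<close> for every \<open>n\<close>.\<close>

lemma identity_is_vertex_of_unit_ball:
  fixes w :: "'a::complex_normed_vector \<Rightarrow>\<^sub>C\<^sub>L 'a"
  assumes bound: "\<And>\<omega>. cmod \<omega> = 1 \<Longrightarrow> norm (cblinfun_id + \<omega> *\<^sub>C w) \<le> 1"
  shows "w = 0"
proof (rule cblinfun_eqI)
  fix v :: 'a
  define f where "f \<omega> = cblinfun_apply (cblinfun_id + \<omega> *\<^sub>C w)" for \<omega>
  have expand: "\<exists>c. c 1 = of_nat n *\<^sub>C cblinfun_apply w v \<and> c 0 = v \<and> (\<forall>j>n. c j = 0) \<and>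
      (\<forall>\<omega>. (f \<omega> ^^ n) v = (\<Sum>j\<le>n. \<omega> ^ j *\<^sub>C c j))" for n
  proof (induction n)
    case 0
    show ?case by (rule exI[of _ "\<lambda>j. if j = 0 then v else 0"]) (simp add: complex_vector.scale_zero_left)
  next
    case (Suc n)
    then obtain c where c: "c 1 = of_nat n *\<^sub>C cblinfun_apply w v" "c 0 = v" "\<And>j. n < j \<Longrightarrow> c j = 0"
      "\<And>\<omega>. (f \<omega> ^^ n) v = (\<Sum>j\<le>n. \<omega> ^ j *\<^sub>C c j)" by blast
    define d where "d j = c j + (case j of 0 \<Rightarrow> 0 | Suc i \<Rightarrow> cblinfun_apply w (c i))" for j
    have lin: "cblinfun_apply w (sum g J) = (\<Sum>j\<in>J. cblinfun_apply w (g j))" for g and J :: "nat set"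
      by (induction J rule: infinite_finite_induct) (simp_all add: cblinfun_apply_linear)
    have "(f \<omega> ^^ Suc n) v = (\<Sum>j\<le>Suc n. \<omega> ^ j *\<^sub>C d j)" for \<omega>
    proof -
      have "(f \<omega> ^^ Suc n) v = (\<Sum>j\<le>n. \<omega> ^ j *\<^sub>C c j) + \<omega> *\<^sub>C cblinfun_apply w (\<Sum>j\<le>n. \<omega> ^ j *\<^sub>C c j)"
        using c(4)[of \<omega>] by (simp add: f_def cblinfun_apply_arith)
      also have "\<omega> *\<^sub>C cblinfun_apply w (\<Sum>j\<le>n. \<omega> ^ j *\<^sub>C c j) = (\<Sum>j\<le>n. \<omega> ^ Suc j *\<^sub>C cblinfun_apply w (c j))"
        by (simp add: lin cblinfun_apply_linear complex_vector.scale_sum_right scaleC_scaleC)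
      also have "\<dots> = (\<Sum>j\<le>Suc n. \<omega> ^ j *\<^sub>C (case j of 0 \<Rightarrow> 0 | Suc i \<Rightarrow> cblinfun_apply w (c i)))"
        by (subst sum.atMost_Suc_shift) simp
      also have "(\<Sum>j\<le>n. \<omega> ^ j *\<^sub>C c j) = (\<Sum>j\<le>Suc n. \<omega> ^ j *\<^sub>C c j)"
        using c(3) by simp
      finally show ?thesis by (simp only: d_def sum.distrib scaleC_add_right)
    qed
    moreover have "d 1 = of_nat (Suc n) *\<^sub>C cblinfun_apply w v"
      using c by (simp add: d_def scaleC_add_left)
    moreover have "d 0 = v" using c by (simp add: d_def)
    moreover have "d j = 0" if "Suc n < j" for j
      using that c(3) by (auto simp: d_def cblinfun_apply_linear split: nat.split)
    ultimately show ?case by blast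
  qed
  have contract: "norm ((f \<omega> ^^ n) v) \<le> norm v" if "cmod \<omega> = 1" for \<omega> n
  proof (induction n)
    case (Suc n)
    have "norm (f \<omega> ((f \<omega> ^^ n) v)) \<le> norm (cblinfun_id + \<omega> *\<^sub>C w) * norm ((f \<omega> ^^ n) v)"
      unfolding f_def by (rule norm_cblinfun)
    also have "\<dots> \<le> 1 * norm ((f \<omega> ^^ n) v)"
      by (rule mult_right_mono[OF bound[OF that]]) simp
    finally show ?case using Suc by simp
  qed simp
  have le: "real n * norm (cblinfun_apply w v) \<le> norm v" for n
  proof (cases "n = 0")
    case False
    \<comment> \<open>The factor \<open>\<omega>\<^sup>n\<close> stands for \<open>\<omega>\<^sup>-\<^sup>1\<close> when \<open>\<omega>\<close> is a root of unity of order \<open>n + 1\<close>; among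
      the exponents \<open>n, \<dots>, 2 n\<close> only \<open>n + 1\<close> survives the average.\<close>
    define N where "N = Suc n"
    define \<zeta> where "\<zeta> = exp (2 * of_real pi * \<i> / of_nat N)"
    obtain c where c: "c 1 = of_nat n *\<^sub>C cblinfun_apply w v"
      "\<And>\<omega>. (f \<omega> ^^ n) v = (\<Sum>j\<le>n. \<omega> ^ j *\<^sub>C c j)"
      using expand[of n] by blast
    have dvd: "N dvd n + j \<longleftrightarrow> j = 1" if "j \<le> n" for j
    proof
      assume "N dvd n + j"
      then obtain q where q: "n + j = N * q" by auto
      have "q < 2"
      proof (rule ccontr)
        assume "\<not> q < 2"
        then have "N * 2 \<le> N * q" by (intro mult_le_mono2) simp
        then show False using q that by (simp add: N_def)
      qed
      moreover have "q \<noteq> 0" using q False by (metis add_is_0 mult_0_right)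
      ultimately show "j = 1" using q by (simp add: N_def less_2_cases_iff)
    qed (simp add: N_def)
    have "(\<Sum>k<N. (\<zeta> ^ k) ^ n *\<^sub>C (f (\<zeta> ^ k) ^^ n) v) = (\<Sum>k<N. \<Sum>j\<le>n. (\<zeta> ^ k) ^ (n + j) *\<^sub>C c j)"
      by (simp add: c(2) complex_vector.scale_sum_right scaleC_scaleC power_add)
    also have "\<dots> = (\<Sum>j\<le>n. (\<Sum>k<N. (\<zeta> ^ k) ^ (n + j)) *\<^sub>C c j)"
      by (subst sum.swap) (simp add: complex_vector.scale_sum_left)
    also have "\<dots> = (\<Sum>j\<le>n. (if j = 1 then of_nat N else 0) *\<^sub>C c j)"
      using dvd sum_powers_root_of_unity[of N] by (intro sum.cong) (auto simp: \<zeta>_def N_def)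
    also have "\<dots> = of_nat N *\<^sub>C c 1"
      using False by (simp add: if_distrib[of "\<lambda>z. z *\<^sub>C _"] complex_vector.scale_zero_left cong: if_cong)
    finally have *: "of_nat N *\<^sub>C c 1 = (\<Sum>k<N. (\<zeta> ^ k) ^ n *\<^sub>C (f (\<zeta> ^ k) ^^ n) v)" by simp
    have "cmod \<zeta> = 1" by (simp add: \<zeta>_def norm_exp_eq_Re)
    then have "norm ((\<zeta> ^ k) ^ n *\<^sub>C (f (\<zeta> ^ k) ^^ n) v) \<le> norm v" for k
      by (simp add: norm_scaleC norm_power contract)
    then have "norm (of_nat N *\<^sub>C c 1) \<le> real N * norm v"
      unfolding * using sum_norm_le[of "{..<N}" "\<lambda>k. (\<zeta> ^ k) ^ n *\<^sub>C (f (\<zeta> ^ k) ^^ n) v" "\<lambda>_. norm v"] by simp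
    then have "real N * (real n * norm (cblinfun_apply w v)) \<le> real N * norm v"
      unfolding c(1) by (simp add: norm_scaleC norm_mult mult.assoc)
    then show ?thesis by (simp add: N_def)
  qed simp
  show "cblinfun_apply w v = cblinfun_apply 0 v"
  proof (rule ccontr)
    assume "\<not> ?thesis"
    then have "0 < norm (cblinfun_apply w v)" by (simp add: cblinfun_apply_arith)
    from reals_Archimedean3[OF this, rule_format, of "norm v"] le show False by (meson not_less)
  qed
qed

section \<open>Dyads\<close>

text \<open>The rank one operator \<open>x \<otimes> \<phi>\<close>. The curried order makes \<open>dyad x\<close> the dyads with a fixed range.\<close>

lift_definition dyad :: "'b::complex_normed_vector \<Rightarrow> 'a::complex_normed_vector dual \<Rightarrow> 'a \<Rightarrow>\<^sub>C\<^sub>L 'b"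
  is "\<lambda>x \<phi>. Blinfun (\<lambda>v. cblinfun_apply \<phi> v *\<^sub>C x)"
proof -
  fix x :: 'b and \<phi> :: "'a dual"
  have bl: "bounded_linear (\<lambda>v. cblinfun_apply \<phi> v *\<^sub>C x)"
    using bounded_clinear_cblinfun_apply[of \<phi>]
    by (intro bounded_linear_compose[OF bounded_linear_scaleC_left]) (simp add: bounded_clinear_def)
  show "bounded_clinear (blinfun_apply (Blinfun (\<lambda>v. cblinfun_apply \<phi> v *\<^sub>C x)))"
    by (simp add: bounded_clinear_def bl bounded_linear_Blinfun_apply cblinfun_apply_linear
        scaleC_complex_def scaleC_scaleC)
qed

lemma cblinfun_apply_dyad [simp]: "cblinfun_apply (dyad x \<phi>) v = cblinfun_apply \<phi> v *\<^sub>C x"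
proof -
  have "bounded_linear (\<lambda>v. cblinfun_apply \<phi> v *\<^sub>C x)"
    using bounded_clinear_cblinfun_apply[of \<phi>]
    by (intro bounded_linear_compose[OF bounded_linear_scaleC_left]) (simp add: bounded_clinear_def)
  then show ?thesis
    by (simp add: cblinfun_apply.rep_eq[of "dyad x \<phi>"] dyad.rep_eq bounded_linear_Blinfun_apply)
qed

lemma dyad_linear:
  "dyad (x + y) \<phi> = dyad x \<phi> + dyad y \<phi>"
  "dyad (x - y) \<phi> = dyad x \<phi> - dyad y \<phi>"
  "dyad x (\<phi> + \<psi>) = dyad x \<phi> + dyad x \<psi>"
  "dyad x (\<phi> - \<psi>) = dyad x \<phi> - dyad x \<psi>"
  "dyad (c *\<^sub>C x) \<phi> = c *\<^sub>C dyad x \<phi>"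
  "dyad x (c *\<^sub>C \<phi>) = c *\<^sub>C dyad x \<phi>"
  by (rule cblinfun_eqI;
      simp add: cblinfun_apply_arith scaleC_add_right scaleC_add_left scaleC_diff_right
        complex_vector.scale_left_diff_distrib scaleC_scaleC scaleC_complex_def mult.commute)+

lemma norm_dyad: "norm (dyad x \<phi>) = norm x * norm \<phi>"
proof (rule antisym)
  show "norm (dyad x \<phi>) \<le> norm x * norm \<phi>"
    by (rule norm_cblinfun_bound)
      (use mult_right_mono[OF norm_cblinfun[of \<phi>] norm_ge_zero[of x]] in \<open>auto simp: norm_scaleC mult_ac\<close>)
  show "norm x * norm \<phi> \<le> norm (dyad x \<phi>)"
  proof (cases "x = 0")
    case False
    have "norm \<phi> \<le> norm (dyad x \<phi>) / norm x"
    proof (rule norm_cblinfun_bound)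
      show "norm (cblinfun_apply \<phi> v) \<le> norm (dyad x \<phi>) / norm x * norm v" for v
        using norm_cblinfun[of "dyad x \<phi>" v] False by (simp add: norm_scaleC field_simps)
    qed simp
    then show ?thesis using False by (simp add: field_simps)
  qed simp
qed

lemma dyad_eq_0_iff: "dyad x \<phi> = 0 \<longleftrightarrow> x = 0 \<or> \<phi> = 0"
  by (metis mult_eq_0_iff norm_dyad norm_eq_zero)

lemma finite_rank_dyad: "finite_rank (dyad x \<phi>)"
  unfolding finite_rank_def
  by (rule exI[of _ "{x}"]) (auto simp: complex_vector.span_base complex_vector.span_scale)

lemma cblinfun_compose_algebra:
  "(a + b) o\<^sub>C\<^sub>L c = a o\<^sub>C\<^sub>L c + b o\<^sub>C\<^sub>L c"
  "(a - b) o\<^sub>C\<^sub>L c = a o\<^sub>C\<^sub>L c - b o\<^sub>C\<^sub>L c"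
  "(k *\<^sub>C a) o\<^sub>C\<^sub>L c = k *\<^sub>C (a o\<^sub>C\<^sub>L c)"
  "a o\<^sub>C\<^sub>L (c + d) = a o\<^sub>C\<^sub>L c + a o\<^sub>C\<^sub>L d"
  "a o\<^sub>C\<^sub>L (c - d) = a o\<^sub>C\<^sub>L c - a o\<^sub>C\<^sub>L d"
  "a o\<^sub>C\<^sub>L (k *\<^sub>C c) = k *\<^sub>C (a o\<^sub>C\<^sub>L c)"
  "a o\<^sub>C\<^sub>L (c o\<^sub>C\<^sub>L e) = a o\<^sub>C\<^sub>L c o\<^sub>C\<^sub>L e"
  "f o\<^sub>C\<^sub>L cblinfun_id = f"
  "cblinfun_id o\<^sub>C\<^sub>L f = f"
  by (rule cblinfun_eqI; simp add: cblinfun_apply_arith cblinfun_apply_linear)+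

lemma compose_dyad: "a o\<^sub>C\<^sub>L dyad x \<phi> = dyad (cblinfun_apply a x) \<phi>"
  by (rule cblinfun_eqI) (simp add: cblinfun_apply_linear)

lemma functional_compose_dyad: "\<psi> o\<^sub>C\<^sub>L dyad x \<phi> = cblinfun_apply \<psi> x *\<^sub>C \<phi>"
  by (rule cblinfun_eqI) (simp add: cblinfun_apply_linear cblinfun_apply_arith scaleC_complex_def)

section \<open>Open groups of invertible operators\<close>

definition inverse_ops :: "('a::complex_normed_vector \<Rightarrow>\<^sub>C\<^sub>L 'a) \<Rightarrow> ('a \<Rightarrow>\<^sub>C\<^sub>L 'a) \<Rightarrow> bool" where
  "inverse_ops a b \<longleftrightarrow> a o\<^sub>C\<^sub>L b = cblinfun_id \<and> b o\<^sub>C\<^sub>L a = cblinfun_id"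

lemma inverse_ops_apply:
  assumes "inverse_ops a b"
  shows "cblinfun_apply a (cblinfun_apply b x) = x" "cblinfun_apply b (cblinfun_apply a x) = x"
  using assms by (simp_all add: inverse_ops_def flip: cblinfun_apply_compose)

lemma inverse_ops_id: "inverse_ops cblinfun_id cblinfun_id"
  by (simp add: inverse_ops_def cblinfun_compose_algebra)

lemma inverse_ops_compose:
  assumes "inverse_ops a a'" "inverse_ops b b'"
  shows "inverse_ops (a o\<^sub>C\<^sub>L b) (b' o\<^sub>C\<^sub>L a')"
  unfolding inverse_ops_def
  by (auto intro!: cblinfun_eqI simp: inverse_ops_apply[OF assms(1)] inverse_ops_apply[OF assms(2)])

lemma inverse_ops_unique: "inverse_ops a b \<Longrightarrow> inverse_ops a b' \<Longrightarrow> b = b'"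
  by (rule cblinfun_eqI) (metis inverse_ops_apply(1,2))

text \<open>On the line spanned by the dyad \<open>R\<close>, where \<open>R\<^sup>2 = \<phi>(u) R\<close>, the Neumann series is geometric and sums to this
rational expression, which stays valid as long as \<open>\<phi>(u) \<noteq> 1\<close>.\<close>

lemma inverse_ops_dyad:
  assumes "cblinfun_apply \<phi> u \<noteq> 1"
  shows "inverse_ops (cblinfun_id - dyad u \<phi>)
    (cblinfun_id + (1 / (1 - cblinfun_apply \<phi> u)) *\<^sub>C dyad u \<phi>)"
proof -
  define D where "D = dyad u \<phi>"
  define k where "k = cblinfun_apply \<phi> u"
  define c where "c = 1 / (1 - k)"
  have DD: "D o\<^sub>C\<^sub>L D = k *\<^sub>C D"
    by (simp add: D_def k_def compose_dyad dyad_linear)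
  have c: "c = 1 + c * k" using assms by (simp add: c_def k_def field_simps)
  then have cD: "c *\<^sub>C D = D + (c * k) *\<^sub>C D" by (metis scaleC_add_left scaleC_one)
  have "c * k = k + c * k * k" by (subst c) (simp add: ring_distribs)
  then have ck: "(c * k) *\<^sub>C D = k *\<^sub>C D + (c * k * k) *\<^sub>C D" by (metis scaleC_add_left)
  have "inverse_ops (cblinfun_id - D) (cblinfun_id + c *\<^sub>C D)"
    unfolding inverse_ops_def using DD cD
    by (simp add: cblinfun_compose_algebra scaleC_scaleC scaleC_diff_right) (simp add: ck)
  then show ?thesis by (simp add: D_def c_def k_def)
qed

lemma connected_nonzero_multiples:
  "connected ((\<lambda>\<mu>. \<mu> *\<^sub>C (a :: 'a::complex_normed_vector)) ` (- {0}))"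
  by (rule connected_continuous_image[OF linear_continuous_on[OF bounded_linear_scaleC_left]
        connected_punctured_universe]) simp

locale operator_group =
  fixes A G :: "('x::complex_banach \<Rightarrow>\<^sub>C\<^sub>L 'x) set"
  assumes algebra: "unital_closed_subalgebra A"
    and finite_rank_in: "finite_rank f \<Longrightarrow> f \<in> A"
    and open_sub: "open_subgroup G (invertible_group A)"
begin

text \<open>Inverses are required to lie in \<open>A\<close>, since a closed subalgebra may contain operators whose inverse it misses.\<close>

definition units :: "('x \<Rightarrow>\<^sub>C\<^sub>L 'x) set" where
  "units = {a \<in> A. \<exists>b\<in>A. inverse_ops a b}"

lemma algebra_closed:
  "0 \<in> A" "cblinfun_id \<in> A"
  "a \<in> A \<Longrightarrow> b \<in> A \<Longrightarrow> a + b \<in> A" "a \<in> A \<Longrightarrow> b \<in> A \<Longrightarrow> a - b \<in> A"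
  "a \<in> A \<Longrightarrow> c *\<^sub>C a \<in> A" "a \<in> A \<Longrightarrow> b \<in> A \<Longrightarrow> a o\<^sub>C\<^sub>L b \<in> A"
  "dyad x \<phi> \<in> A" "closed A"
proof -
  have sub: "csubspace A" using algebra by (simp add: unital_closed_subalgebra_def)
  show "0 \<in> A" "a \<in> A \<Longrightarrow> b \<in> A \<Longrightarrow> a + b \<in> A" "a \<in> A \<Longrightarrow> b \<in> A \<Longrightarrow> a - b \<in> A"
    "a \<in> A \<Longrightarrow> c *\<^sub>C a \<in> A"
    by (simp_all add: sub complex_vector.subspace_0 complex_vector.subspace_add
        complex_vector.subspace_diff complex_vector.subspace_scale)
  show "cblinfun_id \<in> A" "a \<in> A \<Longrightarrow> b \<in> A \<Longrightarrow> a o\<^sub>C\<^sub>L b \<in> A" "closed A"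
    using algebra by (simp_all add: unital_closed_subalgebra_def)
  show "dyad x \<phi> \<in> A" by (rule finite_rank_in[OF finite_rank_dyad])
qed

lemma real_subspace: "subspace A"
  unfolding real_vector.subspace_def
  using algebra_closed(1,3) algebra_closed(5)[of _ "of_real _"] by (auto simp: scaleC_of_real)

lemma carrier_invertible_group: "carrier (invertible_group A) = units"
  by (auto simp: invertible_group_def units_of_def Units_def units_def inverse_ops_def)

lemma group_invertible_group: "group (invertible_group A)"
proof -
  have "monoid \<lparr>carrier = A, mult = (o\<^sub>C\<^sub>L), one = cblinfun_id\<rparr>"
    by unfold_locales (auto simp: algebra_closed cblinfun_compose_algebra)
  then show ?thesis
    unfolding invertible_group_def by (rule monoid.units_group)
qed

lemma subgroup_G: "subgroup G (invertible_group A)"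
  using open_sub by (simp add: open_subgroup_def)

lemma G_units: "a \<in> G \<Longrightarrow> a \<in> units"
  using subgroup.subset[OF subgroup_G] carrier_invertible_group by auto

lemma G_in: "a \<in> G \<Longrightarrow> a \<in> A"
  using G_units by (auto simp: units_def)

lemma id_G: "cblinfun_id \<in> G"
  using subgroup.one_closed[OF subgroup_G] by (simp add: invertible_group_def units_of_def)

lemma compose_G: "a \<in> G \<Longrightarrow> b \<in> G \<Longrightarrow> a o\<^sub>C\<^sub>L b \<in> G"
  using subgroup.m_closed[OF subgroup_G] by (simp add: invertible_group_def units_of_def)

lemma inverse_G:
  assumes a: "a \<in> G"
  obtains b where "b \<in> G" "inverse_ops a b"
proof
  let ?b = "inv\<^bsub>invertible_group A\<^esub> a"
  show "?b \<in> G" by (rule subgroup.m_inv_closed[OF subgroup_G a])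
  show "inverse_ops a ?b"
    using group.r_inv[OF group_invertible_group, of a] group.l_inv[OF group_invertible_group, of a]
      G_units[OF a] unfolding carrier_invertible_group
    by (simp add: inverse_ops_def) (simp add: invertible_group_def units_of_def)
qed

lemma inverse_ops_in_G:
  assumes "a \<in> G" "inverse_ops a b"
  shows "b \<in> G"
proof -
  obtain c where "c \<in> G" "inverse_ops a c" by (rule inverse_G[OF assms(1)])
  then show ?thesis using inverse_ops_unique[OF assms(2)] by simp
qed

lemma units_injective:
  assumes "a \<in> units" "cblinfun_apply a x = 0"
  shows "x = 0"
proof -
  obtain b where "inverse_ops a b" using assms(1) by (auto simp: units_def)
  from inverse_ops_apply(2)[OF this, of x] show ?thesis
    using assms(2) by (simp add: cblinfun_apply_linear)
qed

lemma units_compose: "a \<in> units \<Longrightarrow> b \<in> units \<Longrightarrow> a o\<^sub>C\<^sub>L b \<in> units"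
  unfolding units_def using inverse_ops_compose algebra_closed(6) by blast

text \<open>The inverse is the fixed point of \<open>s \<mapsto> e + c s\<close>, a contraction of the complete set \<open>A\<close>; obtaining it in this way
places it inside \<open>A\<close>. Multiplication from the other side gives a left inverse, and the two agree.\<close>

lemma neumann:
  assumes c: "c \<in> A" "norm c < 1"
  shows "cblinfun_id - c \<in> units"
proof -
  have ex: "\<exists>s\<in>A. cblinfun_id + f s = s"
    if f: "\<And>s. s \<in> A \<Longrightarrow> f s \<in> A" "\<And>s t. f s - f t = f (s - t)" "\<And>s. norm (f s) \<le> norm c * norm s" for f
  proof -
    have "complete A" using algebra_closed(8) by (simp add: complete_eq_closed)
    moreover have "dist (cblinfun_id + f s) (cblinfun_id + f t) \<le> norm c * dist s t" for s t
      using f(3)[of "s - t"] by (simp add: dist_norm f(2))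
    ultimately have "\<exists>!s\<in>A. cblinfun_id + f s = s"
      using c algebra_closed f(1) by (intro Banach_fix[where c = "norm c"]) auto
    then show ?thesis by blast
  qed
  obtain s where s: "s \<in> A" "cblinfun_id + c o\<^sub>C\<^sub>L s = s"
    using ex[of "\<lambda>s. c o\<^sub>C\<^sub>L s"] c(1) norm_cblinfun_compose[of c]
    by (auto simp: algebra_closed cblinfun_compose_algebra)
  obtain t where t: "t \<in> A" "cblinfun_id + t o\<^sub>C\<^sub>L c = t"
    using ex[of "\<lambda>s. s o\<^sub>C\<^sub>L c"] c(1) norm_cblinfun_compose[of _ c]
    by (auto simp: algebra_closed cblinfun_compose_algebra mult.commute)
  have 1: "(cblinfun_id - c) o\<^sub>C\<^sub>L s = cblinfun_id"
    using s(2) by (simp add: cblinfun_compose_algebra algebra_simps)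
  have 2: "t o\<^sub>C\<^sub>L (cblinfun_id - c) = cblinfun_id"
    using t(2) by (simp add: cblinfun_compose_algebra algebra_simps)
  have "t = s"
    using 1 2 by (metis cblinfun_compose_algebra(7,8,9))
  then have "inverse_ops (cblinfun_id - c) s"
    using 1 2 by (simp add: inverse_ops_def)
  then show ?thesis
    using s(1) c(1) by (auto simp: units_def algebra_closed)
qed

lemma units_open:
  assumes a: "a \<in> units"
  obtains \<epsilon> where "0 < \<epsilon>" "\<And>x. x \<in> A \<Longrightarrow> norm (x - a) < \<epsilon> \<Longrightarrow> x \<in> units"
proof -
  obtain b where ab: "a \<in> A" "b \<in> A" "inverse_ops a b" using a by (auto simp: units_def)
  show ?thesis
  proof
    show "0 < 1 / (norm b + 1)" by (simp add: add_nonneg_pos)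
    fix x assume x: "x \<in> A" "norm (x - a) < 1 / (norm b + 1)"
    let ?c = "b o\<^sub>C\<^sub>L (a - x)"
    have "norm ?c \<le> norm b * norm (a - x)" by (rule norm_cblinfun_compose)
    also have "\<dots> \<le> norm b * (1 / (norm b + 1))"
      using x(2) by (intro mult_left_mono) (auto simp: norm_minus_commute)
    also have "\<dots> < 1"
      by (simp add: divide_less_eq add_nonneg_pos)
    finally have "cblinfun_id - ?c \<in> units"
      using x ab by (intro neumann) (auto simp: algebra_closed)
    moreover have "x = a o\<^sub>C\<^sub>L (cblinfun_id - ?c)"
      by (rule cblinfun_eqI) (simp add: cblinfun_apply_arith cblinfun_apply_linear inverse_ops_apply[OF ab(3)])
    ultimately show "x \<in> units" using units_compose[OF a] by metis
  qed
qed

lemma G_open: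
  assumes a: "a \<in> G"
  obtains \<epsilon> where "0 < \<epsilon>" "\<And>x. x \<in> A \<Longrightarrow> norm (x - a) < \<epsilon> \<Longrightarrow> x \<in> G"
proof -
  obtain O' where O': "open O'" "G = units \<inter> O'"
    using open_sub unfolding open_subgroup_def carrier_invertible_group by (auto simp: openin_open)
  obtain \<epsilon>1 where e1: "0 < \<epsilon>1" "\<And>x. x \<in> A \<Longrightarrow> norm (x - a) < \<epsilon>1 \<Longrightarrow> x \<in> units"
    using units_open[OF G_units[OF a]] by blast
  obtain \<epsilon>2 where e2: "0 < \<epsilon>2" "\<And>x. dist x a < \<epsilon>2 \<Longrightarrow> x \<in> O'"
    using O' a unfolding open_dist by blast
  show ?thesis
    by (rule that[of "min \<epsilon>1 \<epsilon>2"]) (use e1 e2 O' in \<open>auto simp: dist_norm\<close>)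
qed

text \<open>An open subgroup is closed in the group, because its cosets are open. In the proof the coset structure appears as
\<open>y = x (b x)\<^sup>-\<^sup>1 (b y)\<close> with \<open>b = a\<^sup>-\<^sup>1\<close>, where \<open>b x\<close> and \<open>b y\<close> are close to \<open>e\<close>.\<close>

lemma connected_subset_G:
  assumes C: "connected C" "C \<subseteq> units" and p: "p \<in> C" "p \<in> G"
  shows "C \<subseteq> G"
proof
  fix q assume q: "q \<in> C"
  obtain \<epsilon> where \<epsilon>: "0 < \<epsilon>" "\<And>x. x \<in> A \<Longrightarrow> norm (x - cblinfun_id) < \<epsilon> \<Longrightarrow> x \<in> G"
    using G_open[OF id_G] by blast
  have "\<exists>T. openin (top_of_set C) T \<and> a \<in> T \<and> (\<forall>x\<in>T. \<forall>y\<in>T. x \<in> G \<longrightarrow> y \<in> G)" if a: "a \<in> C" for a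
  proof -
    obtain b where ab: "a \<in> A" "b \<in> A" "inverse_ops a b" using a C(2) by (auto simp: units_def)
    define \<delta> where "\<delta> = \<epsilon> / (norm b + 1)"
    have \<delta>: "0 < \<delta>" using \<epsilon>(1) by (simp add: \<delta>_def add_nonneg_pos)
    have near: "b o\<^sub>C\<^sub>L x \<in> G" if x: "x \<in> C \<inter> ball a \<delta>" for x
    proof (rule \<epsilon>(2))
      have xA: "x \<in> A" using x C(2) by (auto simp: units_def)
      then show "b o\<^sub>C\<^sub>L x \<in> A" using ab by (simp add: algebra_closed)
      have "b o\<^sub>C\<^sub>L x - cblinfun_id = b o\<^sub>C\<^sub>L (x - a)"
        using ab(3) by (simp add: cblinfun_compose_algebra inverse_ops_def)
      then have "norm (b o\<^sub>C\<^sub>L x - cblinfun_id) \<le> norm b * norm (x - a)"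
        using norm_cblinfun_compose[of b "x - a"] by simp
      also have "\<dots> \<le> norm b * \<delta>"
        using x by (intro mult_left_mono) (auto simp: dist_norm norm_minus_commute)
      also have "\<dots> < (norm b + 1) * \<delta>" using \<delta> by simp
      also have "\<dots> = \<epsilon>" using norm_ge_zero[of b] unfolding \<delta>_def by (simp add: add_nonneg_pos less_imp_neq[symmetric])
      finally show "norm (b o\<^sub>C\<^sub>L x - cblinfun_id) < \<epsilon>" .
    qed
    have "y \<in> G" if x: "x \<in> C \<inter> ball a \<delta>" and y: "y \<in> C \<inter> ball a \<delta>" and xG: "x \<in> G" for x y
    proof -
      obtain u where u: "u \<in> G" "inverse_ops (b o\<^sub>C\<^sub>L x) u" using inverse_G[OF near[OF x]] by blast
      have "y = x o\<^sub>C\<^sub>L u o\<^sub>C\<^sub>L (b o\<^sub>C\<^sub>L y)"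
      proof (rule cblinfun_eqI)
        fix v
        have "cblinfun_apply b (cblinfun_apply x (cblinfun_apply u w)) = w" for w
          using inverse_ops_apply(1)[OF u(2)] by simp
        then have "cblinfun_apply x (cblinfun_apply u w) = cblinfun_apply a w" for w
          by (metis inverse_ops_apply(1)[OF ab(3)])
        then show "cblinfun_apply y v = cblinfun_apply (x o\<^sub>C\<^sub>L u o\<^sub>C\<^sub>L (b o\<^sub>C\<^sub>L y)) v"
          by (simp add: inverse_ops_apply[OF ab(3)])
      qed
      then show ?thesis using compose_G xG u(1) near[OF y] by metis
    qed
    moreover have "openin (top_of_set C) (C \<inter> ball a \<delta>)" by (simp add: openin_open_Int)
    moreover have "a \<in> C \<inter> ball a \<delta>" using a \<delta> by simp
    ultimately show ?thesis by blast
  qed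
  then show "q \<in> G"
    by (rule connected_induction_simple[where P = "\<lambda>x. x \<in> G", OF C(1) p(1) q p(2)])
qed

lemma scalar_units: "\<mu> \<noteq> 0 \<Longrightarrow> \<mu> *\<^sub>C cblinfun_id \<in> units"
  unfolding units_def
  by (auto simp: algebra_closed inverse_ops_def cblinfun_compose_algebra scaleC_scaleC
      intro!: bexI[of _ "inverse \<mu> *\<^sub>C cblinfun_id"])

lemma scalars_subset_G: "(\<lambda>\<mu>. \<mu> *\<^sub>C cblinfun_id) ` (- {0}) \<subseteq> G"
  using scalar_units id_G
  by (intro connected_subset_G[of _ cblinfun_id] connected_nonzero_multiples)
    (auto intro!: image_eqI[of _ _ 1])

lemma scalar_mult_G: "a \<in> G \<Longrightarrow> \<mu> \<noteq> 0 \<Longrightarrow> \<mu> *\<^sub>C a \<in> G"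
  using compose_G[of "\<mu> *\<^sub>C cblinfun_id" a] scalars_subset_G by (auto simp: cblinfun_compose_algebra)

text \<open>\<open>\<mu> e + x = \<mu> (e + x / \<mu>)\<close>, and \<open>x / \<mu>\<close> is small.\<close>

lemma large_scalar_plus_G:
  assumes a: "a \<in> A"
  obtains r where "0 < r"
    "\<And>\<mu> x. r \<le> cmod \<mu> \<Longrightarrow> x \<in> A \<Longrightarrow> norm x \<le> norm a \<Longrightarrow> \<mu> *\<^sub>C cblinfun_id + x \<in> G"
proof -
  obtain \<epsilon> where \<epsilon>: "0 < \<epsilon>" "\<And>x. x \<in> A \<Longrightarrow> norm (x - cblinfun_id) < \<epsilon> \<Longrightarrow> x \<in> G"
    using G_open[OF id_G] by blast
  define r where "r = norm a / \<epsilon> + 1"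
  have r: "0 < r" using \<epsilon>(1) by (simp add: r_def add_nonneg_pos)
  show ?thesis
  proof (rule that[OF r])
    fix \<mu> x assume \<mu>: "r \<le> cmod \<mu>" and x: "x \<in> A" "norm x \<le> norm a"
    then have \<mu>0: "\<mu> \<noteq> 0" using r by auto
    have "norm a / \<epsilon> < cmod \<mu>" using \<mu> by (simp add: r_def)
    then have "norm x < \<epsilon> * cmod \<mu>" using \<epsilon>(1) x(2) by (simp add: field_simps)
    then have "norm (inverse \<mu> *\<^sub>C x) < \<epsilon>"
      using \<mu>0 by (simp add: norm_scaleC norm_inverse norm_divide field_simps)
    then have "cblinfun_id + inverse \<mu> *\<^sub>C x \<in> G"
      using x(1) by (intro \<epsilon>(2)) (simp_all add: algebra_closed)
    then have "\<mu> *\<^sub>C (cblinfun_id + inverse \<mu> *\<^sub>C x) \<in> G" using \<mu>0 by (rule scalar_mult_G)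
    then show "\<mu> *\<^sub>C cblinfun_id + x \<in> G" using \<mu>0 by (simp add: scaleC_add_right scaleC_scaleC)
  qed
qed

lemma G_spans:
  assumes a: "a \<in> A"
  obtains g k where "g \<in> G" "k \<in> G" "a = g - k"
proof -
  obtain r where r: "0 < r"
    "\<And>\<mu> x. r \<le> cmod \<mu> \<Longrightarrow> x \<in> A \<Longrightarrow> norm x \<le> norm a \<Longrightarrow> \<mu> *\<^sub>C cblinfun_id + x \<in> G"
    using large_scalar_plus_G[OF a] by blast
  have "of_real r *\<^sub>C cblinfun_id + a \<in> G" using r(1) a by (intro r(2)) auto
  moreover have "complex_of_real r *\<^sub>C cblinfun_id \<in> G" using r(1) id_G by (intro scalar_mult_G) auto
  ultimately show ?thesis by (rule that) simp
qed

text \<open>The operators \<open>e - s R\<close>, with the bad parameter \<open>s = 1 / \<phi>(u)\<close> left out, form a connected set of invertible elements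
through \<open>e\<close>: the plane minus at most one point is connected.\<close>

lemma id_minus_dyad_G:
  assumes "cblinfun_apply \<phi> u \<noteq> 1"
  shows "cblinfun_id - dyad u \<phi> \<in> G"
proof -
  let ?S = "{s. s * cblinfun_apply \<phi> u \<noteq> 1}"
  let ?C = "(\<lambda>s. cblinfun_id - s *\<^sub>C dyad u \<phi>) ` ?S"
  have "?S = UNIV \<or> ?S = - {1 / cblinfun_apply \<phi> u}"
    by (cases "cblinfun_apply \<phi> u = 0") (auto simp: field_simps)
  then have "connected ?S"
  proof
    assume eq: "?S = - {1 / cblinfun_apply \<phi> u}"
    show ?thesis unfolding eq by (rule connected_punctured_universe) simp
  next
    assume eq: "?S = UNIV"
    show ?thesis unfolding eq by (rule connected_UNIV)
  qed
  then have "connected ?C"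
    by (intro connected_continuous_image continuous_intros linear_continuous_on bounded_linear_scaleC_left)
  moreover have "?C \<subseteq> units"
  proof clarify
    fix s assume s: "s * cblinfun_apply \<phi> u \<noteq> 1"
    then have "inverse_ops (cblinfun_id - dyad (s *\<^sub>C u) \<phi>)
        (cblinfun_id + (1 / (1 - s * cblinfun_apply \<phi> u)) *\<^sub>C dyad (s *\<^sub>C u) \<phi>)"
      using inverse_ops_dyad[of \<phi> "s *\<^sub>C u"] by (simp add: cblinfun_apply_linear scaleC_complex_def)
    then show "cblinfun_id - s *\<^sub>C dyad u \<phi> \<in> units"
      unfolding units_def dyad_linear(5) by (auto simp: algebra_closed)
  qed
  moreover have "cblinfun_id \<in> ?C"
    by (rule image_eqI[of _ _ 0]) (auto simp: complex_vector.scale_zero_left)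
  ultimately have "?C \<subseteq> G" using id_G by (intro connected_subset_G)
  then show ?thesis using assms by (auto intro!: subsetD[OF \<open>?C \<subseteq> G\<close>] image_eqI[of _ _ 1])
qed

text \<open>\<open>a - x \<otimes> \<phi> = a (e - a\<^sup>-\<^sup>1 x \<otimes> \<phi>)\<close>, and if \<open>\<phi>(a\<^sup>-\<^sup>1 x) = 1\<close> then \<open>a\<^sup>-\<^sup>1 x\<close> is in the kernel. This equivalence
is the link between the group, which the isometry respects, and the values of functionals.\<close>

lemma minus_dyad_in_G_iff:
  assumes a: "a \<in> G" and inv: "inverse_ops a b"
  shows "a - dyad x \<phi> \<in> G \<longleftrightarrow> cblinfun_apply \<phi> (cblinfun_apply b x) \<noteq> 1"
proof
  assume *: "a - dyad x \<phi> \<in> G"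
  show "cblinfun_apply \<phi> (cblinfun_apply b x) \<noteq> 1"
  proof
    assume 1: "cblinfun_apply \<phi> (cblinfun_apply b x) = 1"
    then have "cblinfun_apply (a - dyad x \<phi>) (cblinfun_apply b x) = 0"
      by (simp add: cblinfun_apply_arith inverse_ops_apply[OF inv])
    then have "cblinfun_apply b x = 0" by (rule units_injective[OF G_units[OF *]])
    then show False using 1 by (simp add: cblinfun_apply_linear)
  qed
next
  assume "cblinfun_apply \<phi> (cblinfun_apply b x) \<noteq> 1"
  then have "a o\<^sub>C\<^sub>L (cblinfun_id - dyad (cblinfun_apply b x) \<phi>) \<in> G"
    by (intro compose_G a id_minus_dyad_G)
  then show "a - dyad x \<phi> \<in> G"
    by (simp add: cblinfun_compose_algebra compose_dyad inverse_ops_apply[OF inv])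
qed

end

section \<open>Geometry of the dyads\<close>

lemma dual_separates_line:
  fixes x y :: "'a::complex_normed_vector"
  assumes "\<And>k. x \<noteq> k *\<^sub>C y"
  shows "\<exists>\<phi> :: 'a dual. cblinfun_apply \<phi> y = 0 \<and> cblinfun_apply \<phi> x = 1"
proof (cases "y = 0")
  case True
  then have "x \<noteq> 0" using assms[of 0] by (simp add: complex_vector.scale_zero_left)
  then show ?thesis using dual_separates[of x] True by (auto simp: cblinfun_apply_linear)
next
  case False
  then obtain \<psi> :: "'a dual" where \<psi>: "cblinfun_apply \<psi> y = 1" using dual_separates by blast
  obtain \<eta> :: "'a dual" where \<eta>: "cblinfun_apply \<eta> (x - cblinfun_apply \<psi> x *\<^sub>C y) = 1"
    using dual_separates[of "x - cblinfun_apply \<psi> x *\<^sub>C y"] assms by auto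
  show ?thesis
    by (rule exI[of _ "\<eta> - cblinfun_apply \<eta> y *\<^sub>C \<psi>"])
      (use \<psi> \<eta> in \<open>simp add: cblinfun_apply_arith cblinfun_apply_linear scaleC_complex_def mult.commute\<close>)
qed

text \<open>Of a functional suitable for \<open>x\<close>, one suitable for \<open>y\<close>, and their sum, one works for both.\<close>

lemma dual_separates_simultaneously:
  fixes x y z :: "'a::complex_normed_vector"
  assumes x: "\<And>k. x \<noteq> k *\<^sub>C z" and y: "\<And>k. y \<noteq> k *\<^sub>C z"
  shows "\<exists>\<phi> :: 'a dual. cblinfun_apply \<phi> z = 0 \<and> cblinfun_apply \<phi> x = 1 \<and> cblinfun_apply \<phi> y \<noteq> 0"
proof -
  obtain \<phi> :: "'a dual" where \<phi>: "cblinfun_apply \<phi> z = 0" "cblinfun_apply \<phi> x = 1"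
    using dual_separates_line x by blast
  obtain \<psi> :: "'a dual" where \<psi>: "cblinfun_apply \<psi> z = 0" "cblinfun_apply \<psi> y = 1"
    using dual_separates_line y by blast
  consider "cblinfun_apply \<phi> y \<noteq> 0" | "cblinfun_apply \<psi> x \<noteq> 0"
    | "cblinfun_apply \<phi> y = 0" "cblinfun_apply \<psi> x = 0" by blast
  then show ?thesis
  proof cases
    case 1
    then show ?thesis using \<phi> by blast
  next
    case 2
    then show ?thesis using \<psi>
      by (intro exI[of _ "inverse (cblinfun_apply \<psi> x) *\<^sub>C \<psi>"])
        (simp add: cblinfun_apply_arith scaleC_complex_def)
  next
    case 3
    then show ?thesis using \<phi> \<psi>
      by (intro exI[of _ "\<phi> + \<psi>"]) (simp add: cblinfun_apply_arith)
  qed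
qed

lemma dual_nonzeroE:
  fixes \<phi> :: "'a::complex_normed_vector dual"
  assumes "\<phi> \<noteq> 0"
  obtains v where "cblinfun_apply \<phi> v = 1"
proof -
  obtain u where u: "cblinfun_apply \<phi> u \<noteq> 0"
    using assms cblinfun_eqI[of \<phi> 0] by (auto simp: cblinfun_apply_arith)
  show ?thesis
    by (rule that[of "inverse (cblinfun_apply \<phi> u) *\<^sub>C u"])
      (use u in \<open>simp add: cblinfun_apply_linear scaleC_complex_def\<close>)
qed

lemma dual_multiple_of_kernel:
  fixes \<phi> \<psi> :: "'a::complex_normed_vector dual"
  assumes "\<psi> \<noteq> 0" and ker: "\<And>v. cblinfun_apply \<psi> v = 0 \<Longrightarrow> cblinfun_apply \<phi> v = 0"
  shows "\<exists>k. \<phi> = k *\<^sub>C \<psi>"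
proof -
  obtain u where u: "cblinfun_apply \<psi> u = 1" using dual_nonzeroE[OF assms(1)] .
  have "\<phi> = cblinfun_apply \<phi> u *\<^sub>C \<psi>"
  proof (rule cblinfun_eqI)
    fix v
    have "cblinfun_apply \<phi> (v - cblinfun_apply \<psi> v *\<^sub>C u) = 0"
      by (rule ker) (simp add: cblinfun_apply_linear u scaleC_complex_def)
    then show "cblinfun_apply \<phi> v = cblinfun_apply (cblinfun_apply \<phi> u *\<^sub>C \<psi>) v"
      by (simp add: cblinfun_apply_linear cblinfun_apply_arith scaleC_complex_def mult.commute)
  qed
  then show ?thesis by blast
qed

definition dyadic :: "('a::complex_normed_vector \<Rightarrow>\<^sub>C\<^sub>L 'b::complex_normed_vector) \<Rightarrow> bool" where
  "dyadic R \<longleftrightarrow> (\<exists>x \<phi>. R = dyad x \<phi>)"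

lemma dyadic_dyad [simp]: "dyadic (dyad x \<phi>)"
  by (auto simp: dyadic_def)

text \<open>If all values of \<open>R\<close> were multiples of one \<open>R x\<close>, a functional equal to \<open>1\<close> at \<open>R x\<close> would exhibit \<open>R\<close> as a
dyad.\<close>

lemma not_dyadicE:
  fixes R :: "'a::complex_normed_vector \<Rightarrow>\<^sub>C\<^sub>L 'b::complex_normed_vector"
  assumes "\<not> dyadic R"
  obtains x y where "cblinfun_apply R x \<noteq> 0" "\<And>k. cblinfun_apply R y \<noteq> k *\<^sub>C cblinfun_apply R x"
proof -
  have "R \<noteq> dyad 0 0" using assms dyadic_dyad[of 0 0] by auto
  then obtain x where x: "cblinfun_apply R x \<noteq> 0"
    using cblinfun_eqI[of R "dyad 0 0"] by auto
  obtain \<eta> :: "'b dual" where \<eta>: "cblinfun_apply \<eta> (cblinfun_apply R x) = 1"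
    using dual_separates[OF x] by blast
  have "R \<noteq> dyad (cblinfun_apply R x) (\<eta> o\<^sub>C\<^sub>L R)" using assms dyadic_dyad by metis
  then obtain y where "cblinfun_apply R y \<noteq> cblinfun_apply \<eta> (cblinfun_apply R y) *\<^sub>C cblinfun_apply R x"
    using cblinfun_eqI[of R "dyad (cblinfun_apply R x) (\<eta> o\<^sub>C\<^sub>L R)"] by auto
  then have "cblinfun_apply R y \<noteq> k *\<^sub>C cblinfun_apply R x" for k
    using \<eta> by (auto simp: cblinfun_apply_linear scaleC_complex_def)
  then show ?thesis using x that by blast
qed

abbreviation column_dyads :: "'a::complex_normed_vector dual \<Rightarrow> ('a \<Rightarrow>\<^sub>C\<^sub>L 'b::complex_normed_vector) set" where
  "column_dyads \<phi> \<equiv> range (\<lambda>x. dyad x \<phi>)"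

abbreviation row_dyads :: "'b::complex_normed_vector \<Rightarrow> ('a::complex_normed_vector \<Rightarrow>\<^sub>C\<^sub>L 'b) set" where
  "row_dyads x \<equiv> range (dyad x)"

lemma subspace_columns: "subspace (column_dyads \<phi>)"
proof (rule real_vector.subspaceI)
  show "0 \<in> column_dyads \<phi>" using dyad_eq_0_iff[of 0 \<phi>] by (metis rangeI)
  show "R + Q \<in> column_dyads \<phi>" if "R \<in> column_dyads \<phi>" "Q \<in> column_dyads \<phi>" for R Q
    using that by (auto simp flip: dyad_linear)
  show "c *\<^sub>R R \<in> column_dyads \<phi>" if "R \<in> column_dyads \<phi>" for c R
    using that by (auto simp flip: dyad_linear(5) scaleC_of_real)
qed

lemma subspace_rows: "subspace (row_dyads x)"
proof (rule real_vector.subspaceI)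
  show "0 \<in> row_dyads x" using dyad_eq_0_iff[of x 0] by (metis rangeI)
  show "R + Q \<in> row_dyads x" if "R \<in> row_dyads x" "Q \<in> row_dyads x" for R Q
    using that by (auto simp flip: dyad_linear)
  show "c *\<^sub>R R \<in> row_dyads x" if "R \<in> row_dyads x" for c R
    using that by (auto simp flip: dyad_linear(6) scaleC_of_real)
qed

text \<open>Let \<open>y \<otimes> \<psi> + x \<otimes> \<phi>\<close> have rank at most one. If \<open>\<phi>\<close> and \<open>\<psi>\<close> are independent, evaluating at a vector that
only one of them kills shows that \<open>x\<close> and \<open>y\<close> both lie on the line of the sum's range. So the dyads adjacent to
\<open>x \<otimes> \<phi>\<close> are described without reference to the two families, which is what lets \<open>S\<close> be applied.\<close>

lemma dyadic_neighbours:
  assumes x: "x \<noteq> 0" and \<phi>: "\<phi> \<noteq> 0"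
  shows "{R. dyadic R \<and> dyadic (R + dyad x \<phi>)} = column_dyads \<phi> \<union> row_dyads x"
proof (intro equalityI subsetI)
  fix R assume "R \<in> {R. dyadic R \<and> dyadic (R + dyad x \<phi>)}"
  then obtain y \<psi> z \<eta> where R: "R = dyad y \<psi>" and sum: "dyad y \<psi> + dyad x \<phi> = dyad z \<eta>"
    by (auto simp: dyadic_def)
  have ap: "cblinfun_apply \<psi> v *\<^sub>C y + cblinfun_apply \<phi> v *\<^sub>C x = cblinfun_apply \<eta> v *\<^sub>C z" for v
    using arg_cong[OF sum, of "\<lambda>f. cblinfun_apply f v"] by (simp add: cblinfun_apply_arith)
  show "R \<in> column_dyads \<phi> \<union> row_dyads x"
  proof (cases "\<exists>k. \<psi> = k *\<^sub>C \<phi>")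
    case True
    then have "R \<in> column_dyads \<phi>" by (auto simp: R dyad_linear(6) simp flip: dyad_linear(5))
    then show ?thesis by blast
  next
    case False
    then obtain v where v: "cblinfun_apply \<phi> v = 0" "cblinfun_apply \<psi> v \<noteq> 0"
      using dual_multiple_of_kernel[OF \<phi>, of \<psi>] by blast
    have "\<psi> \<noteq> 0" using False by (metis complex_vector.scale_zero_left)
    have "\<not> (\<exists>k. \<phi> = k *\<^sub>C \<psi>)"
    proof
      assume "\<exists>k. \<phi> = k *\<^sub>C \<psi>"
      then obtain k where k: "\<phi> = k *\<^sub>C \<psi>" by blast
      then have "k \<noteq> 0" using \<phi> by (auto simp: complex_vector.scale_zero_left)
      then have "\<psi> = inverse k *\<^sub>C \<phi>" by (simp add: k scaleC_scaleC)
      then show False using False by blast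
    qed
    then obtain u where u: "cblinfun_apply \<psi> u = 0" "cblinfun_apply \<phi> u \<noteq> 0"
      using dual_multiple_of_kernel[OF \<open>\<psi> \<noteq> 0\<close>, of \<phi>] by blast
    have xz: "cblinfun_apply \<phi> u *\<^sub>C x = cblinfun_apply \<eta> u *\<^sub>C z"
      and yz: "cblinfun_apply \<psi> v *\<^sub>C y = cblinfun_apply \<eta> v *\<^sub>C z"
      using ap[of u] ap[of v] u v by (simp_all add: complex_vector.scale_zero_left)
    have "cblinfun_apply \<eta> u \<noteq> 0"
    proof
      assume "cblinfun_apply \<eta> u = 0"
      then have "norm (cblinfun_apply \<phi> u *\<^sub>C x) = 0" using xz by (simp add: complex_vector.scale_zero_left)
      then show False using u x by (simp add: norm_scaleC)
    qed
    then have "z = (inverse (cblinfun_apply \<eta> u) * cblinfun_apply \<phi> u) *\<^sub>C x"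
      using xz by (simp flip: scaleC_scaleC add: xz)
    moreover have "y = (inverse (cblinfun_apply \<psi> v) * cblinfun_apply \<eta> v) *\<^sub>C z"
      using v(2) by (simp flip: scaleC_scaleC add: yz[symmetric])
    ultimately have "\<exists>k. y = k *\<^sub>C x" by (metis scaleC_scaleC)
    then have "R \<in> row_dyads x" by (auto simp: R dyad_linear(5) simp flip: dyad_linear(6))
    then show ?thesis by blast
  qed
qed (auto simp flip: dyad_linear)

text \<open>Either inclusion means that the space is one-dimensional. This is the only degenerate case in which the two families
cannot be told apart.\<close>

lemma rows_subset_columns_iff:
  fixes x :: "'a::complex_normed_vector" and \<phi> :: "'a dual"
  assumes x: "x \<noteq> 0" and \<phi>: "\<phi> \<noteq> 0"
  shows "row_dyads x \<subseteq> (column_dyads \<phi> :: ('a \<Rightarrow>\<^sub>C\<^sub>L 'a) set) \<longleftrightarrow> column_dyads \<phi> \<subseteq> (row_dyads x :: ('a \<Rightarrow>\<^sub>C\<^sub>L 'a) set)"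
proof
  assume sub: "row_dyads x \<subseteq> column_dyads \<phi>"
  have mult: "\<exists>k. \<psi> = k *\<^sub>C \<phi>" for \<psi>
  proof -
    obtain y where y: "dyad x \<psi> = dyad y \<phi>" using sub by auto
    have "cblinfun_apply \<psi> v = 0" if "cblinfun_apply \<phi> v = 0" for v
    proof -
      have "cblinfun_apply \<psi> v *\<^sub>C x = 0"
        using arg_cong[OF y, of "\<lambda>f. cblinfun_apply f v"] that by (simp add: complex_vector.scale_zero_left)
      then have "norm (cblinfun_apply \<psi> v *\<^sub>C x) = 0" by simp
      then show ?thesis using x by (simp add: norm_scaleC)
    qed
    then show ?thesis by (rule dual_multiple_of_kernel[OF \<phi>])
  qed
  have "\<exists>k. y = k *\<^sub>C x" for y
  proof (rule ccontr)
    assume "\<nexists>k. y = k *\<^sub>C x"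
    then have "y \<noteq> k *\<^sub>C x" for k by simp
    from dual_separates_line[OF this]
    obtain \<psi> :: "'a dual" where \<psi>: "cblinfun_apply \<psi> x = 0" "cblinfun_apply \<psi> y = 1"
      by blast
    obtain \<eta> :: "'a dual" where \<eta>: "cblinfun_apply \<eta> x = 1" using dual_separates[OF x] by blast
    obtain k l where "\<psi> = k *\<^sub>C \<phi>" "\<eta> = l *\<^sub>C \<phi>" using mult by blast
    then show False using \<psi> \<eta>
      by (auto simp: cblinfun_apply_arith scaleC_complex_def)
  qed
  then have "dyad y \<phi> \<in> row_dyads x" for y
  proof -
    obtain k where "y = k *\<^sub>C x" using \<open>\<And>y. \<exists>k. y = k *\<^sub>C x\<close> by blast
    then have "dyad y \<phi> = dyad x (k *\<^sub>C \<phi>)" by (simp add: dyad_linear)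
    then show ?thesis by simp
  qed
  then show "column_dyads \<phi> \<subseteq> row_dyads x" by blast
next
  assume sub: "column_dyads \<phi> \<subseteq> row_dyads x"
  obtain u where u: "cblinfun_apply \<phi> u = 1" using dual_nonzeroE[OF \<phi>] .
  have mult: "\<exists>k. y = k *\<^sub>C x" for y
  proof -
    obtain \<psi> where y: "dyad y \<phi> = dyad x \<psi>" using sub by auto
    show ?thesis
      using arg_cong[OF y, of "\<lambda>f. cblinfun_apply f u"] u by auto
  qed
  obtain \<eta> :: "'a dual" where \<eta>: "cblinfun_apply \<eta> x = 1" using dual_separates[OF x] by blast
  have "\<exists>k. \<psi> = k *\<^sub>C \<phi>" for \<psi>
  proof (rule dual_multiple_of_kernel[OF \<phi>])
    fix v assume v: "cblinfun_apply \<phi> v = 0"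
    obtain k l where k: "v = k *\<^sub>C x" "u = l *\<^sub>C x" using mult by blast
    then have "k = 0" using u v by (auto simp: cblinfun_apply_linear scaleC_complex_def)
    then show "cblinfun_apply \<psi> v = 0"
      using k by (simp add: complex_vector.scale_zero_left cblinfun_apply_linear)
  qed
  then have "dyad x \<psi> \<in> column_dyads \<phi>" for \<psi>
  proof -
    obtain k where "\<psi> = k *\<^sub>C \<phi>" using \<open>\<And>\<psi>. \<exists>k. \<psi> = k *\<^sub>C \<phi>\<close> by blast
    then have "dyad x \<psi> = dyad (k *\<^sub>C x) \<phi>" by (simp add: dyad_linear)
    then show ?thesis by simp
  qed
  then show "row_dyads x \<subseteq> column_dyads \<phi>" by blast
qed

lemma columns_inter_rows:
  assumes "\<phi> \<noteq> 0" "R \<in> column_dyads \<phi>" "R \<in> row_dyads x"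
  shows "\<exists>k. R = k *\<^sub>C dyad x \<phi>"
proof -
  obtain y \<psi> where R: "R = dyad y \<phi>" "R = dyad x \<psi>" using assms(2,3) by blast
  obtain u where u: "cblinfun_apply \<phi> u = 1" using dual_nonzeroE[OF assms(1)] .
  have "y = cblinfun_apply \<psi> u *\<^sub>C x"
    using arg_cong[OF R(2)[unfolded R(1)], of "\<lambda>f. cblinfun_apply f u"] u by simp
  then show ?thesis by (auto simp: R(1) dyad_linear)
qed

lemma difference_closed_in_union:
  assumes H: "\<And>x y. x \<in> H \<Longrightarrow> y \<in> H \<Longrightarrow> x - y \<in> H"
    and M: "subspace M" "subspace N" and sub: "H \<subseteq> M \<union> N"
  shows "H \<subseteq> M \<or> H \<subseteq> N"
proof (rule ccontr)
  assume "\<not> ?thesis"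
  then obtain x y where x: "x \<in> H" "x \<notin> M" and y: "y \<in> H" "y \<notin> N" by blast
  then have N: "x \<in> N" and M': "y \<in> M" using sub by auto
  have "x - y \<in> M \<or> x - y \<in> N" using H[OF x(1) y(1)] sub by blast
  then show False
  proof
    assume "x - y \<in> M"
    then have "(x - y) + y \<in> M" using M' M(1) by (intro subspace_add)
    then show False using x by simp
  next
    assume "x - y \<in> N"
    then have "x - (x - y) \<in> N" by (rule subspace_diff[OF M(2) N])
    then show False using y by simp
  qed
qed

text \<open>A group is not the union of two proper subgroups, so each \<open>S ` L\<^sub>i\<close> lies in one \<open>M\<^sub>j\<close>, and conversely each
\<open>M\<^sub>j\<close> in one \<open>S ` L\<^sub>i\<close>. The assumptions on inclusions say that the two spaces on a side are incomparable or
equal, which leaves only the two stated matchings.\<close>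

lemma additive_bijection_of_unions:
  assumes A0: "subspace A" and A: "\<And>x y. x \<in> A \<Longrightarrow> y \<in> A \<Longrightarrow> S (x - y) = S x - S y"
    and inj: "inj_on S A" and LA: "L1 \<subseteq> A" "L2 \<subseteq> A"
    and sub: "subspace L1" "subspace L2" "subspace M1" "subspace M2"
    and L: "L1 \<subseteq> L2 \<longleftrightarrow> L2 \<subseteq> L1" and M: "M1 \<subseteq> M2 \<longleftrightarrow> M2 \<subseteq> M1"
    and im: "S ` (L1 \<union> L2) = M1 \<union> M2"
  shows "S ` L1 = M1 \<and> S ` L2 = M2 \<or> S ` L1 = M2 \<and> S ` L2 = M1"
proof -
  have forth: "S ` L \<subseteq> M1 \<or> S ` L \<subseteq> M2" if "L = L1 \<or> L = L2" for L
  proof (rule difference_closed_in_union[OF _ sub(3,4)])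
    have LL: "subspace L" "L \<subseteq> A" using that sub LA by auto
    show "x - y \<in> S ` L" if xy: "x \<in> S ` L" "y \<in> S ` L" for x y
    proof -
      obtain p q where pq: "p \<in> L" "q \<in> L" "x = S p" "y = S q" using xy by blast
      then have "x - y = S (p - q)" using A[of p q] subsetD[OF LL(2)] by simp
      then show ?thesis using subspace_diff[OF LL(1)] pq by blast
    qed
    show "S ` L \<subseteq> M1 \<union> M2" using that im by auto
  qed
  have preimg: "M \<subseteq> S ` L1 \<or> M \<subseteq> S ` L2" if "M = M1 \<or> M = M2" for M
  proof -
    let ?H = "{x \<in> L1 \<union> L2. S x \<in> M}"
    have MM: "subspace M" using that sub by auto
    have "M \<subseteq> S ` (L1 \<union> L2)" unfolding im using that by auto
    then have MS: "M \<subseteq> S ` ?H" by blast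
    have "?H \<subseteq> L1 \<or> ?H \<subseteq> L2"
    proof (rule difference_closed_in_union[OF _ sub(1,2)])
      fix x y assume xy: "x \<in> ?H" "y \<in> ?H"
      then have xyA: "x \<in> A" "y \<in> A" using LA by auto
      have "S (x - y) \<in> M" using xy A[OF xyA] subspace_diff[OF MM] by simp
      then obtain z where z: "z \<in> L1 \<union> L2" "S z = S (x - y)" using MS by force
      have "x - y \<in> A" "z \<in> A" using xyA z LA subspace_diff[OF A0] by auto
      then have "z = x - y" using inj z(2) by (simp add: inj_on_def)
      then show "x - y \<in> ?H" using z \<open>S (x - y) \<in> M\<close> by simp
    qed auto
    then show ?thesis using MS by blast
  qed
  have LS: "S ` L1 \<subseteq> S ` L2 \<longleftrightarrow> S ` L2 \<subseteq> S ` L1"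
    using L LA inj by (simp add: inj_on_image_subset_iff)
  have onto: "M \<subseteq> K"
    if "K \<subseteq> M" "M \<subseteq> S ` L1 \<or> M \<subseteq> S ` L2" "K = S ` L1 \<or> K = S ` L2" for K M
  proof (rule ccontr)
    assume "\<not> M \<subseteq> K"
    with that(2,3) have "K = S ` L1 \<and> M \<subseteq> S ` L2 \<or> K = S ` L2 \<and> M \<subseteq> S ` L1" by metis
    then have "S ` L1 \<subseteq> S ` L2 \<or> S ` L2 \<subseteq> S ` L1"
      using subset_trans[OF that(1), of "S ` L2"] subset_trans[OF that(1), of "S ` L1"] by metis
    then have "S ` L1 = S ` L2" using LS by blast
    then show False using that \<open>\<not> M \<subseteq> K\<close> by simp
  qed
  have img: "K = M1 \<or> K = M2" if K: "K = S ` L1 \<or> K = S ` L2" for K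
  proof -
    have "K \<subseteq> M1 \<or> K \<subseteq> M2"
      using K forth[of L1, OF disjI1[OF refl]] forth[of L2, OF disjI2[OF refl]] by metis
    then show ?thesis
    proof
      assume 1: "K \<subseteq> M1"
      then have "M1 \<subseteq> K" by (rule onto[OF _ preimg K]) simp
      then show ?thesis using 1 by simp
    next
      assume 2: "K \<subseteq> M2"
      then have "M2 \<subseteq> K" by (rule onto[OF _ preimg K]) simp
      then show ?thesis using 2 by simp
    qed
  qed
  have un: "M1 \<union> M2 = S ` L1 \<union> S ` L2" using im by (simp add: image_Un)
  have same: "M1 = M2" if "S ` L1 = S ` L2"
  proof -
    have "M1 \<union> M2 = S ` L1" using un that by simp
    then have "M1 \<subseteq> M2 \<or> M2 \<subseteq> M1" using img[of "S ` L1"] by (metis Un_upper1 Un_upper2)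
    then show ?thesis using M by blast
  qed
  show ?thesis
    using img[of "S ` L1"] img[of "S ` L2"] same by metis
qed

context operator_group
begin

lemma G_transitive:
  assumes "x \<noteq> 0" "y \<noteq> 0"
  shows "\<exists>a\<in>G. cblinfun_apply a x = y"
proof -
  obtain \<phi> :: "'x dual" where \<phi>: "cblinfun_apply \<phi> x = 1" "cblinfun_apply \<phi> y \<noteq> 0"
    using dual_separates_simultaneously[of x 0 y] assms by auto
  then have "cblinfun_id - dyad (x - y) \<phi> \<in> G"
    by (intro id_minus_dyad_G) (simp add: cblinfun_apply_linear)
  moreover have "cblinfun_apply (cblinfun_id - dyad (x - y) \<phi>) x = y"
    using \<phi> by (simp add: cblinfun_apply_arith)
  ultimately show ?thesis by blast
qed

text \<open>First move \<open>x\<close> to \<open>y\<close>, then correct the image of \<open>x'\<close> by a dyad perturbation whose functional vanishes at \<open>y\<close>.\<close>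

lemma G_transitive_on_independent_pairs:
  assumes x: "x \<noteq> 0" "\<And>k. x' \<noteq> k *\<^sub>C x" and y: "y \<noteq> 0" "\<And>k. y' \<noteq> k *\<^sub>C y"
  shows "\<exists>a\<in>G. cblinfun_apply a x = y \<and> cblinfun_apply a x' = y'"
proof -
  obtain a where a: "a \<in> G" "cblinfun_apply a x = y" using G_transitive[OF x(1) y(1)] by blast
  let ?z = "cblinfun_apply a x'"
  have z: "?z \<noteq> k *\<^sub>C y" for k
  proof
    assume "?z = k *\<^sub>C y"
    then have "cblinfun_apply a (x' - k *\<^sub>C x) = 0" using a by (simp add: cblinfun_apply_linear)
    then have "x' - k *\<^sub>C x = 0" by (rule units_injective[OF G_units[OF a(1)]])
    then show False using x(2) by simp
  qed
  obtain \<phi> :: "'x dual" where \<phi>: "cblinfun_apply \<phi> y = 0" "cblinfun_apply \<phi> ?z = 1" "cblinfun_apply \<phi> y' \<noteq> 0"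
    using dual_separates_simultaneously[OF z y(2)] by blast
  then have "cblinfun_id - dyad (?z - y') \<phi> \<in> G"
    by (intro id_minus_dyad_G) (simp add: cblinfun_apply_linear)
  then have "(cblinfun_id - dyad (?z - y') \<phi>) o\<^sub>C\<^sub>L a \<in> G" using a by (intro compose_G)
  moreover have "cblinfun_apply ((cblinfun_id - dyad (?z - y') \<phi>) o\<^sub>C\<^sub>L a) x = y"
    "cblinfun_apply ((cblinfun_id - dyad (?z - y') \<phi>) o\<^sub>C\<^sub>L a) x' = y'"
    using \<phi> a by (simp_all add: cblinfun_apply_arith complex_vector.scale_zero_left)
  ultimately show ?thesis by blast
qed

lemma not_in_G: "cblinfun_apply a x = 0 \<Longrightarrow> x \<noteq> 0 \<Longrightarrow> a \<notin> G"
  using units_injective G_units by blast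

text \<open>For a dyad the numbers \<open>\<phi>(a\<^sup>-\<^sup>1 x)\<close> and \<open>2 \<phi>(a\<^sup>-\<^sup>1 x)\<close> cannot both be \<open>1\<close>. If \<open>R\<close> has two independent values \<open>R x\<close>
and \<open>R y\<close>, transitivity on pairs provides an \<open>a\<close> that agrees with \<open>R\<close> at \<open>x\<close> and with \<open>2 R\<close> at \<open>y\<close>, so
that both differences have a kernel. The multiple \<open>2 R\<close> is written \<open>R + R\<close> so that additive maps respect the criterion.\<close>

lemma dyadic_iff_G:
  "dyadic R \<longleftrightarrow> \<not> (\<exists>a\<in>G. a - R \<notin> G \<and> a - (R + R) \<notin> G)"
proof
  assume "dyadic R"
  then obtain x \<phi> where R: "R = dyad x \<phi>" by (auto simp: dyadic_def)
  then have RR: "R + R = dyad (x + x) \<phi>" by (simp add: dyad_linear)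
  show "\<not> (\<exists>a\<in>G. a - R \<notin> G \<and> a - (R + R) \<notin> G)"
  proof
    assume "\<exists>a\<in>G. a - R \<notin> G \<and> a - (R + R) \<notin> G"
    then obtain a where a: "a \<in> G" "a - dyad x \<phi> \<notin> G" "a - dyad (x + x) \<phi> \<notin> G"
      unfolding RR unfolding R by blast
    obtain b where b: "inverse_ops a b" using inverse_G[OF a(1)] by blast
    have "cblinfun_apply \<phi> (cblinfun_apply b x) = 1" "cblinfun_apply \<phi> (cblinfun_apply b (x + x)) = 1"
      using a minus_dyad_in_G_iff[OF a(1) b] by blast+
    then show False by (simp add: cblinfun_apply_linear)
  qed
next
  assume *: "\<not> (\<exists>a\<in>G. a - R \<notin> G \<and> a - (R + R) \<notin> G)"
  show "dyadic R"
  proof (rule ccontr)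
    assume "\<not> dyadic R"
    then obtain x y where x: "cblinfun_apply R x \<noteq> 0"
      and y: "\<And>k. cblinfun_apply R y \<noteq> k *\<^sub>C cblinfun_apply R x" by (rule not_dyadicE) blast
    have x0: "x \<noteq> 0" using x by (auto simp: cblinfun_apply_linear)
    have y0: "y \<noteq> k *\<^sub>C x" for k using y[of k] by (auto simp: cblinfun_apply_linear)
    have y2: "2 *\<^sub>C cblinfun_apply R y \<noteq> k *\<^sub>C cblinfun_apply R x" for k
    proof
      assume "2 *\<^sub>C cblinfun_apply R y = k *\<^sub>C cblinfun_apply R x"
      then have "(1/2) *\<^sub>C 2 *\<^sub>C cblinfun_apply R y = (1/2) *\<^sub>C k *\<^sub>C cblinfun_apply R x" by simp
      then show False using y[of "(1/2) * k"] by (simp add: scaleC_scaleC)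
    qed
    obtain a where a: "a \<in> G" "cblinfun_apply a x = cblinfun_apply R x"
      "cblinfun_apply a y = 2 *\<^sub>C cblinfun_apply R y"
      using G_transitive_on_independent_pairs[OF x0 y0 x y2] by blast
    have "a - R \<notin> G"
      by (rule not_in_G[OF _ x0]) (simp add: a cblinfun_apply_arith)
    moreover have "a - (R + R) \<notin> G"
    proof (rule not_in_G)
      have "2 *\<^sub>C cblinfun_apply R y = cblinfun_apply R y + cblinfun_apply R y"
        using scaleC_add_left[of 1 1 "cblinfun_apply R y"] by simp
      then show "cblinfun_apply (a - (R + R)) y = 0" by (simp add: a cblinfun_apply_arith)
      show "y \<noteq> 0" using y0[of 0] by (simp add: complex_vector.scale_zero_left)
    qed
    ultimately show False using * a(1) by blast
  qed
qed

end

section \<open>The isometry extends to the algebra\<close>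

locale group_isometry = dom: operator_group A G + cod: operator_group B H
  for A G :: "('x::complex_banach \<Rightarrow>\<^sub>C\<^sub>L 'x) set" and B H :: "('y::complex_banach \<Rightarrow>\<^sub>C\<^sub>L 'y) set" +
  fixes T :: "('x \<Rightarrow>\<^sub>C\<^sub>L 'x) \<Rightarrow> ('y \<Rightarrow>\<^sub>C\<^sub>L 'y)"
  assumes T_onto: "T ` G = H" and T_isometry: "norm_isometry_on G T"
begin

lemma T_norm: "a \<in> G \<Longrightarrow> b \<in> G \<Longrightarrow> norm (T a - T b) = norm (a - b)"
  using T_isometry by (simp add: norm_isometry_on_def)

lemma T_in: "a \<in> G \<Longrightarrow> T a \<in> H"
  using T_onto by blast

definition affine_at :: "('x \<Rightarrow>\<^sub>C\<^sub>L 'x) \<Rightarrow> (('x \<Rightarrow>\<^sub>C\<^sub>L 'x) \<Rightarrow> ('y \<Rightarrow>\<^sub>C\<^sub>L 'y)) \<Rightarrow> ('y \<Rightarrow>\<^sub>C\<^sub>L 'y) \<Rightarrow> bool" where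
  "affine_at a D c \<longleftrightarrow> (\<exists>\<epsilon>>0. \<forall>x\<in>A. norm (x - a) < \<epsilon> \<longrightarrow> T x = D x + c)"

lemma locally_affine:
  assumes a: "a \<in> G"
  obtains D c where "additive_isometry A B D" "affine_at a D c"
proof -
  obtain e1 where e1: "0 < e1" "\<And>x. x \<in> A \<Longrightarrow> norm (x - a) < e1 \<Longrightarrow> x \<in> G"
    using dom.G_open[OF a] by blast
  obtain e2 where e2: "0 < e2" "\<And>x. x \<in> B \<Longrightarrow> norm (x - T a) < e2 \<Longrightarrow> x \<in> H"
    using cod.G_open[OF T_in[OF a]] by blast
  define e where "e = min e1 e2"
  have e: "0 < e" using e1 e2 by (simp add: e_def)
  have GA: "x \<in> G" if "x \<in> A \<inter> ball a e" for x
    using that e1 by (auto simp: e_def dist_norm norm_minus_commute)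
  have HB: "x \<in> H" if "x \<in> B \<inter> ball (T a) e" for x
    using that e2 by (auto simp: e_def dist_norm norm_minus_commute)
  have "isometry_between (A \<inter> ball a e) (B \<inter> ball (T a) e) T"
    unfolding isometry_between_def bij_betw_def
  proof (intro conjI)
    show "norm_isometry_on (A \<inter> ball a e) T"
      using GA T_norm by (simp add: norm_isometry_on_def)
    show "inj_on T (A \<inter> ball a e)"
    proof (rule inj_onI)
      fix x y assume "x \<in> A \<inter> ball a e" "y \<in> A \<inter> ball a e" "T x = T y"
      then show "x = y" using T_norm[OF GA GA, of x y] by simp
    qed
    show "T ` (A \<inter> ball a e) = B \<inter> ball (T a) e"
    proof (intro equalityI subsetI)
      fix y assume "y \<in> T ` (A \<inter> ball a e)"
      then obtain x where x: "x \<in> A \<inter> ball a e" "y = T x" by blast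
      then show "y \<in> B \<inter> ball (T a) e"
        using T_norm[OF a GA[OF x(1)]] cod.G_in[OF T_in[OF GA[OF x(1)]]] by (simp add: dist_norm)
    next
      fix y assume y: "y \<in> B \<inter> ball (T a) e"
      obtain x where x: "x \<in> G" "y = T x" using HB[OF y] T_onto by blast
      then have "x \<in> A \<inter> ball a e"
        using y T_norm[OF a x(1)] dom.G_in[OF x(1)] by (simp add: dist_norm)
      then show "y \<in> T ` (A \<inter> ball a e)" using x by blast
    qed
  qed
  from isometry_of_balls_affine[OF dom.real_subspace cod.real_subspace this dom.G_in[OF a] e]
  obtain D c where "additive_isometry A B D" "\<forall>x\<in>A. norm (x - a) < e / 2 \<longrightarrow> T x = D x + c" by blast
  then show ?thesis
    using e by (intro that[of D c]) (auto simp: affine_at_def intro!: exI[of _ "e / 2"])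
qed

text \<open>Two additive maps that agree near \<open>0\<close> agree everywhere.\<close>

lemma affine_at_unique:
  assumes D: "additive_isometry A B D" "affine_at a D c"
    and D': "additive_isometry A B D'" "affine_at a D' c'" and a: "a \<in> A"
  shows "c = c'" "\<And>x. x \<in> A \<Longrightarrow> D x = D' x"
proof -
  obtain e1 where e1: "0 < e1" "\<And>x. x \<in> A \<Longrightarrow> norm (x - a) < e1 \<Longrightarrow> T x = D x + c"
    using D(2) by (auto simp: affine_at_def)
  obtain e2 where e2: "0 < e2" "\<And>x. x \<in> A \<Longrightarrow> norm (x - a) < e2 \<Longrightarrow> T x = D' x + c'"
    using D'(2) by (auto simp: affine_at_def)
  have add: "E (x + y) = E x + E y" if "additive_isometry A B E" "x \<in> A" "y \<in> A" for E x y
    using that by (simp add: additive_isometry_def)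
  have at: "D a + c = D' a + c'" using e1(2)[OF a] e2(2)[OF a] e1(1) e2(1) by simp
  have small: "D x = D' x" if x: "x \<in> A" "norm x < min e1 e2" for x
  proof -
    have "a + x \<in> A" using a x dom.algebra_closed by simp
    then have "D (a + x) + c = D' (a + x) + c'" using e1(2)[of "a + x"] e2(2)[of "a + x"] x by simp
    then have "(D a + c) + D x = (D' a + c') + D' x"
      by (simp add: add[OF D(1) a x(1)] add[OF D'(1) a x(1)] algebra_simps)
    then show ?thesis using at by simp
  qed
  have mult: "E (real n *\<^sub>R x) = real n *\<^sub>R E x" if E: "additive_isometry A B E" and x: "x \<in> A" for E n x
  proof (induction n)
    case 0
    have "E (0 + 0) = E 0 + E 0" by (rule add[OF E]) (simp_all add: dom.algebra_closed)
    then show ?case by simp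
  next
    case (Suc n)
    have "E (real n *\<^sub>R x + x) = E (real n *\<^sub>R x) + E x"
      by (rule add[OF E]) (simp_all add: x real_vector.subspace_scale[OF dom.real_subspace])
    then show ?case using Suc by (simp add: algebra_simps)
  qed
  show eq: "D x = D' x" if x: "x \<in> A" for x
  proof -
    define m where "m = min e1 e2"
    have m: "0 < m" using e1(1) e2(1) by (simp add: m_def)
    obtain n where n: "norm x / m < real n" using reals_Archimedean2 by blast
    have "0 \<le> norm x / m" using m by simp
    then have n0: "0 < real n" using n by linarith
    let ?y = "(1 / real n) *\<^sub>R x"
    have y: "?y \<in> A" using x by (simp add: real_vector.subspace_scale[OF dom.real_subspace])
    have "norm ?y < m"
      using n n0 m by (simp add: field_simps)
    then have "D ?y = D' ?y" using small[OF y] by (simp add: m_def)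
    then have "D (real n *\<^sub>R ?y) = D' (real n *\<^sub>R ?y)" by (simp only: mult[OF D(1) y] mult[OF D'(1) y])
    then show ?thesis using n0 by simp
  qed
  show "c = c'" using at eq[OF a] by simp
qed

text \<open>By uniqueness, the affine form at a point is the affine form at all nearby points.\<close>

lemma affine_at_connected:
  assumes C: "connected C" "C \<subseteq> G" and ab: "a \<in> C" "b \<in> C"
    and D: "additive_isometry A B D" "affine_at a D c"
  shows "affine_at b D c"
proof (rule connected_induction_simple[where P = "\<lambda>x. affine_at x D c", OF C(1) ab D(2)])
  fix p assume p: "p \<in> C"
  then have pG: "p \<in> G" using C(2) by blast
  obtain D' c' where D': "additive_isometry A B D'" "affine_at p D' c'" using locally_affine[OF pG] .
  obtain e where e: "0 < e" "\<And>x. x \<in> A \<Longrightarrow> norm (x - p) < e \<Longrightarrow> T x = D' x + c'"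
    using D'(2) by (auto simp: affine_at_def)
  have near: "affine_at x D' c'" if "x \<in> ball p e" for x
    unfolding affine_at_def
  proof (intro exI[of _ "e - norm (x - p)"] conjI ballI impI)
    show "0 < e - norm (x - p)" using that by (simp add: dist_norm norm_minus_commute)
    fix y assume "y \<in> A" "norm (y - x) < e - norm (x - p)"
    then show "T y = D' y + c'" using norm_triangle_ineq[of "y - x" "x - p"] by (intro e(2)) auto
  qed
  have "affine_at y D c" if x: "x \<in> C \<inter> ball p e" "affine_at x D c" and y: "y \<in> C \<inter> ball p e" for x y
  proof -
    have xA: "x \<in> A" using x(1) C(2) dom.G_in by blast
    have "affine_at x D' c'" using near x(1) by blast
    note eq = affine_at_unique[OF D(1) x(2) D'(1) this xA]
    have "affine_at y D' c'" using near y by blast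
    then show ?thesis unfolding affine_at_def using eq by metis
  qed
  then have "\<forall>x\<in>C \<inter> ball p e. \<forall>y\<in>C \<inter> ball p e. affine_at x D c \<longrightarrow> affine_at y D c" by blast
  moreover have "openin (top_of_set C) (C \<inter> ball p e)" by (simp add: openin_open_Int)
  moreover have "p \<in> C \<inter> ball p e" using p e(1) by simp
  ultimately show "\<exists>U. openin (top_of_set C) U \<and> p \<in> U \<and> (\<forall>x\<in>U. \<forall>y\<in>U. affine_at x D c \<longrightarrow> affine_at y D c)"
    by blast
qed

text \<open>Travel from \<open>e\<close> to \<open>\<mu> e\<close> through nonzero scalars, then along the segment to \<open>\<mu> e + a\<close>, which stays in \<open>G\<close> when
\<open>\<bar>\<mu>\<bar>\<close> is large compared with \<open>\<parallel>a\<parallel>\<close>.\<close>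

lemma affine_far_out:
  assumes D: "additive_isometry A B D" "affine_at cblinfun_id D c" and a: "a \<in> A"
  obtains r where "0 < r" "\<And>\<mu>. r \<le> cmod \<mu> \<Longrightarrow> \<mu> *\<^sub>C cblinfun_id + a \<in> G \<and> T (\<mu> *\<^sub>C cblinfun_id + a) = D (\<mu> *\<^sub>C cblinfun_id + a) + c"
proof -
  obtain r where r: "0 < r"
    "\<And>\<mu> x. r \<le> cmod \<mu> \<Longrightarrow> x \<in> A \<Longrightarrow> norm x \<le> norm a \<Longrightarrow> \<mu> *\<^sub>C cblinfun_id + x \<in> G"
    using dom.large_scalar_plus_G[OF a] by blast
  show ?thesis
  proof (rule that[OF r(1)])
    fix \<mu> :: complex assume \<mu>: "r \<le> cmod \<mu>"
    then have \<mu>0: "\<mu> \<noteq> 0" using r(1) by auto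
    let ?C = "(\<lambda>t::real. \<mu> *\<^sub>C cblinfun_id + t *\<^sub>R a) ` {0..1}"
    have "connected ?C"
      by (intro connected_continuous_image continuous_intros convex_connected convex_real_interval)
    moreover have CG: "?C \<subseteq> G"
    proof clarify
      fix t :: real assume t: "t \<in> {0..1}"
      then have "norm (t *\<^sub>R a) \<le> norm a" by (simp add: mult_left_le_one_le)
      then show "\<mu> *\<^sub>C cblinfun_id + t *\<^sub>R a \<in> G"
        using \<mu> real_vector.subspace_scale[OF dom.real_subspace a] by (intro r(2))
    qed
    ultimately have step: "affine_at q D c" if "affine_at p D c" "p \<in> ?C" "q \<in> ?C" for p q
      using affine_at_connected[OF _ CG that(2,3) D(1) that(1)] by blast
    have "affine_at (\<mu> *\<^sub>C cblinfun_id) D c"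
    proof (rule affine_at_connected[OF connected_nonzero_multiples dom.scalars_subset_G _ _ D])
      show "cblinfun_id \<in> (\<lambda>\<mu>. \<mu> *\<^sub>C cblinfun_id) ` (- {0})" by (rule image_eqI[of _ _ 1]) simp_all
      show "\<mu> *\<^sub>C cblinfun_id \<in> (\<lambda>\<mu>. \<mu> *\<^sub>C cblinfun_id) ` (- {0})" using \<mu>0 by (intro imageI) simp
    qed
    moreover have "\<mu> *\<^sub>C cblinfun_id \<in> ?C" by (rule image_eqI[of _ _ 0]) simp_all
    moreover have inC: "\<mu> *\<^sub>C cblinfun_id + a \<in> ?C" by (rule image_eqI[of _ _ 1]) simp_all
    ultimately have "affine_at (\<mu> *\<^sub>C cblinfun_id + a) D c" by (rule step)
    moreover have "\<mu> *\<^sub>C cblinfun_id + a \<in> G" using CG inC by blast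
    ultimately show "\<mu> *\<^sub>C cblinfun_id + a \<in> G \<and> T (\<mu> *\<^sub>C cblinfun_id + a) = D (\<mu> *\<^sub>C cblinfun_id + a) + c"
      using dom.G_in by (auto simp: affine_at_def)
  qed
qed

text \<open>The components of \<open>G\<close> have to be linked by metric means, because local affinity says nothing across a gap. The points
\<open>\<mu> e + a\<close> lie in the component of \<open>e\<close>, and their distance to \<open>a\<close> is \<open>\<bar>\<mu>\<bar>\<close> times that of \<open>e\<close> to \<open>0\<close>.\<close>

lemma globally_affine:
  "\<exists>D c. additive_isometry A B D \<and> (\<forall>a\<in>G. T a = D a + c)"
proof -
  obtain D c where D: "additive_isometry A B D" "affine_at cblinfun_id D c"
    using locally_affine[OF dom.id_G] .
  have im: "D ` A = B" and add: "\<And>x y. x \<in> A \<Longrightarrow> y \<in> A \<Longrightarrow> D (x + y) = D x + D y"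
    and nrm: "\<And>x. x \<in> A \<Longrightarrow> norm (D x) = norm x"
    using D(1) by (auto simp: additive_isometry_def)
  note diff = additive_isometry_diff[OF dom.real_subspace D(1)]
  have "T cblinfun_id = D cblinfun_id + c"
    using D(2) dom.algebra_closed by (auto simp: affine_at_def)
  then have "c = T cblinfun_id - D cblinfun_id" by simp
  moreover have "D cblinfun_id \<in> B" using im dom.algebra_closed by blast
  ultimately have cB: "c \<in> B" using cod.algebra_closed(4) cod.G_in[OF T_in[OF dom.id_G]] by simp
  have "T a = D a + c" if a: "a \<in> G" for a
  proof -
    have aA: "a \<in> A" by (rule dom.G_in[OF a])
    have "T a - c - D a \<in> B"
      using cB im aA cod.G_in[OF T_in[OF a]] by (intro cod.algebra_closed(4)) auto
    then obtain z where z: "z \<in> A" "D z = T a - c - D a" using im by (metis imageE)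
    obtain r where r: "0 < r" "\<And>\<mu>. r \<le> cmod \<mu> \<Longrightarrow> \<mu> *\<^sub>C cblinfun_id + a \<in> G \<and> T (\<mu> *\<^sub>C cblinfun_id + a) = D (\<mu> *\<^sub>C cblinfun_id + a) + c"
      using affine_far_out[OF D aA] by blast
    have bound: "norm (z - \<mu> *\<^sub>C cblinfun_id) \<le> cmod \<mu>" if "r \<le> cmod \<mu>" for \<mu>
    proof -
      let ?m = "\<mu> *\<^sub>C (cblinfun_id :: 'x \<Rightarrow>\<^sub>C\<^sub>L 'x)"
      have mA: "?m \<in> A" by (simp add: dom.algebra_closed)
      have "norm (z - ?m) = norm (D z - D ?m)"
        using nrm[of "z - ?m"] diff[OF z(1) mA] z(1) mA dom.algebra_closed(4) by simp
      also have "D z - D ?m = T a - T (?m + a)"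
        using r(2)[OF that] by (simp add: z(2) add[OF mA aA])
      also have "norm \<dots> = norm (a - (?m + a))"
        using T_norm[OF a] r(2)[OF that] by blast
      also have "\<dots> = cmod \<mu> * norm (cblinfun_id :: 'x \<Rightarrow>\<^sub>C\<^sub>L 'x)"
        by (simp add: norm_scaleC)
      also have "\<dots> \<le> cmod \<mu> * 1"
        by (intro mult_left_mono norm_cblinfun_bound) auto
      finally show ?thesis by simp
    qed
    \<comment> \<open>For \<open>\<bar>\<omega>\<bar> = 1\<close>, \<open>e + \<omega> z / r\<close> is \<open>z - \<mu> e\<close> with \<open>\<mu> = - r / \<omega>\<close>, rescaled to size one.\<close>
    have "(1 / of_real r) *\<^sub>C z = 0"
    proof (rule identity_is_vertex_of_unit_ball)
      fix \<omega> :: complex assume \<omega>: "cmod \<omega> = 1"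
      let ?\<mu> = "- of_real r * inverse \<omega>"
      have \<omega>0: "\<omega> \<noteq> 0" using \<omega> by auto
      have "cblinfun_id + \<omega> *\<^sub>C (1 / of_real r) *\<^sub>C z = (\<omega> / of_real r) *\<^sub>C (z - ?\<mu> *\<^sub>C cblinfun_id)"
        using \<omega>0 r(1) by (simp add: scaleC_scaleC scaleC_diff_right scaleC_add_right algebra_simps)
      then have "norm (cblinfun_id + \<omega> *\<^sub>C (1 / of_real r) *\<^sub>C z) = (1 / r) * norm (z - ?\<mu> *\<^sub>C cblinfun_id)"
        using \<omega> r(1) by (simp add: norm_scaleC norm_divide)
      also have "\<dots> \<le> (1 / r) * cmod ?\<mu>"
        using \<omega> r(1) by (intro mult_left_mono bound) (auto simp: norm_mult norm_inverse)
      also have "\<dots> = 1" using \<omega> r(1) by (simp add: norm_mult norm_inverse)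
      finally show "norm (cblinfun_id + \<omega> *\<^sub>C (1 / of_real r) *\<^sub>C z) \<le> 1" .
    qed
    then have "norm ((1 / of_real r :: complex) *\<^sub>C z) = 0" by simp
    then have "z = 0" using r(1) by (simp add: norm_scaleC norm_divide)
    then have "D z = 0" using nrm[OF z(1)] by simp
    then show ?thesis using z(2) by (simp add: algebra_simps)
  qed
  then show ?thesis using D(1) by blast
qed

text \<open>The translation part vanishes because \<open>H\<close> would otherwise be invariant under subtracting a fixed nonzero operator, while
\<open>H\<close> acts transitively on nonzero vectors.\<close>

lemma extends_to_additive_isometry:
  obtains D where "additive_isometry A B D" "\<And>a. a \<in> G \<Longrightarrow> T a = D a"
proof -
  obtain D c where D: "additive_isometry A B D" and T: "\<And>a. a \<in> G \<Longrightarrow> T a = D a + c"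
    using globally_affine by blast
  have shift: "b - (1/2) *\<^sub>C c \<in> H" if b: "b \<in> H" for b
  proof -
    obtain a where a: "a \<in> G" "b = T a" using b T_onto by blast
    have "2 *\<^sub>C a = a + a" using scaleC_add_left[of 1 1 a] by simp
    then have aa: "a + a \<in> G" using dom.scalar_mult_G[OF a(1), of 2] by simp
    have "D (a + a) = D a + D a" using D dom.G_in[OF a(1)] by (simp add: additive_isometry_def)
    then have "T (a + a) = (b + b) - c" using T[OF aa] T[OF a(1)] a(2) by simp
    moreover have "(1/2) *\<^sub>C T (a + a) \<in> H" using T_in[OF aa] by (intro cod.scalar_mult_G) auto
    moreover have "(1/2) *\<^sub>C (b + b) = b"
      using scaleC_add_left[of "1/2" "1/2" b] by (simp add: scaleC_add_right)
    ultimately show ?thesis by (simp add: scaleC_diff_right)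
  qed
  \<comment> \<open>An element of \<open>H\<close> that agrees with \<open>c / 2\<close> at one vector contradicts the shift invariance.\<close>
  have "c = 0"
  proof (rule ccontr)
    assume "c \<noteq> 0"
    then obtain x where x: "cblinfun_apply c x \<noteq> 0"
      using cblinfun_eqI[of c 0] by (auto simp: cblinfun_apply_arith)
    then have x0: "x \<noteq> 0" by (auto simp: cblinfun_apply_linear)
    have "norm ((1/2 :: complex) *\<^sub>C cblinfun_apply c x) \<noteq> 0" using x by (simp add: norm_scaleC)
    then have "(1/2 :: complex) *\<^sub>C cblinfun_apply c x \<noteq> 0" by auto
    then obtain b where b: "b \<in> H" "cblinfun_apply b x = (1/2) *\<^sub>C cblinfun_apply c x"
      using cod.G_transitive[OF x0] by blast
    then have "cblinfun_apply (b - (1/2) *\<^sub>C c) x = 0" by (simp add: cblinfun_apply_arith)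
    then show False using cod.not_in_G[OF _ x0] shift[OF b(1)] by blast
  qed
  then show ?thesis using that[OF D] T by simp
qed

end

section \<open>The normalized extension on dyads\<close>

text \<open>These are the field automorphisms of the complex numbers that fix the reals; treating them together handles linear and
conjugate linear operators at once.\<close>

definition real_automorphism :: "(complex \<Rightarrow> complex) \<Rightarrow> bool" where
  "real_automorphism h \<longleftrightarrow> h = (\<lambda>c. c) \<or> h = cnj"

lemma real_automorphism_simps:
  assumes "real_automorphism h"
  shows "h 0 = 0" "h 1 = 1" "h (c + d) = h c + h d" "h (c - d) = h c - h d" "h (c * d) = h c * h d"
    "h (c / d) = h c / h d" "h (h c) = c" "h (complex_of_real r) = complex_of_real r"
    "cmod (h c) = cmod c"
  using assms by (auto simp: real_automorphism_def)

lemma real_automorphism_inj: "real_automorphism h \<Longrightarrow> h c = h d \<longleftrightarrow> c = d"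
  by (auto simp: real_automorphism_def)

text \<open>The distances to \<open>0\<close> and \<open>1\<close> determine a number up to conjugation, and the distance to the image of \<open>\<i>\<close> decides
which alternative holds, consistently for all numbers.\<close>

lemma complex_isometry_fixing_0_1:
  fixes k :: "complex \<Rightarrow> complex"
  assumes iso: "\<And>c d. cmod (k c - k d) = cmod (c - d)" and k: "k 0 = 0" "k 1 = 1"
  shows "real_automorphism k"
proof -
  have eqs: "(Re (k c) - Re (k d))\<^sup>2 + (Im (k c) - Im (k d))\<^sup>2 = (Re c - Re d)\<^sup>2 + (Im c - Im d)\<^sup>2" for c d
    using arg_cong[OF iso[of c d], of "\<lambda>x. x\<^sup>2"] by (simp add: cmod_power2)
  have Re: "Re (k c) = Re c" for c
  proof -
    have "(Re (k c))\<^sup>2 + (Im (k c))\<^sup>2 = (Re c)\<^sup>2 + (Im c)\<^sup>2"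
      "(Re (k c) - 1)\<^sup>2 + (Im (k c))\<^sup>2 = (Re c - 1)\<^sup>2 + (Im c)\<^sup>2"
      using eqs[of c 0] eqs[of c 1] by (simp_all add: k)
    then show ?thesis by (simp add: power2_diff)
  qed
  have Im: "(Im (k c) - Im (k d))\<^sup>2 = (Im c - Im d)\<^sup>2" for c d
    using eqs[of c d] by (simp add: Re)
  have Im0: "Im (k c) = Im c \<or> Im (k c) = - Im c" for c
    using Im[of c 0] by (simp add: k power2_eq_iff)
  have "Im (k \<i>) = 1 \<or> Im (k \<i>) = - 1" using Im0[of \<i>] by simp
  then show ?thesis
  proof
    assume i: "Im (k \<i>) = 1"
    have "k c = c" for c
      using Im0[of c] Im[of c \<i>] Re[of c] by (auto simp: i complex_eq_iff power2_eq_iff)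
    then show ?thesis by (auto simp: real_automorphism_def)
  next
    assume i: "Im (k \<i>) = - 1"
    have "k c = cnj c" for c
      using Im0[of c] Im[of c \<i>] Re[of c] by (auto simp: i complex_eq_iff power2_eq_iff)
    then show ?thesis by (auto simp: real_automorphism_def)
  qed
qed

lemma scaleC_eq_0_iff: "c *\<^sub>C x = 0 \<longleftrightarrow> c = 0 \<or> x = 0" for x :: "'a::complex_vector"
  by (rule complex_vector.scale_eq_0_iff)

lemma dyad_left_inject: "\<phi> \<noteq> 0 \<Longrightarrow> dyad x \<phi> = dyad y \<phi> \<longleftrightarrow> x = y"
  using dyad_eq_0_iff[of "x - y" \<phi>] by (simp add: dyad_linear)

lemma dual_eqI:
  fixes x y :: "'a::complex_normed_vector"
  assumes "\<And>\<phi> :: 'a dual. cblinfun_apply \<phi> x = cblinfun_apply \<phi> y"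
  shows "x = y"
proof (rule ccontr)
  assume "x \<noteq> y"
  then obtain \<phi> :: "'a dual" where "cblinfun_apply \<phi> (x - y) = 1"
    using dual_separates[of "x - y"] by auto
  then show False using assms[of \<phi>] by (simp add: cblinfun_apply_linear)
qed

text \<open>\<open>D\<close> and \<open>E = T(e)\<^sup>-\<^sup>1\<close> are parameters, so that the normalization \<open>S\<close> below can be a definition.\<close>

locale extended_isometry = group_isometry A G B H T
  for A G :: "('x::complex_banach \<Rightarrow>\<^sub>C\<^sub>L 'x) set" and B H :: "('y::complex_banach \<Rightarrow>\<^sub>C\<^sub>L 'y) set"
    and T :: "('x \<Rightarrow>\<^sub>C\<^sub>L 'x) \<Rightarrow> ('y \<Rightarrow>\<^sub>C\<^sub>L 'y)" +
  fixes D :: "('x \<Rightarrow>\<^sub>C\<^sub>L 'x) \<Rightarrow> ('y \<Rightarrow>\<^sub>C\<^sub>L 'y)" and E :: "'y \<Rightarrow>\<^sub>C\<^sub>L 'y"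
  assumes D: "additive_isometry A B D" and T_eq: "a \<in> G \<Longrightarrow> T a = D a"
    and E: "inverse_ops (T cblinfun_id) E"
begin

definition S :: "('x \<Rightarrow>\<^sub>C\<^sub>L 'x) \<Rightarrow> ('y \<Rightarrow>\<^sub>C\<^sub>L 'y)" where
  "S b = E o\<^sub>C\<^sub>L D b"

lemma D_image: "D ` A = B" and D_add: "x \<in> A \<Longrightarrow> y \<in> A \<Longrightarrow> D (x + y) = D x + D y"
  and D_norm: "x \<in> A \<Longrightarrow> norm (D x) = norm x"
  using D by (auto simp: additive_isometry_def)

lemmas D_diff = additive_isometry_diff[OF dom.real_subspace D]

lemma D_inj: "x \<in> A \<Longrightarrow> y \<in> A \<Longrightarrow> D x = D y \<Longrightarrow> x = y"
  using D_norm[of "x - y"] D_diff[of x y] dom.algebra_closed(4)[of x y] by simp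

lemma E_in: "E \<in> H"
  using cod.inverse_ops_in_G[OF T_in[OF dom.id_G] E] .

lemma D_eq: "D b = T cblinfun_id o\<^sub>C\<^sub>L S b"
  unfolding S_def using E by (simp add: cblinfun_compose_algebra inverse_ops_def)

lemma S_in: "b \<in> A \<Longrightarrow> S b \<in> B"
  unfolding S_def using D_image cod.G_in[OF E_in] by (intro cod.algebra_closed(6)) auto

lemma S_add: "x \<in> A \<Longrightarrow> y \<in> A \<Longrightarrow> S (x + y) = S x + S y"
  by (simp add: S_def D_add cblinfun_compose_algebra)

lemma S_diff: "x \<in> A \<Longrightarrow> y \<in> A \<Longrightarrow> S (x - y) = S x - S y"
  by (simp add: S_def D_diff cblinfun_compose_algebra)

lemma S_0: "S 0 = 0"
  using S_diff[of 0 0] dom.algebra_closed(1) by simp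

lemma S_id: "S cblinfun_id = cblinfun_id"
  using E T_eq[OF dom.id_G] by (simp add: S_def inverse_ops_def)

lemma S_inj: "inj_on S A"
proof (rule inj_onI)
  fix x y assume "x \<in> A" "y \<in> A" "S x = S y"
  then show "x = y" using D_inj D_eq by metis
qed

lemma S_image: "S ` A = B"
proof (intro equalityI subsetI)
  fix y assume y: "y \<in> B"
  have "T cblinfun_id o\<^sub>C\<^sub>L y \<in> B"
    using y cod.G_in[OF T_in[OF dom.id_G]] by (intro cod.algebra_closed(6))
  then obtain x where x: "x \<in> A" "D x = T cblinfun_id o\<^sub>C\<^sub>L y" using D_image by (metis imageE)
  have "S x = y" unfolding S_def x(2) using E by (simp add: cblinfun_compose_algebra inverse_ops_def)
  then show "y \<in> S ` A" using x by blast
qed (use S_in in blast)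

lemma S_in_H_iff:
  assumes b: "b \<in> A"
  shows "S b \<in> H \<longleftrightarrow> b \<in> G"
proof
  assume "b \<in> G"
  then show "S b \<in> H" unfolding S_def using T_eq[of b] T_in[of b] by (intro cod.compose_G E_in) simp
next
  assume "S b \<in> H"
  from cod.compose_G[OF T_in[OF dom.id_G] this] have "D b \<in> H" by (simp only: D_eq)
  then obtain g where g: "g \<in> G" "D b = T g" using T_onto by blast
  then have "b = g" using D_inj[OF b dom.G_in[OF g(1)]] T_eq by simp
  then show "b \<in> G" using g by simp
qed

lemma S_eq_0_iff: "b \<in> A \<Longrightarrow> S b = 0 \<longleftrightarrow> b = 0"
  using S_inj S_0 dom.algebra_closed(1) by (metis inj_on_eq_iff)

lemma norm_S_le: "b \<in> A \<Longrightarrow> norm (S b) \<le> norm E * norm b"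
  using norm_cblinfun_compose[of E "D b"] by (simp add: S_def D_norm)

lemma norm_le_S: "b \<in> A \<Longrightarrow> norm b \<le> norm (T cblinfun_id) * norm (S b)"
  using norm_cblinfun_compose[of "T cblinfun_id" "S b"] D_norm[of b] by (simp add: D_eq)

lemma dyadic_in: "dyadic R \<Longrightarrow> R \<in> A"
  by (auto simp: dyadic_def dom.algebra_closed)

text \<open>\<open>dyadic_iff_G\<close> speaks only of sums, differences and membership in the group.\<close>

lemma dyadic_S:
  assumes R: "R \<in> A"
  shows "dyadic (S R) \<longleftrightarrow> dyadic R"
proof -
  have *: "(S a \<in> H \<and> S a - S R \<notin> H \<and> S a - (S R + S R) \<notin> H) \<longleftrightarrow>
      (a \<in> G \<and> a - R \<notin> G \<and> a - (R + R) \<notin> G)" if a: "a \<in> A" for a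
  proof -
    have RR: "R + R \<in> A" using R dom.algebra_closed(3) by blast
    have "S a - S R = S (a - R)" "S a - (S R + S R) = S (a - (R + R))"
      using a R RR by (simp_all add: S_diff S_add)
    then show ?thesis
      using S_in_H_iff[OF a] S_in_H_iff[of "a - R"] S_in_H_iff[of "a - (R + R)"] a R RR dom.algebra_closed(4)
      by simp
  qed
  have "H \<subseteq> S ` A" unfolding S_image using cod.G_in by blast
  then have "(\<exists>b\<in>H. b - S R \<notin> H \<and> b - (S R + S R) \<notin> H) \<longleftrightarrow>
      (\<exists>a\<in>A. S a \<in> H \<and> S a - S R \<notin> H \<and> S a - (S R + S R) \<notin> H)"
    by blast
  also have "\<dots> \<longleftrightarrow> (\<exists>a\<in>G. a - R \<notin> G \<and> a - (R + R) \<notin> G)"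
    using * dom.G_in by blast
  finally show ?thesis by (simp only: dom.dyadic_iff_G cod.dyadic_iff_G)
qed

lemma S_dyadE:
  obtains y \<psi> where "S (dyad x \<phi>) = dyad y \<psi>"
  using dyadic_S[of "dyad x \<phi>"] dom.algebra_closed(7)[of x \<phi>] by (auto simp: dyadic_def)

text \<open>Adjacency of dyads is preserved, so the union of the two spaces through a dyad goes to the union of the two spaces
through its image, and \<open>additive_bijection_of_unions\<close> separates them.\<close>

lemma S_columns_rows:
  assumes x: "x \<noteq> 0" and \<phi>: "\<phi> \<noteq> 0" and S: "S (dyad x \<phi>) = dyad y \<psi>"
  shows "S ` column_dyads \<phi> = column_dyads \<psi> \<and> S ` row_dyads x = row_dyads y \<or>
    S ` column_dyads \<phi> = row_dyads y \<and> S ` row_dyads x = column_dyads \<psi>"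
proof -
  have xA: "dyad x \<phi> \<in> A" by (rule dom.algebra_closed)
  have "dyad x \<phi> \<noteq> 0" using x \<phi> by (simp add: dyad_eq_0_iff)
  then have "dyad y \<psi> \<noteq> 0" using S_eq_0_iff[OF xA] S by simp
  then have y: "y \<noteq> 0" "\<psi> \<noteq> 0" by (auto simp: dyad_eq_0_iff)
  have "S ` {R. dyadic R \<and> dyadic (R + dyad x \<phi>)} = {Q. dyadic Q \<and> dyadic (Q + dyad y \<psi>)}"
  proof (intro equalityI subsetI)
    fix Q assume "Q \<in> S ` {R. dyadic R \<and> dyadic (R + dyad x \<phi>)}"
    then obtain R where R: "dyadic R" "dyadic (R + dyad x \<phi>)" "Q = S R" by blast
    have "S (R + dyad x \<phi>) = Q + dyad y \<psi>" using S_add[OF dyadic_in[OF R(1)] xA] R(3) S by simp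
    then show "Q \<in> {Q. dyadic Q \<and> dyadic (Q + dyad y \<psi>)}"
      using R dyadic_S[OF dyadic_in[OF R(1)]] dyadic_S[OF dyadic_in[OF R(2)]] by simp
  next
    fix Q assume "Q \<in> {Q. dyadic Q \<and> dyadic (Q + dyad y \<psi>)}"
    then have Q: "dyadic Q" "dyadic (Q + dyad y \<psi>)" by auto
    have "Q \<in> B" using Q(1) by (auto simp: dyadic_def cod.algebra_closed)
    then obtain R where R: "R \<in> A" "Q = S R" using S_image by blast
    have RA: "R + dyad x \<phi> \<in> A" using R(1) xA by (rule dom.algebra_closed(3))
    have "S (R + dyad x \<phi>) = Q + dyad y \<psi>" using S_add[OF R(1) xA] R(2) S by simp
    then have "dyadic R" "dyadic (R + dyad x \<phi>)"
      using Q R(2) dyadic_S[OF R(1)] dyadic_S[OF RA] by simp_all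
    then show "Q \<in> S ` {R. dyadic R \<and> dyadic (R + dyad x \<phi>)}" using R(2) by blast
  qed
  then have im: "S ` (column_dyads \<phi> \<union> row_dyads x) = column_dyads \<psi> \<union> row_dyads y"
    unfolding dyadic_neighbours[OF x \<phi>] dyadic_neighbours[OF y] .
  show ?thesis
  proof (rule additive_bijection_of_unions[OF dom.real_subspace S_diff S_inj _ _
        subspace_columns subspace_rows subspace_columns subspace_rows _ _ im])
    show "column_dyads \<phi> \<subseteq> A" "row_dyads x \<subseteq> A" by (auto simp: dom.algebra_closed)
    show "column_dyads \<phi> \<subseteq> row_dyads x \<longleftrightarrow> row_dyads x \<subseteq> column_dyads \<phi>"
      using rows_subset_columns_iff[OF x \<phi>] by blast
    show "column_dyads \<psi> \<subseteq> row_dyads y \<longleftrightarrow> row_dyads y \<subseteq> column_dyads \<psi>"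
      using rows_subset_columns_iff[OF y] by blast
  qed
qed

text \<open>A space of columns shared by several dyads transports in one way, so the alternative chosen at one dyad settles it at
the others.\<close>

lemma S_rows_of_columns:
  assumes "x \<noteq> 0" "\<phi> \<noteq> 0" "S (dyad x \<phi>) = dyad y \<psi>" "S ` column_dyads \<phi> = column_dyads \<psi>"
  shows "S ` row_dyads x = row_dyads y"
  using S_columns_rows[OF assms(1-3)] assms(4) by metis

lemma S_columns_of_rows:
  assumes "x \<noteq> 0" "\<phi> \<noteq> 0" "S (dyad x \<phi>) = dyad y \<psi>" "S ` row_dyads x = column_dyads \<psi>"
  shows "S ` column_dyads \<phi> = row_dyads y"
  using S_columns_rows[OF assms(1-3)] assms(4) by metis

text \<open>The multiples of a dyad are the intersection of its two spaces.\<close>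

lemma S_scale_dyad:
  assumes R: "dyadic R"
  shows "\<exists>k. S (c *\<^sub>C R) = k *\<^sub>C S R"
proof (cases "R = 0")
  case True
  then show ?thesis by (simp add: S_0)
next
  case False
  obtain x \<phi> where R': "R = dyad x \<phi>" using R by (auto simp: dyadic_def)
  then have x: "x \<noteq> 0" and \<phi>: "\<phi> \<noteq> 0" using False by (auto simp: dyad_eq_0_iff)
  obtain y \<psi> where S: "S (dyad x \<phi>) = dyad y \<psi>" by (rule S_dyadE)
  have "dyad y \<psi> \<noteq> 0" using S_eq_0_iff[OF dyadic_in[OF R]] S R' False by simp
  then have \<psi>: "\<psi> \<noteq> 0" by (auto simp: dyad_eq_0_iff)
  have "c *\<^sub>C R \<in> column_dyads \<phi>" "c *\<^sub>C R \<in> row_dyads x"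
    by (simp_all add: R' flip: dyad_linear(5)) (simp add: dyad_linear(5) flip: dyad_linear(6))
  then have "S (c *\<^sub>C R) \<in> column_dyads \<psi>" "S (c *\<^sub>C R) \<in> row_dyads y"
    using S_columns_rows[OF x \<phi> S] by blast+
  then show ?thesis using columns_inter_rows[OF \<psi>] S R' by auto
qed

text \<open>The factor \<open>k\<close> is the same for \<open>D\<close> and \<open>S\<close>, and for \<open>D\<close> it is an isometry of the plane. In dimension one nothing but this
metric argument ties \<open>S\<close> to the complex structure.\<close>

lemma S_scale_automorphism:
  assumes R: "dyadic R" and R0: "R \<noteq> 0"
  shows "\<exists>k. real_automorphism k \<and> (\<forall>c. S (c *\<^sub>C R) = k c *\<^sub>C S R)"
proof -
  have RA: "R \<in> A" by (rule dyadic_in[OF R])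
  have SR: "S R \<noteq> 0" using S_eq_0_iff[OF RA] R0 by simp
  obtain k where k: "\<And>c. S (c *\<^sub>C R) = k c *\<^sub>C S R" using S_scale_dyad[OF R] by metis
  have Dk: "D (c *\<^sub>C R) = k c *\<^sub>C D R" for c
    by (simp add: D_eq k cblinfun_compose_algebra)
  have "cmod (k c - k d) = cmod (c - d)" for c d
  proof -
    have "cmod (k c - k d) * norm R = norm (D (c *\<^sub>C R) - D (d *\<^sub>C R))"
      using D_norm[OF RA] by (simp add: Dk norm_scaleC flip: complex_vector.scale_left_diff_distrib)
    also have "\<dots> = norm (c *\<^sub>C R - d *\<^sub>C R)"
      using RA D_norm[of "c *\<^sub>C R - d *\<^sub>C R"] by (simp add: D_diff dom.algebra_closed)
    also have "\<dots> = cmod (c - d) * norm R"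
      by (simp add: norm_scaleC flip: complex_vector.scale_left_diff_distrib)
    finally show ?thesis using R0 by simp
  qed
  moreover have "k 0 = 0"
    using k[of 0] SR by (simp add: S_0 scaleC_eq_0_iff)
  moreover have "k 1 = 1"
  proof -
    have "(k 1 - 1) *\<^sub>C S R = 0" using k[of 1] by (simp add: complex_vector.scale_left_diff_distrib)
    then show ?thesis using SR by (simp add: scaleC_eq_0_iff)
  qed
  ultimately have "real_automorphism k" by (rule complex_isometry_fixing_0_1)
  then show ?thesis using k by blast
qed

text \<open>If \<open>R\<close> and \<open>Q\<close> were scaled by different automorphisms, comparing the values at \<open>\<i>\<close> with those of \<open>R + Q\<close>, which
is scaled by one of the two, would make \<open>S R\<close> or \<open>S Q\<close> vanish.\<close>

lemma S_scale_transfer: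
  assumes h: "real_automorphism h" and R: "dyadic R" "R \<noteq> 0" "\<And>c. S (c *\<^sub>C R) = h c *\<^sub>C S R"
    and Q: "dyadic Q" "Q \<noteq> 0" and RQ: "dyadic (R + Q)"
  shows "S (c *\<^sub>C Q) = h c *\<^sub>C S Q"
proof -
  obtain k where k: "real_automorphism k" "\<And>c. S (c *\<^sub>C Q) = k c *\<^sub>C S Q"
    using S_scale_automorphism[OF Q] by blast
  have A: "R \<in> A" "Q \<in> A" using R(1) Q(1) dyadic_in by auto
  have nz: "S R \<noteq> 0" "S Q \<noteq> 0" using A R(2) Q(2) S_eq_0_iff by auto
  have sum: "S (c *\<^sub>C (R + Q)) = h c *\<^sub>C S R + k c *\<^sub>C S Q" for c
    using A by (simp add: scaleC_add_right S_add dom.algebra_closed R(3) k(2))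
  have "h = k"
  proof (rule ccontr)
    assume "h \<noteq> k"
    then have hk: "h \<i> - k \<i> \<noteq> 0" using h k(1) by (auto simp: real_automorphism_def)
    show False
    proof (cases "R + Q = 0")
      case True
      have "h \<i> *\<^sub>C S R + k \<i> *\<^sub>C S Q = 0" using sum[of \<i>] True by (simp add: S_0)
      moreover have "S R = - S Q"
        using S_add[OF A] True by (simp add: S_0 eq_neg_iff_add_eq_0)
      ultimately have "(h \<i> - k \<i>) *\<^sub>C S Q = 0"
        by (auto simp: complex_vector.scale_left_diff_distrib scaleC_minus_right add_eq_0_iff)
      then show False using hk nz by (simp add: scaleC_eq_0_iff)
    next
      case False
      obtain m where m: "real_automorphism m" "\<And>c. S (c *\<^sub>C (R + Q)) = m c *\<^sub>C S (R + Q)"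
        using S_scale_automorphism[OF RQ False] by blast
      have eq: "m \<i> *\<^sub>C S R + m \<i> *\<^sub>C S Q = h \<i> *\<^sub>C S R + k \<i> *\<^sub>C S Q"
        using sum[of \<i>] m(2)[of \<i>] A by (simp add: S_add scaleC_add_right)
      have "m = h \<or> m = k" using h k(1) m(1) \<open>h \<noteq> k\<close> by (auto simp: real_automorphism_def)
      then show False
      proof
        assume "m = h"
        then have "(h \<i> - k \<i>) *\<^sub>C S Q = 0" using eq by (simp add: complex_vector.scale_left_diff_distrib)
        then show False using hk nz by (simp add: scaleC_eq_0_iff)
      next
        assume "m = k"
        then have "(h \<i> - k \<i>) *\<^sub>C S R = 0" using eq by (auto simp: complex_vector.scale_left_diff_distrib)
        then show False using hk nz by (simp add: scaleC_eq_0_iff)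
      qed
    qed
  qed
  then show ?thesis using k(2) by simp
qed

text \<open>Any two nonzero dyads \<open>x \<otimes> \<phi>\<close> and \<open>y \<otimes> \<psi>\<close> are linked through \<open>x \<otimes> \<psi>\<close>, where consecutive dyads share a factor.\<close>

lemma S_semilinear_on_dyads:
  obtains h where "real_automorphism h" "\<And>R c. dyadic R \<Longrightarrow> S (c *\<^sub>C R) = h c *\<^sub>C S R"
proof (cases "\<exists>R :: 'x \<Rightarrow>\<^sub>C\<^sub>L 'x. dyadic R \<and> R \<noteq> 0")
  case False
  then have "S (c *\<^sub>C R) = c *\<^sub>C S R" if "dyadic R" for R c
    using that by (auto simp: S_0)
  then show ?thesis using that[of "\<lambda>c. c"] by (simp add: real_automorphism_def)
next
  case True
  then obtain R :: "'x \<Rightarrow>\<^sub>C\<^sub>L 'x" where R: "dyadic R" "R \<noteq> 0" by blast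
  then obtain x \<phi> where R': "R = dyad x \<phi>" "x \<noteq> 0" "\<phi> \<noteq> 0" by (auto simp: dyadic_def dyad_eq_0_iff)
  obtain h where h: "real_automorphism h" "\<And>c. S (c *\<^sub>C R) = h c *\<^sub>C S R"
    using S_scale_automorphism[OF R] by blast
  have "S (c *\<^sub>C Q) = h c *\<^sub>C S Q" if "dyadic Q" for c Q
  proof (cases "Q = 0")
    case True
    then show ?thesis by (simp add: S_0)
  next
    case False
    with that obtain y \<psi> where Q: "Q = dyad y \<psi>" "y \<noteq> 0" "\<psi> \<noteq> 0" by (auto simp: dyadic_def dyad_eq_0_iff)
    have row: "S (c *\<^sub>C dyad x \<psi>) = h c *\<^sub>C S (dyad x \<psi>)" for c
      by (rule S_scale_transfer[OF h(1) R h(2)])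
        (use R' Q in \<open>simp_all add: dyad_eq_0_iff flip: dyad_linear\<close>)
    show ?thesis
      unfolding Q(1)
      by (rule S_scale_transfer[OF h(1) _ _ row])
        (use R' Q in \<open>simp_all add: dyad_eq_0_iff flip: dyad_linear\<close>)
  qed
  then show ?thesis using that[OF h(1)] by blast
qed

end

context extended_isometry
begin

section \<open>Intertwining operators\<close>

text \<open>By \<open>minus_dyad_in_G_iff\<close> on both sides, \<open>c \<alpha> = 1\<close> and \<open>h(c) \<beta> = 1\<close> are equivalent for every scalar \<open>c\<close>, where
\<open>\<alpha>\<close> and \<open>\<beta>\<close> are the two numbers compared. This determines \<open>\<beta>\<close> from \<open>\<alpha>\<close>, also when \<open>\<alpha> = 0\<close>.\<close>

lemma trace_formula:
  assumes h: "real_automorphism h" "\<And>R c. dyadic R \<Longrightarrow> S (c *\<^sub>C R) = h c *\<^sub>C S R"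
    and a: "a \<in> G" and a': "inverse_ops a a'" and b: "inverse_ops (S a) b"
    and S: "S (dyad x \<phi>) = dyad y \<psi>"
  shows "cblinfun_apply \<psi> (cblinfun_apply b y) = h (cblinfun_apply \<phi> (cblinfun_apply a' x))"
proof -
  let ?\<alpha> = "cblinfun_apply \<phi> (cblinfun_apply a' x)" and ?\<beta> = "cblinfun_apply \<psi> (cblinfun_apply b y)"
  note hs = real_automorphism_simps[OF h(1)]
  have aA: "a \<in> A" by (rule dom.G_in[OF a])
  have SaH: "S a \<in> H" using S_in_H_iff[OF aA] a by simp
  have key: "c * ?\<alpha> = 1 \<longleftrightarrow> h c * ?\<beta> = 1" for c
  proof -
    have "S (a - dyad (c *\<^sub>C x) \<phi>) = S a - dyad (h c *\<^sub>C y) \<psi>"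
      using S_diff[OF aA] h(2)[of "dyad x \<phi>" c] S by (simp add: dyad_linear dom.algebra_closed)
    then have "a - dyad (c *\<^sub>C x) \<phi> \<in> G \<longleftrightarrow> S a - dyad (h c *\<^sub>C y) \<psi> \<in> H"
      using S_in_H_iff[of "a - dyad (c *\<^sub>C x) \<phi>"] aA dom.algebra_closed(4,7) by simp
    then show ?thesis
      using dom.minus_dyad_in_G_iff[OF a a'] cod.minus_dyad_in_G_iff[OF SaH b]
      by (simp add: cblinfun_apply_linear scaleC_complex_def)
  qed
  show ?thesis
  proof (cases "?\<alpha> = 0")
    case True
    have "?\<beta> = 0"
    proof (rule ccontr)
      \<comment> \<open>\<open>h\<close> is an involution, so this scalar would satisfy the right-hand side of \<open>key\<close> alone.\<close>
      assume "?\<beta> \<noteq> 0"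
      then show False using key[of "h (1 / ?\<beta>)"] True by (simp add: hs)
    qed
    then show ?thesis using True by (simp add: hs)
  next
    case False
    then have "h (1 / ?\<alpha>) * ?\<beta> = 1" using key[of "1 / ?\<alpha>"] by simp
    moreover have "h ?\<alpha> \<noteq> 0" using False real_automorphism_inj[OF h(1), of ?\<alpha> 0] by (simp add: hs)
    ultimately show ?thesis by (simp add: hs)
  qed
qed

text \<open>The two cases differ only in the factor of the dyads that \<open>U\<close> acts on. Here \<open>M u v\<close> is \<open>u \<otimes> v\<close> or \<open>v \<otimes> u\<close>,
\<open>p\<close> is the pairing of the factors, and \<open>act a\<close> is \<open>a\<close> or its adjoint.

\<open>U\<close> is read off from the images of \<open>M u v\<^sub>0\<close>. By the trace formula \<open>\<eta>(S(a)\<^sup>-\<^sup>1 U u) = h (p (a\<^sup>-\<^sup>1 u) v)\<close> whenever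
\<open>S (M u v) = U u \<otimes> \<eta>\<close>. To identify \<open>S(a)\<^sup>-\<^sup>1 U u\<close> with \<open>U (a\<^sup>-\<^sup>1 u)\<close> one also needs \<open>\<eta>(U u') = h (p u' v)\<close> for all
\<open>u'\<close>. That is the trace formula again, for an element of \<open>G\<close> whose image under \<open>S\<close> can be computed, namely a
perturbation of \<open>e\<close> by some \<open>M w v\<^sub>0\<close> whose inverse moves \<open>u\<close> to \<open>u'\<close>. All functionals \<open>\<eta>\<close> occur, so they separate.\<close>

lemma intertwining_operator:
  fixes M :: "'e::complex_normed_vector \<Rightarrow> 'f::real_normed_vector \<Rightarrow> ('x \<Rightarrow>\<^sub>C\<^sub>L 'x)"
    and p :: "'e \<Rightarrow> 'f \<Rightarrow> complex" and act :: "('x \<Rightarrow>\<^sub>C\<^sub>L 'x) \<Rightarrow> 'e \<Rightarrow> 'e"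
  assumes h: "real_automorphism h" "\<And>R c. dyadic R \<Longrightarrow> S (c *\<^sub>C R) = h c *\<^sub>C S R"
    and M_dyadic: "\<And>u v. dyadic (M u v)"
    and M_norm: "\<And>u v. norm (M u v) = norm u * norm v"
    and M_add: "\<And>u w v. M (u + w) v = M u v + M w v"
    and M_scale: "\<And>c u v. M (c *\<^sub>C u) v = c *\<^sub>C M u v"
    and p_add: "\<And>u w v. p (u + w) v = p u v + p w v"
    and p_scale: "\<And>c u v. p (c *\<^sub>C u) v = c * p u v"
    and act_add: "\<And>a u w. act a (u + w) = act a u + act a w"
    and act_id: "\<And>u. act cblinfun_id u = u"
    and act_inverse: "\<And>a a' u. inverse_ops a a' \<Longrightarrow> act a' (act a u) = u"
    and act_M: "\<And>k u w v. act (cblinfun_id + k *\<^sub>C M w v) u = u + (k * p u v) *\<^sub>C w"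
    and M_perturb: "\<And>u v. p u v \<noteq> 1 \<Longrightarrow> cblinfun_id - M u v \<in> G \<and>
      inverse_ops (cblinfun_id - M u v) (cblinfun_id + (1 / (1 - p u v)) *\<^sub>C M u v)"
    and trace: "\<And>a a' b u v y \<psi>. a \<in> G \<Longrightarrow> inverse_ops a a' \<Longrightarrow> inverse_ops (S a) b \<Longrightarrow>
      S (M u v) = dyad y \<psi> \<Longrightarrow> cblinfun_apply \<psi> (cblinfun_apply b y) = h (p (act a' u) v)"
    and p_u1: "p u1 v0 = 1" and v0: "v0 \<noteq> 0" and \<psi>0: "\<psi>0 \<noteq> 0"
    and columns: "S ` range (\<lambda>u. M u v0) = column_dyads \<psi>0"
    and rows: "\<And>u y. u \<noteq> 0 \<Longrightarrow> S (M u v0) = dyad y \<psi>0 \<Longrightarrow> S ` range (M u) = row_dyads y"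
  shows "\<exists>U. invertible_operator U \<and> (bounded_clinear U \<or> bounded_conj_linear U) \<and>
    (\<forall>a\<in>G. \<forall>u. cblinfun_apply (S a) (U u) = U (act a u))"
proof -
  note hs = real_automorphism_simps[OF h(1)]
  have MA: "M u v \<in> A" for u v by (rule dyadic_in[OF M_dyadic])
  have p_minus: "p (u - w) v = p u v - p w v" for u w v
    using p_add[of "u - w" w v] by simp
  obtain U where U: "\<And>u. S (M u v0) = dyad (U u) \<psi>0"
  proof -
    have "\<forall>u. \<exists>y. S (M u v0) = dyad y \<psi>0" using columns by blast
    then show ?thesis using that by metis
  qed
  have U_add: "U (u + w) = U u + U w" for u w
  proof -
    have "dyad (U (u + w)) \<psi>0 = dyad (U u + U w) \<psi>0"
      using S_add[OF MA MA, of u v0 w v0] by (simp add: U dyad_linear flip: M_add)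
    then show ?thesis using dyad_left_inject[OF \<psi>0] by blast
  qed
  have U_scale: "U (c *\<^sub>C u) = h c *\<^sub>C U u" for c u
  proof -
    have "dyad (U (c *\<^sub>C u)) \<psi>0 = dyad (h c *\<^sub>C U u) \<psi>0"
      using h(2)[OF M_dyadic, of c u v0] by (simp add: U dyad_linear flip: M_scale)
    then show ?thesis using dyad_left_inject[OF \<psi>0] by blast
  qed
  have U_diff: "U (u - w) = U u - U w" for u w
    using U_add[of "u - w" w] by simp
  have nv: "0 < norm v0" "0 < norm \<psi>0" using v0 \<psi>0 by auto
  have U_surj: "\<exists>u. U u = y" for y
  proof -
    have "dyad y \<psi>0 \<in> S ` range (\<lambda>u. M u v0)" unfolding columns by blast
    then obtain u where "dyad y \<psi>0 = S (M u v0)" by blast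
    then show ?thesis using U[of u] dyad_left_inject[OF \<psi>0, of y "U u"] by (intro exI[of _ u]) simp
  qed
  have U_upper: "norm (U u) \<le> norm u * (norm E * norm v0 / norm \<psi>0)" for u
    using norm_S_le[OF MA, of u v0] nv by (simp add: U norm_dyad M_norm field_simps)
  have U_lower: "norm u \<le> norm (U u) * (norm (T cblinfun_id) * norm \<psi>0 / norm v0)" for u
    using norm_le_S[OF MA, of u v0] nv by (simp add: U norm_dyad M_norm field_simps)
  have U_inj: "u = w" if "U u = U w" for u w
    using U_lower[of "u - w"] that by (simp add: U_diff)
  have bij: "bij U"
    using U_inj U_surj unfolding bij_def inj_def surj_def by metis
  have U_scaleR: "U (r *\<^sub>R u) = r *\<^sub>R U u" for r u
    using U_scale[of "complex_of_real r" u] by (simp add: hs scaleC_of_real)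
  have bl: "bounded_linear U"
    by (rule bounded_linear_intro[OF U_add U_scaleR U_upper])
  have inv_U: "inv_into UNIV U (U u) = u" "U (inv_into UNIV U y) = y" for u y
    using bij by (simp_all add: bij_def surj_f_inv_f)
  have "bounded_linear (inv_into UNIV U)"
  proof (rule bounded_linear_intro)
    show "inv_into UNIV U (x + y) = inv_into UNIV U x + inv_into UNIV U y" for x y
      by (rule U_inj) (simp add: inv_U U_add)
    show "inv_into UNIV U (r *\<^sub>R x) = r *\<^sub>R inv_into UNIV U x" for r x
      by (rule U_inj) (simp add: inv_U U_scaleR)
    show "norm (inv_into UNIV U y) \<le> norm y * (norm (T cblinfun_id) * norm \<psi>0 / norm v0)" for y
      using U_lower[of "inv_into UNIV U y"] by (simp add: inv_U)
  qed
  then have inv: "invertible_operator U" using bij bl by (simp add: invertible_operator_def)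
  have lin: "bounded_clinear U \<or> bounded_conj_linear U"
    using h(1) bl U_scale by (auto simp: real_automorphism_def bounded_clinear_def bounded_conj_linear_def)

  have id_inv: "inverse_ops (S cblinfun_id) cblinfun_id"
    by (simp add: S_id inverse_ops_id)
  have \<psi>0_U: "cblinfun_apply \<psi>0 (U u) = h (p u v0)" for u
    using trace[OF dom.id_G inverse_ops_id id_inv U, of u] by (simp add: act_id)
  have pair: "cblinfun_apply \<eta> (U u) = h (p u v)"
    if u0: "p u0 v0 \<noteq> 0" and v: "S (M u0 v) = dyad (U u0) \<eta>" for u0 v \<eta> u
  proof -
    have main: "cblinfun_apply \<eta> (U u) = h (p u v)" if u: "p u v0 \<noteq> 0" for u
    proof -
      \<comment> \<open>Chosen so that the inverse of \<open>e - M w v\<^sub>0\<close>, which adds a multiple of \<open>w\<close>, takes \<open>u\<^sub>0\<close> to \<open>u\<close>.\<close>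
      define w where "w = (1 / p u v0) *\<^sub>C (u - u0)"
      define \<kappa> where "\<kappa> = p w v0"
      have \<kappa>: "1 - \<kappa> = p u0 v0 / p u v0"
        using u by (simp add: \<kappa>_def w_def p_scale p_minus field_simps)
      then have \<kappa>1: "\<kappa> \<noteq> 1" using u u0 by auto
      then have "h \<kappa> \<noteq> 1" using real_automorphism_inj[OF h(1), of \<kappa> 1] by (simp add: hs)
      let ?a = "cblinfun_id - M w v0" and ?a' = "cblinfun_id + (1 / (1 - \<kappa>)) *\<^sub>C M w v0"
      let ?b = "cblinfun_id + (1 / (1 - h \<kappa>)) *\<^sub>C dyad (U w) \<psi>0"
      have a: "?a \<in> G" "inverse_ops ?a ?a'"
        using M_perturb[of w v0] \<kappa>1 by (simp_all add: \<kappa>_def)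
      have Sa: "S ?a = cblinfun_id - dyad (U w) \<psi>0"
        using S_diff[OF dom.algebra_closed(2) MA] by (simp add: S_id U)
      have b: "inverse_ops (S ?a) ?b"
        unfolding Sa using inverse_ops_dyad[of \<psi>0 "U w"] \<open>h \<kappa> \<noteq> 1\<close> by (simp add: \<psi>0_U \<kappa>_def)
      have uw: "u = u0 + (p u0 v0 / (1 - \<kappa>)) *\<^sub>C w"
        unfolding \<kappa> using u u0 by (simp add: w_def scaleC_scaleC)
      have act_u: "act ?a' u0 = u"
        unfolding act_M using uw by simp
      have "cblinfun_apply ?b (U u0) = U u0 + (h (p u0 v0) / (1 - h \<kappa>)) *\<^sub>C U w"
        by (simp add: cblinfun_apply_arith \<psi>0_U scaleC_scaleC)
      also have "\<dots> = U (u0 + (p u0 v0 / (1 - \<kappa>)) *\<^sub>C w)"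
        by (simp add: U_add U_scale hs)
      finally have "cblinfun_apply ?b (U u0) = U u" using uw by simp
      then show ?thesis using trace[OF a b v] act_u by simp
    qed
    show ?thesis
    proof (cases "p u v0 = 0")
      case False
      then show ?thesis by (rule main)
    next
      case True
      then have "cblinfun_apply \<eta> (U (u + u0)) = h (p (u + u0) v)"
        using u0 by (intro main) (simp add: p_add)
      then show ?thesis using main[OF u0] by (simp add: U_add p_add hs cblinfun_apply_linear)
    qed
  qed
  have inverse_step: "cblinfun_apply b (U u) = U (act a' u)"
    if a: "a \<in> G" "inverse_ops a a'" "inverse_ops (S a) b" for a a' b u
  proof -
    have main: "cblinfun_apply b (U u) = U (act a' u)" if u: "p u v0 \<noteq> 0" for u
    proof (rule dual_eqI)
      fix \<eta> :: "'y dual"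
      have "u \<noteq> 0" using u p_scale[of 0 u v0] by (auto simp: complex_vector.scale_zero_left)
      from rows[OF this U] have "dyad (U u) \<eta> \<in> S ` range (M u)" by blast
      then obtain v where v: "S (M u v) = dyad (U u) \<eta>" by auto
      show "cblinfun_apply \<eta> (cblinfun_apply b (U u)) = cblinfun_apply \<eta> (U (act a' u))"
        using trace[OF a v] pair[OF u v] by simp
    qed
    show ?thesis
    proof (cases "p u v0 = 0")
      case False
      then show ?thesis by (rule main)
    next
      case True
      then have "cblinfun_apply b (U (u + u1)) = U (act a' (u + u1))"
        by (intro main) (simp add: p_add p_u1)
      moreover have "cblinfun_apply b (U u1) = U (act a' u1)"
        by (intro main) (simp add: p_u1)
      ultimately show ?thesis by (simp add: U_add act_add cblinfun_apply_linear)
    qed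
  qed
  have "cblinfun_apply (S a) (U u) = U (act a u)" if a: "a \<in> G" for a u
  proof -
    obtain a' where a': "inverse_ops a a'" using dom.inverse_G[OF a] by blast
    have "S a \<in> H" using S_in_H_iff[OF dom.G_in[OF a]] a by simp
    then obtain b where b: "inverse_ops (S a) b" using cod.inverse_G by blast
    have "cblinfun_apply b (U (act a u)) = U u"
      using inverse_step[OF a a' b, of "act a u"] act_inverse[OF a'] by simp
    then show ?thesis using inverse_ops_apply(1)[OF b, of "U (act a u)"] by simp
  qed
  then show ?thesis using inv lin by blast
qed

lemma S_conjugation_form:
  assumes nontrivial: "\<exists>x :: 'x. x \<noteq> 0"
  shows "(\<exists>U :: 'x \<Rightarrow> 'y. invertible_operator U \<and> (bounded_clinear U \<or> bounded_conj_linear U) \<and>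
      (\<forall>a\<in>G. \<forall>u. cblinfun_apply (S a) (U u) = U (cblinfun_apply a u))) \<or>
    (\<exists>V :: 'x dual \<Rightarrow> 'y. invertible_operator V \<and> (bounded_clinear V \<or> bounded_conj_linear V) \<and>
      (\<forall>a\<in>G. \<forall>u. cblinfun_apply (S a) (V u) = V (u o\<^sub>C\<^sub>L a)))"
proof -
  obtain h where h: "real_automorphism h" "\<And>R c. dyadic R \<Longrightarrow> S (c *\<^sub>C R) = h c *\<^sub>C S R"
    by (rule S_semilinear_on_dyads) blast
  obtain x0 :: 'x where x0: "x0 \<noteq> 0" using nontrivial by blast
  obtain \<phi>0 :: "'x dual" where \<phi>0x0: "cblinfun_apply \<phi>0 x0 = 1" using dual_separates[OF x0] by blast
  then have \<phi>0: "\<phi>0 \<noteq> 0" by (auto simp: cblinfun_apply_arith)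
  obtain y0 \<psi>0 where S0: "S (dyad x0 \<phi>0) = dyad y0 \<psi>0" by (rule S_dyadE)
  have "dyad y0 \<psi>0 \<noteq> 0"
    using S_eq_0_iff[of "dyad x0 \<phi>0"] S0 x0 \<phi>0 by (simp add: dom.algebra_closed dyad_eq_0_iff)
  then have \<psi>0: "\<psi>0 \<noteq> 0" by (auto simp: dyad_eq_0_iff)
  from S_columns_rows[OF x0 \<phi>0 S0] show ?thesis
  proof
    assume cr: "S ` column_dyads \<phi>0 = column_dyads \<psi>0 \<and> S ` row_dyads x0 = row_dyads y0"
    have "\<exists>U. invertible_operator U \<and> (bounded_clinear U \<or> bounded_conj_linear U) \<and>
      (\<forall>a\<in>G. \<forall>u. cblinfun_apply (S a) (U u) = U (cblinfun_apply a u))"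
    proof (rule intertwining_operator[OF h, where M = dyad and p = "\<lambda>u v. cblinfun_apply v u" and ?u1.0 = x0 and ?v0.0 = \<phi>0 and ?\<psi>0.0 = \<psi>0])
      show "S ` range (dyad u) = row_dyads y" if "u \<noteq> 0" "S (dyad u \<phi>0) = dyad y \<psi>0" for u y
        using S_rows_of_columns[OF that(1) \<phi>0 that(2)] cr by blast
      show "cblinfun_apply \<psi> (cblinfun_apply b y) = h (cblinfun_apply v (cblinfun_apply a' u))"
        if "a \<in> G" "inverse_ops a a'" "inverse_ops (S a) b" "S (dyad u v) = dyad y \<psi>" for a a' b u v y \<psi>
        by (rule trace_formula[OF h that])
    qed (use cr \<phi>0 \<psi>0 \<phi>0x0 in \<open>simp_all add: norm_dyad dyad_linear cblinfun_apply_linear cblinfun_apply_arith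
        inverse_ops_apply scaleC_complex_def scaleC_scaleC inverse_ops_dyad dom.id_minus_dyad_G\<close>)
    then show ?thesis by blast
  next
    assume cr: "S ` column_dyads \<phi>0 = row_dyads y0 \<and> S ` row_dyads x0 = column_dyads \<psi>0"
    have "\<exists>V :: 'x dual \<Rightarrow> 'y. invertible_operator V \<and> (bounded_clinear V \<or> bounded_conj_linear V) \<and>
      (\<forall>a\<in>G. \<forall>u. cblinfun_apply (S a) (V u) = V (u o\<^sub>C\<^sub>L a))"
    proof (rule intertwining_operator[OF h, where M = "\<lambda>u v. dyad v u" and p = cblinfun_apply and act = "\<lambda>a u. u o\<^sub>C\<^sub>L a" and ?u1.0 = \<phi>0 and ?v0.0 = x0 and ?\<psi>0.0 = \<psi>0])
      show "S ` range (\<lambda>v. dyad v u) = row_dyads y" if "u \<noteq> 0" "S (dyad x0 u) = dyad y \<psi>0" for u y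
        using S_columns_of_rows[OF x0 that(1) that(2)] cr by blast
      show "cblinfun_apply \<psi> (cblinfun_apply b y) = h (cblinfun_apply (u o\<^sub>C\<^sub>L a') v)"
        if "a \<in> G" "inverse_ops a a'" "inverse_ops (S a) b" "S (dyad v u) = dyad y \<psi>" for a a' b u v y \<psi>
        using trace_formula[OF h that] by simp
      show "u o\<^sub>C\<^sub>L a o\<^sub>C\<^sub>L a' = u" if "inverse_ops a a'" for a a' and u :: "'x dual"
        using that by (simp add: inverse_ops_def cblinfun_compose_algebra flip: cblinfun_compose_algebra(7))
    qed (use cr x0 \<psi>0 \<phi>0x0 in \<open>simp_all add: norm_dyad dyad_linear cblinfun_apply_arith mult.commute
        cblinfun_compose_algebra functional_compose_dyad scaleC_complex_def scaleC_scaleC inverse_ops_dyad dom.id_minus_dyad_G\<close>)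
    then show ?thesis by blast
  qed
qed

end

lemma invertible_group_mult: "x \<otimes>\<^bsub>invertible_group C\<^esub> y = x o\<^sub>C\<^sub>L y"
  by (simp add: invertible_group_def units_of_def)

context extended_isometry
begin

section \<open>Products and the full groups of invertible elements\<close>

text \<open>\<open>P\<close> is the product in either order. Writing both factors as differences of elements of \<open>G\<close> reduces the claim to
\<open>G\<close>, as \<open>P\<close> is additive in each argument.\<close>

lemma D_product:
  assumes P: "\<And>x y z. P (x - y) z = P x z - P y z" "\<And>x y z. P z (x - y) = P z x - P z y"
    and T: "\<And>a b. a \<in> G \<Longrightarrow> b \<in> G \<Longrightarrow> T (a o\<^sub>C\<^sub>L b) = P (T a) (T b)"
    and ab: "a \<in> A" "b \<in> A"
  shows "D (a o\<^sub>C\<^sub>L b) = P (D a) (D b)"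
proof -
  obtain g k where a: "g \<in> G" "k \<in> G" "a = g - k" using dom.G_spans[OF ab(1)] .
  obtain m n where b: "m \<in> G" "n \<in> G" "b = m - n" using dom.G_spans[OF ab(2)] .
  have D_G: "D (u o\<^sub>C\<^sub>L v) = P (D u) (D v)" if "u \<in> G" "v \<in> G" for u v
    using T[OF that] T_eq[OF that(1)] T_eq[OF that(2)] T_eq[OF dom.compose_G[OF that]] by simp
  have A: "g \<in> A" "k \<in> A" "m \<in> A" "n \<in> A" using a b dom.G_in by auto
  note closed = dom.algebra_closed(4,6)
  have "D (a o\<^sub>C\<^sub>L b) = D ((g o\<^sub>C\<^sub>L m - g o\<^sub>C\<^sub>L n) - (k o\<^sub>C\<^sub>L m - k o\<^sub>C\<^sub>L n))"
    by (simp add: a(3) b(3) cblinfun_compose_algebra(2,5)) (simp add: algebra_simps)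
  also have "\<dots> = (D (g o\<^sub>C\<^sub>L m) - D (g o\<^sub>C\<^sub>L n)) - (D (k o\<^sub>C\<^sub>L m) - D (k o\<^sub>C\<^sub>L n))"
    using A by (simp add: D_diff closed)
  also have "\<dots> = P (D a) (D b)"
    using A a(1,2) b(1,2) by (simp add: D_G a(3) b(3) D_diff P algebra_simps)
  finally show ?thesis .
qed

lemma D_bij_units:
  assumes P: "P = (o\<^sub>C\<^sub>L) \<or> P = (\<lambda>x y. y o\<^sub>C\<^sub>L x)"
    and prod: "\<And>a b. a \<in> A \<Longrightarrow> b \<in> A \<Longrightarrow> D (a o\<^sub>C\<^sub>L b) = P (D a) (D b)"
    and id: "D cblinfun_id = cblinfun_id"
  shows "bij_betw D dom.units cod.units"
proof -
  have inv: "inverse_ops (D a) (D b) \<longleftrightarrow> inverse_ops a b" if "a \<in> A" "b \<in> A" for a b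
  proof -
    have eq: "D (u o\<^sub>C\<^sub>L v) = cblinfun_id \<longleftrightarrow> u o\<^sub>C\<^sub>L v = cblinfun_id" if "u \<in> A" "v \<in> A" for u v
      using D_inj[of "u o\<^sub>C\<^sub>L v" cblinfun_id] that id dom.algebra_closed by auto
    show ?thesis
      using P eq[OF that] eq[OF that(2,1)] prod[OF that] prod[OF that(2,1)]
      by (auto simp: inverse_ops_def)
  qed
  have "D ` dom.units = cod.units"
  proof (intro equalityI subsetI)
    fix y assume "y \<in> D ` dom.units"
    then obtain a b where "a \<in> A" "b \<in> A" "inverse_ops a b" "y = D a" by (auto simp: dom.units_def)
    then show "y \<in> cod.units" using inv D_image by (auto simp: cod.units_def)
  next
    fix y assume "y \<in> cod.units"
    then obtain z where z: "y \<in> B" "z \<in> B" "inverse_ops y z" by (auto simp: cod.units_def)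
    then obtain a b where ab: "a \<in> A" "y = D a" "b \<in> A" "z = D b" using D_image by blast
    then have "a \<in> dom.units" using inv z by (auto simp: dom.units_def)
    then show "y \<in> D ` dom.units" using ab by blast
  qed
  moreover have "inj_on D dom.units" using D_inj by (auto simp: inj_on_def dom.units_def)
  ultimately show ?thesis by (simp add: bij_betw_def)
qed

lemma D_norm_isometry: "norm_isometry_on dom.units D"
  unfolding norm_isometry_on_def
proof (intro ballI)
  fix x y assume "x \<in> dom.units" "y \<in> dom.units"
  then have "x \<in> A" "y \<in> A" by (auto simp: dom.units_def)
  then show "norm (D x - D y) = norm (x - y)"
    using D_norm[of "x - y"] D_diff[of x y] dom.algebra_closed(4)[of x y] by simp
qed

lemma isometrically_isomorphic_if_multiplicative:
  assumes id: "T cblinfun_id = cblinfun_id"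
    and T: "\<And>a b. a \<in> G \<Longrightarrow> b \<in> G \<Longrightarrow> T (a o\<^sub>C\<^sub>L b) = T a o\<^sub>C\<^sub>L T b"
  shows "isometrically_isomorphic (invertible_group A) (invertible_group B)"
proof -
  have prod: "D (a o\<^sub>C\<^sub>L b) = D a o\<^sub>C\<^sub>L D b" if "a \<in> A" "b \<in> A" for a b
    by (rule D_product[OF _ _ T that]) (simp_all add: cblinfun_compose_algebra)
  have bij: "bij_betw D dom.units cod.units"
    by (rule D_bij_units[OF disjI1[OF refl] prod]) (use id T_eq[OF dom.id_G] in simp_all)
  then have "D \<in> iso (invertible_group A) (invertible_group B)"
    unfolding iso_def hom_def
    by (auto simp: dom.carrier_invertible_group cod.carrier_invertible_group invertible_group_mult
        dom.units_def intro!: prod dest: bij_betwE)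
  then show ?thesis
    unfolding isometrically_isomorphic_def dom.carrier_invertible_group using D_norm_isometry by blast
qed

lemma isometrically_anti_isomorphic_if_antimultiplicative:
  assumes id: "T cblinfun_id = cblinfun_id"
    and T: "\<And>a b. a \<in> G \<Longrightarrow> b \<in> G \<Longrightarrow> T (a o\<^sub>C\<^sub>L b) = T b o\<^sub>C\<^sub>L T a"
  shows "isometrically_anti_isomorphic (invertible_group A) (invertible_group B)"
proof -
  have prod: "D (a o\<^sub>C\<^sub>L b) = D b o\<^sub>C\<^sub>L D a" if "a \<in> A" "b \<in> A" for a b
    by (rule D_product[where P = "\<lambda>x y. y o\<^sub>C\<^sub>L x", OF _ _ T that]) (simp_all add: cblinfun_compose_algebra)
  have bij: "bij_betw D dom.units cod.units"
    by (rule D_bij_units[OF disjI2[OF refl] prod]) (use id T_eq[OF dom.id_G] in simp_all)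
  then have "D \<in> anti_iso (invertible_group A) (invertible_group B)"
    unfolding anti_iso_def
    by (auto simp: dom.carrier_invertible_group cod.carrier_invertible_group invertible_group_mult
        dom.units_def intro!: prod)
  then show ?thesis
    unfolding isometrically_anti_isomorphic_def dom.carrier_invertible_group using D_norm_isometry by blast
qed

lemma T_eq_S: "a \<in> G \<Longrightarrow> T a = T cblinfun_id o\<^sub>C\<^sub>L S a"
  using D_eq T_eq by simp

text \<open>A zero space has a single operator, so \<open>H\<close> has a single element, although it contains \<open>e\<close> and \<open>2 e\<close>.\<close>

lemma trivial_codomain:
  assumes X: "\<And>x :: 'x. x = 0"
  shows "(y :: 'y) = 0"
proof -
  have all: "T a = T b" for a b
    by (rule arg_cong[of _ _ T], rule cblinfun_eqI) (metis X)
  have "(2 :: complex) *\<^sub>C cblinfun_id \<in> H" using cod.scalar_mult_G[OF cod.id_G] by simp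
  then obtain a b where "cblinfun_id = T a" "2 *\<^sub>C cblinfun_id = T b"
    using cod.id_G T_onto by (metis imageE)
  then have "2 *\<^sub>C cblinfun_id = (cblinfun_id :: 'y \<Rightarrow>\<^sub>C\<^sub>L 'y)" using all by metis
  then have "cblinfun_apply (2 *\<^sub>C cblinfun_id) y = cblinfun_apply cblinfun_id y" by (rule arg_cong)
  then have "2 *\<^sub>C y = y" by (simp add: cblinfun_apply_arith)
  then have "y + y = y" using scaleC_add_left[of 1 1 y] by simp
  then show ?thesis by simp
qed

text \<open>On a zero space there is no nonzero dyad to start from, but then both spaces are zero and every formula holds.\<close>

lemma representation:
  "(\<exists>U :: 'x \<Rightarrow> 'y.
      invertible_operator U \<and> (bounded_clinear U \<or> bounded_conj_linear U) \<and>
      (\<forall>a\<in>G. cblinfun_apply (T a) =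
        cblinfun_apply (T cblinfun_id) \<circ> U \<circ> cblinfun_apply a \<circ> inv_into UNIV U)) \<or>
   (\<exists>V :: 'x dual \<Rightarrow> 'y.
      invertible_operator V \<and> (bounded_clinear V \<or> bounded_conj_linear V) \<and>
      (\<forall>a\<in>G. cblinfun_apply (T a) =
        cblinfun_apply (T cblinfun_id) \<circ> V \<circ> cblinfun_apply (cblinfun_adjoint a) \<circ> inv_into UNIV V))"
proof (cases "\<exists>x :: 'x. x \<noteq> 0")
  case False
  then have X: "x = 0" for x :: 'x by blast
  note Y = trivial_codomain[OF X]
  let ?U = "\<lambda>x :: 'x. 0 :: 'y"
  have "inj ?U" by (rule injI) (rule trans[OF X X[symmetric]])
  moreover have "surj ?U" by (rule surjI[where f = "\<lambda>_. 0"]) (rule Y[symmetric])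
  ultimately have "bij ?U" by (simp add: bij_def)
  moreover have "bounded_linear (inv_into UNIV ?U)"
    by (rule bounded_linear_intro[where K = 0]; subst X; simp add: X[of "_ + _"] X[of "_ *\<^sub>R _"])
  ultimately have "invertible_operator ?U" by (simp add: invertible_operator_def bounded_linear_zero)
  moreover have "bounded_clinear ?U" by (simp add: bounded_clinear_def bounded_linear_zero)
  moreover have "cblinfun_apply (T a) = cblinfun_apply (T cblinfun_id) \<circ> ?U \<circ> cblinfun_apply a \<circ> inv_into UNIV ?U" for a
  proof (rule ext)
    fix y
    show "cblinfun_apply (T a) y = (cblinfun_apply (T cblinfun_id) \<circ> ?U \<circ> cblinfun_apply a \<circ> inv_into UNIV ?U) y"
      using Y[of "cblinfun_apply (T a) y"] by (simp add: cblinfun_apply_linear)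
  qed
  ultimately show ?thesis by blast
next
  case True
  have form: "cblinfun_apply (T a) = cblinfun_apply (T cblinfun_id) \<circ> W \<circ> f \<circ> inv_into UNIV W"
    if a: "a \<in> G" and W: "invertible_operator W" and f: "\<And>u. cblinfun_apply (S a) (W u) = W (f u)" for a W f
  proof (rule ext)
    fix y
    have "W (inv_into UNIV W y) = y"
      using W by (simp add: invertible_operator_def bij_is_surj surj_f_inv_f)
    then have "cblinfun_apply (S a) y = W (f (inv_into UNIV W y))" using f by metis
    then show "cblinfun_apply (T a) y = (cblinfun_apply (T cblinfun_id) \<circ> W \<circ> f \<circ> inv_into UNIV W) y"
      using T_eq_S[OF a] by simp
  qed
  from S_conjugation_form[OF True] show ?thesis
  proof
    assume "\<exists>U :: 'x \<Rightarrow> 'y. invertible_operator U \<and> (bounded_clinear U \<or> bounded_conj_linear U) \<and>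
      (\<forall>a\<in>G. \<forall>u. cblinfun_apply (S a) (U u) = U (cblinfun_apply a u))"
    then obtain U :: "'x \<Rightarrow> 'y" where U: "invertible_operator U" "bounded_clinear U \<or> bounded_conj_linear U"
      "\<And>a u. a \<in> G \<Longrightarrow> cblinfun_apply (S a) (U u) = U (cblinfun_apply a u)" by blast
    show ?thesis
      by (rule disjI1, rule exI[of _ U]) (intro conjI ballI U(1,2) form U(3))
  next
    assume "\<exists>V :: 'x dual \<Rightarrow> 'y. invertible_operator V \<and> (bounded_clinear V \<or> bounded_conj_linear V) \<and>
      (\<forall>a\<in>G. \<forall>u. cblinfun_apply (S a) (V u) = V (u o\<^sub>C\<^sub>L a))"
    then obtain V :: "'x dual \<Rightarrow> 'y" where V: "invertible_operator V" "bounded_clinear V \<or> bounded_conj_linear V"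
      "\<And>a u. a \<in> G \<Longrightarrow> cblinfun_apply (S a) (V u) = V (cblinfun_apply (cblinfun_adjoint a) u)" by auto
    show ?thesis
      by (rule disjI2, rule exI[of _ V]) (intro conjI ballI V(1,2) form V(3))
  qed
qed

lemma multiplicative_or_antimultiplicative:
  assumes id: "T cblinfun_id = cblinfun_id"
  shows "(\<forall>a\<in>G. \<forall>b\<in>G. T (a o\<^sub>C\<^sub>L b) = T a o\<^sub>C\<^sub>L T b) \<or> (\<forall>a\<in>G. \<forall>b\<in>G. T (a o\<^sub>C\<^sub>L b) = T b o\<^sub>C\<^sub>L T a)"
  using representation
proof
  assume "\<exists>U :: 'x \<Rightarrow> 'y. invertible_operator U \<and> (bounded_clinear U \<or> bounded_conj_linear U) \<and>
      (\<forall>a\<in>G. cblinfun_apply (T a) =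
        cblinfun_apply (T cblinfun_id) \<circ> U \<circ> cblinfun_apply a \<circ> inv_into UNIV U)"
  then obtain U :: "'x \<Rightarrow> 'y" where "invertible_operator U"
    and U: "\<And>a y. a \<in> G \<Longrightarrow> cblinfun_apply (T a) y = U (cblinfun_apply a (inv_into UNIV U y))"
    using id by auto
  then have inv: "inv_into UNIV U (U x) = x" for x
    by (simp add: invertible_operator_def bij_is_inj)
  have "T (a o\<^sub>C\<^sub>L b) = T a o\<^sub>C\<^sub>L T b" if "a \<in> G" "b \<in> G" for a b
    by (rule cblinfun_eqI) (simp add: U that dom.compose_G inv)
  then show ?thesis by blast
next
  assume "\<exists>V :: 'x dual \<Rightarrow> 'y. invertible_operator V \<and> (bounded_clinear V \<or> bounded_conj_linear V) \<and>
      (\<forall>a\<in>G. cblinfun_apply (T a) =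
        cblinfun_apply (T cblinfun_id) \<circ> V \<circ> cblinfun_apply (cblinfun_adjoint a) \<circ> inv_into UNIV V)"
  then obtain V :: "'x dual \<Rightarrow> 'y" where "invertible_operator V"
    and V: "\<And>a y. a \<in> G \<Longrightarrow> cblinfun_apply (T a) y = V (inv_into UNIV V y o\<^sub>C\<^sub>L a)"
    using id by auto
  then have inv: "inv_into UNIV V (V x) = x" for x
    by (simp add: invertible_operator_def bij_is_inj)
  have "T (a o\<^sub>C\<^sub>L b) = T b o\<^sub>C\<^sub>L T a" if "a \<in> G" "b \<in> G" for a b
    by (rule cblinfun_eqI) (simp add: V that dom.compose_G inv cblinfun_compose_algebra)
  then show ?thesis by blast
qed

end

lemma (in group_isometry) obtain_extension:
  obtains D E where "extended_isometry A G B H T D E"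
proof -
  obtain D where D: "additive_isometry A B D" "\<And>a. a \<in> G \<Longrightarrow> T a = D a"
    using extends_to_additive_isometry by blast
  obtain E where E: "inverse_ops (T cblinfun_id) E" using cod.inverse_G[OF T_in[OF dom.id_G]] by blast
  have "extended_isometry A G B H T D E"
    by unfold_locales (use D E in auto)
  then show ?thesis by (rule that)
qed

theorem corollary5p4:
  fixes A GA :: "('x::complex_banach \<Rightarrow>\<^sub>C\<^sub>L 'x) set"
    and B GB :: "('y::complex_banach \<Rightarrow>\<^sub>C\<^sub>L 'y) set"
    and T :: "('x \<Rightarrow>\<^sub>C\<^sub>L 'x) \<Rightarrow> ('y \<Rightarrow>\<^sub>C\<^sub>L 'y)"
  assumes "unital_closed_subalgebra A" and "\<And>f. finite_rank f \<Longrightarrow> f \<in> A"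
    and "unital_closed_subalgebra B" and "\<And>g. finite_rank g \<Longrightarrow> g \<in> B"
    and "open_subgroup GA (invertible_group A)"
    and "open_subgroup GB (invertible_group B)"
    and "T ` GA = GB"
    and "norm_isometry_on GA T"
  shows
    "((\<exists>U :: 'x \<Rightarrow> 'y.
         invertible_operator U \<and> (bounded_clinear U \<or> bounded_conj_linear U) \<and>
         (\<forall>a\<in>GA. cblinfun_apply (T a) =
            cblinfun_apply (T cblinfun_id) \<circ> U \<circ> cblinfun_apply a \<circ> inv_into UNIV U)) \<or>
      (\<exists>V :: 'x dual \<Rightarrow> 'y.
         invertible_operator V \<and> (bounded_clinear V \<or> bounded_conj_linear V) \<and>
         (\<forall>a\<in>GA. cblinfun_apply (T a) =
            cblinfun_apply (T cblinfun_id) \<circ> V \<circ> cblinfun_apply (cblinfun_adjoint a) \<circ> inv_into UNIV V)))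
     \<and>
     (T cblinfun_id = cblinfun_id \<longrightarrow>
        ((\<forall>a\<in>GA. \<forall>b\<in>GA. T (a o\<^sub>C\<^sub>L b) = T a o\<^sub>C\<^sub>L T b) \<or>
         (\<forall>a\<in>GA. \<forall>b\<in>GA. T (a o\<^sub>C\<^sub>L b) = T b o\<^sub>C\<^sub>L T a)) \<and>
        ((\<forall>a\<in>GA. \<forall>b\<in>GA. T (a o\<^sub>C\<^sub>L b) = T a o\<^sub>C\<^sub>L T b) \<longrightarrow>
           isometrically_isomorphic (invertible_group A) (invertible_group B)) \<and>
        ((\<forall>a\<in>GA. \<forall>b\<in>GA. T (a o\<^sub>C\<^sub>L b) = T b o\<^sub>C\<^sub>L T a) \<longrightarrow>
           isometrically_anti_isomorphic (invertible_group A) (invertible_group B)))"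
proof -
  interpret group_isometry A GA B GB T
    by unfold_locales (fact assms)+
  obtain D E where "extended_isometry A GA B GB T D E" by (rule obtain_extension)
  then interpret extended_isometry A GA B GB T D E .
  show ?thesis
    using representation multiplicative_or_antimultiplicative
      isometrically_isomorphic_if_multiplicative isometrically_anti_isomorphic_if_antimultiplicative
    by (intro conjI impI) (blast+)
qed

end
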